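(* Let $q>0$, $a_1\le a_2$, $x_1\le x_2\le a_2$. Let $X$ be a Lévy process on $\mathbb{R}$ for which there exist $\mu_-<0<\mu_+$ such that for all $\gamma\in[\mu_-,\mu_+]$, $\mathbb{E}[e^{-\gamma X_1}]<\infty$ and $q+\psi(i\gamma)>0$. Assume that the Wiener–Hopf factors admit the representations $\phi^\pm_q=a^\pm_q+\phi^{\pm\pm}_q$ with $a^\pm_q\ge0$ and $$|\phi^{++}_q(\xi)|\le C_+(q)(1+|\xi|)^{-\nu_+},\ \Im\xi\ge\mu_-;\qquad |\phi^{--}_q(\xi)|\le C_-(q)(1+|\xi|)^{-\nu_-},\ \Im\xi\le\mu_+,$$ where $\nu_\pm>0$ and $C_\pm(q)>0$ are independent of $\xi$. Let $$V(T,x_1,x_2)=\mathbb{Q}\big[x_1+X_T\le a_1,\ \max\{x_2,x_1+\bar X_T\}\le a_2\big],\qquad \tilde V(q,x_1,x_2)=\int_0^\infty e^{-qT}V(T,x_1,x_2)\,dT.$$ Then, for any $\mu_-<\omega_-<0<\omega_1<\mu_+$, $$\tilde V(q,x_1,x_2)=\frac{1}{2\pi}\int_{\Im\xi_1=\omega_1}\frac{e^{i(x_1-a_1)\xi_1}}{-i\xi_1(q+\psi(\xi_1))}\,d\xi_1+\frac{1}{(2\pi)^2q}\int_{\Im\eta=\omega_-}d\eta\,e^{i(x_1-a_2)\eta}\phi^{++}_q(\eta)\int_{\Im\xi_1=\omega_1}d\xi_1\,\frac{e^{i\xi_1(a_2-a_1)}\phi^{--}_q(\xi_1)}{\xi_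1(\xi_1-\eta)}.$$
   Context: $X=(X_t)_{t\ge0}$ is a one-dimensional Lévy process with $X_0=0$ under a probability $\mathbb{Q}$ with expectation $\mathbb{E}$, and characteristic exponent $\psi$ defined by $\mathbb{E}[e^{i\xi X_t}]=e^{-t\psi(\xi)}$. Put $\bar X_t=\sup_{0\le s\le t}X_s$, $\underline X_t=\inf_{0\le s\le t}X_s$. For $q>0$, $T_q$ is an exponentially distributed random variable of mean $1/q$ independent of $X$. The Wiener–Hopf factors are $\phi^+_q(\xi)=\mathbb{E}[e^{i\xi\bar X_{T_q}}]$ and $\phi^-_q(\xi)=\mathbb{E}[e^{i\xi\underline X_{T_q}}]$; they satisfy $\phi^+_q\phi^-_q=q/(q+\psi)$, and under the stated moment conditions $\phi^+_q$ (resp. $\phi^-_q$) continues analytically to $\{\Im\xi\ge\mu_-\}$ (resp. $\{\Im\xi\le\mu_+\}$), i.e. analytic in the interior and continuous up to the boundary.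
   Formalization: The case x_1=a_1 with both a^+_q>0 and a^-_q>0 is excluded: there the first integral diverges and its principal value gives a wrong formula (e.g. X=0, x_1=x_2=a_1=a_2); the integrals are read as improper integrals along the lines. *)

theory Defs
  imports "HOL-Probability.Probability"
begin

definition cadlag :: "(real \<Rightarrow> real) \<Rightarrow> bool" where
  "cadlag f \<longleftrightarrow>
     (\<forall>t\<ge>0. (f \<longlongrightarrow> f t) (at_right t)) \<and>
     (\<forall>t>0. \<exists>l. (f \<longlongrightarrow> l) (at_left t))"

text \<open>Only times \<open>t \<ge> 0\<close> matter.  All paths are cadlag, as on the canonical path space, so that
  the running extrema are random variables even if the measure is not complete.\<close>

definition levy_process :: "'a measure \<Rightarrow> (real \<Rightarrow> 'a \<Rightarrow> real) \<Rightarrow> bool" where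
  "levy_process M X \<longleftrightarrow>
     prob_space M \<and>
     (\<forall>t\<ge>0. X t \<in> borel_measurable M) \<and>
     (AE \<omega> in M. X 0 \<omega> = 0) \<and>
     (\<forall>\<omega>\<in>space M. cadlag (\<lambda>t. X t \<omega>)) \<and>
     (\<forall>(n::nat) (t::nat \<Rightarrow> real). 0 \<le> t 0 \<longrightarrow> (\<forall>i<n. t i \<le> t (Suc i)) \<longrightarrow>
        prob_space.indep_vars M (\<lambda>_. borel) (\<lambda>i \<omega>. X (t (Suc i)) \<omega> - X (t i) \<omega>) {..<n}) \<and>
     (\<forall>s\<ge>0. \<forall>t\<ge>0. distr M borel (\<lambda>\<omega>. X (s + t) \<omega> - X s \<omega>) = distr M borel (X t))"

definition indep_of_process :: "'a measure \<Rightarrow> (real \<Rightarrow> 'a \<Rightarrow> real) \<Rightarrow> ('a \<Rightarrow> real) \<Rightarrow> bool" where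
  "indep_of_process M X T \<longleftrightarrow>
     prob_space.indep_set M
       (sigma_sets (space M) {X t -` A \<inter> space M | t A. 0 \<le> t \<and> A \<in> sets borel})
       {T -` A \<inter> space M | A. A \<in> sets borel}"

text \<open>The equation for all \<open>t \<ge> 0\<close> has at most one solution \<open>z\<close> (differentiate at \<open>t = 0\<close>), so no
  choice of a branch of the logarithm is needed; it has one whenever
  \<open>exp (- Im \<xi> * X 1)\<close> is integrable.\<close>

definition char_exponent :: "'a measure \<Rightarrow> (real \<Rightarrow> 'a \<Rightarrow> real) \<Rightarrow> complex \<Rightarrow> complex" where
  "char_exponent M X \<xi> =
     (THE z. \<forall>t\<ge>0. (LINT \<omega>|M. exp (\<i> * \<xi> * of_real (X t \<omega>))) = exp (- of_real t * z))"

definition running_max :: "(real \<Rightarrow> 'a \<Rightarrow> real) \<Rightarrow> real \<Rightarrow> 'a \<Rightarrow> real" where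
  "running_max X t \<omega> = (SUP s\<in>{0..t}. X s \<omega>)"

definition running_min :: "(real \<Rightarrow> 'a \<Rightarrow> real) \<Rightarrow> real \<Rightarrow> 'a \<Rightarrow> real" where
  "running_min X t \<omega> = (INF s\<in>{0..t}. X s \<omega>)"

text \<open>The Wiener-Hopf factors are defined for complex \<open>\<xi>\<close> by the same expectation as for real
  \<open>\<xi>\<close>.  Wherever the expectation converges absolutely on a half-plane, this is the analytic
  continuation (continuous up to the boundary).\<close>

definition wh_plus :: "'a measure \<Rightarrow> (real \<Rightarrow> 'a \<Rightarrow> real) \<Rightarrow> ('a \<Rightarrow> real) \<Rightarrow> complex \<Rightarrow> complex" where
  "wh_plus M X T \<xi> = (LINT \<omega>|M. exp (\<i> * \<xi> * of_real (running_max X (T \<omega>) \<omega>)))"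

definition wh_minus :: "'a measure \<Rightarrow> (real \<Rightarrow> 'a \<Rightarrow> real) \<Rightarrow> ('a \<Rightarrow> real) \<Rightarrow> complex \<Rightarrow> complex" where
  "wh_minus M X T \<xi> = (LINT \<omega>|M. exp (\<i> * \<xi> * of_real (running_min X (T \<omega>) \<omega>)))"

definition joint_V ::
  "'a measure \<Rightarrow> (real \<Rightarrow> 'a \<Rightarrow> real) \<Rightarrow> real \<Rightarrow> real \<Rightarrow> real \<Rightarrow> real \<Rightarrow> real \<Rightarrow> real" where
  "joint_V M X a1 a2 t x1 x2 =
     measure M {\<omega> \<in> space M. x1 + X t \<omega> \<le> a1 \<and> max x2 (x1 + running_max X t \<omega>) \<le> a2}"

definition joint_V_laplace ::
  "'a measure \<Rightarrow> (real \<Rightarrow> 'a \<Rightarrow> real) \<Rightarrow> real \<Rightarrow> real \<Rightarrow> real \<Rightarrow> real \<Rightarrow> real \<Rightarrow> real" where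
  "joint_V_laplace M X a1 a2 q x1 x2 =
     (LBINT t:{0..}. exp (- q * t) * joint_V M X a1 a2 t x1 x2)"

text \<open>Integrals over the line \<open>Im \<xi> = w\<close>, oriented from left to right.  On \<open>UNIV\<close> the
  Henstock-Kurzweil integral includes conditionally convergent improper integrals (with
  independent limits at the two ends), for which the Lebesgue integral would not exist.\<close>

definition line_integrable :: "real \<Rightarrow> (complex \<Rightarrow> complex) \<Rightarrow> bool" where
  "line_integrable w f \<longleftrightarrow> (\<lambda>u. f (Complex u w)) integrable_on UNIV"

definition line_integral :: "real \<Rightarrow> (complex \<Rightarrow> complex) \<Rightarrow> complex" where
  "line_integral w f = integral UNIV (\<lambda>u. f (Complex u w))"

end

theory Submission
  imports Defs "HOL-Real_Asymp.Real_Asymp"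
begin

text \<open>
  Put \<open>h = a1 - x1\<close> and \<open>b = a2 - x1\<close>, so that \<open>h \<le> b\<close> and \<open>b \<ge> 0\<close>.  Because \<open>x2 \<le> a2\<close>, the
  number \<open>q\<close> times the Laplace transform is the probability that, at an independent exponential time
  of rate \<open>q\<close>, the process is at most \<open>h\<close> and its maximum at most \<open>b\<close>.  This is
  \<open>P(M + N \<le> h) - P(b < M, M + N \<le> h)\<close>, where \<open>M\<close> is the maximum and \<open>N \<le> 0\<close> is the position relative
  to the maximum.  The Wiener-Hopf theorem says that \<open>M\<close> and \<open>N\<close> are independent and that \<open>N\<close> is
  distributed as the minimum.

  The first probability is recovered from the transform \<open>q / (q + \<psi>)\<close> on the line \<open>Im \<xi> = w1\<close>.  For
  the second one, fix \<open>M = m > b\<close>.  Then \<open>h - m < 0\<close>, and the distribution function of \<open>N\<close> at a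
  negative point is an integral of \<open>phi_mm\<close> alone: the constant \<open>a_minus\<close> is the mass of \<open>N\<close> at \<open>0\<close>.
  Integration over \<open>m > b\<close> leaves the truncated transform \<open>E[exp(i \<xi> M); M > b]\<close>, which is an
  integral of \<open>phi_pp\<close> alone along \<open>Im \<eta> = w_minus\<close>, because \<open>a_plus\<close> is the mass of \<open>M\<close> at \<open>0 \<le> b\<close>.
  Substituting one formula into the other gives the double integral; the power decay makes its kernel
  absolutely integrable, so that the order of integration is free (\<open>max_crossing_probability\<close>).

  Three ingredients carry this.

  \<^item> Inversion (\<open>decay_kernel_inversion\<close>): convolution with \<open>exp (- \<alpha> z)\<close> on \<open>z > 0\<close> divides the
    transform by \<open>\<alpha> - i u\<close>, and the quotient is inverted by inserting a Gaussian factor that is then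
    removed.  The transforms decay only like a small power, so that the distributions may be very
    rough, but the decay does identify all their atoms (\<open>atom_of_transform\<close>).  In the first integral
    of the theorem the product of the two constants contributes a term of order \<open>1 / \<xi>\<close>; its integral is
    improper and computed by one integration by parts (\<open>decay_kernel_has_integral\<close>).

  \<^item> Wiener-Hopf (\<open>wiener_hopf_factorization\<close>): on a grid the process is a random walk and the
    exponential clock becomes geometric.  Cutting the walk at its first maximum splits it into two
    independent pieces, so the generating functions multiply (\<open>discrete_wiener_hopf\<close>); reversing time
    turns the distance to the maximum into the minimum.  Right-continuity of the paths carries this
    over to the limit of vanishing mesh.

  \<^item> Exponents (\<open>char_exponent_moment\<close>): the expectations \<open>E[exp(i \<xi> X t)]\<close> are multiplicative in \<open>t\<close>
    and continuous at \<open>0\<close>, hence exponential in \<open>t\<close>, and integrating over the exponential time gives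
    \<open>q / (q + \<psi>)\<close>.
\<close>

section \<open>Fourier inversion against one-sided exponential kernels\<close>

lemma (in pair_sigma_finite) integrable_pair_dominated:
  fixes f :: "'a \<Rightarrow> 'b \<Rightarrow> 'c::{banach, second_countable_topology}" and g h
  assumes f[measurable]: "case_prod f \<in> borel_measurable (M1 \<Otimes>\<^sub>M M2)"
    and g: "integrable M1 g" and h: "integrable M2 h"
    and bound: "\<And>x y. x \<in> space M1 \<Longrightarrow> y \<in> space M2 \<Longrightarrow> norm (f x y) \<le> g x * (h y :: real)"
  shows "integrable (M1 \<Otimes>\<^sub>M M2) (case_prod f)"
proof -
  have [measurable]: "g \<in> borel_measurable M1" "h \<in> borel_measurable M2"
    using g h by auto
  have "integrable (M1 \<Otimes>\<^sub>M M2) (\<lambda>z. g (fst z) * h (snd z))"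
  proof (rule Fubini_integrable)
    show "integrable M1 (\<lambda>x. LINT y|M2. norm (g (fst (x, y)) * h (snd (x, y))))"
      using g h by (simp add: abs_mult)
    show "AE x in M1. integrable M2 (\<lambda>y. g (fst (x, y)) * h (snd (x, y)))"
      using h by simp
  qed measurable
  then show ?thesis
  proof (rule Bochner_Integration.integrable_bound)
    show "AE z in M1 \<Otimes>\<^sub>M M2. norm (case_prod f z) \<le> norm (g (fst z) * h (snd z))"
      using bound by (intro AE_I2) (force simp: space_pair_measure split: prod.splits)
  qed simp
qed

text \<open>
  The strict inequality matters: at \<open>z = 0\<close> the kernel must vanish, so that integrating
  \<open>decay_kernel \<alpha> (b - Y)\<close> never sees the atom \<open>Y = b\<close>.
\<close>

definition decay_kernel :: "complex \<Rightarrow> real \<Rightarrow> complex" where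
  "decay_kernel \<alpha> z = (if z > 0 then exp (- \<alpha> * of_real z) else 0)"

lemma decay_kernel_measurable [measurable]: "decay_kernel \<alpha> \<in> borel_measurable borel"
  unfolding decay_kernel_def by measurable

lemma norm_decay_kernel: "norm (decay_kernel \<alpha> z) = (if z > 0 then exp (- Re \<alpha> * z) else 0)"
  by (simp add: decay_kernel_def)

lemma norm_decay_kernel_le_1: "Re \<alpha> \<ge> 0 \<Longrightarrow> norm (decay_kernel \<alpha> z) \<le> 1"
  by (simp add: norm_decay_kernel)

lemma decay_kernel_integrable:
  assumes "Re \<alpha> > 0"
  shows "integrable lborel (decay_kernel \<alpha>)"
proof -
  interpret prob_space "density lborel (exponential_density (Re \<alpha>))"
    by (rule prob_space_exponential_density[OF assms])
  have "integrable (density lborel (exponential_density (Re \<alpha>))) (\<lambda>_. 1::real)"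
    by simp
  then have "integrable lborel (\<lambda>x. exponential_density (Re \<alpha>) x)"
    by (subst (asm) integrable_density) (auto simp: exponential_density_nonneg assms)
  then have "integrable lborel (\<lambda>x. exponential_density (Re \<alpha>) x / Re \<alpha>)"
    by simp
  then show ?thesis
    by (rule Bochner_Integration.integrable_bound)
       (use assms in \<open>auto simp: norm_decay_kernel exponential_density_def mult.commute\<close>)
qed

lemma decay_kernel_integral:
  assumes "Re \<alpha> > 0"
  shows "(LINT z|lborel. decay_kernel \<alpha> z) = 1 / \<alpha>"
proof -
  let ?F = "\<lambda>z::real. - exp (- \<alpha> * of_real z) / \<alpha>"
  have a0: "\<alpha> \<noteq> 0" using assms by auto
  have ii: "indicator (einterval 0 \<infinity>) z *\<^sub>R exp (- \<alpha> * of_real z) = decay_kernel \<alpha> z" for z :: real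
    by (auto simp: decay_kernel_def einterval_def indicator_def zero_ereal_def)
  have "(LBINT z=0..\<infinity>. exp (- \<alpha> * of_real z)) = 0 - (- 1 / \<alpha>)"
  proof (rule interval_integral_FTC_integrable[where F = ?F])
    fix x :: real
    show "(?F has_vector_derivative exp (- \<alpha> * of_real x)) (at x)"
      using a0 by (auto intro!: derivative_eq_intros has_vector_derivative_real_field)
    show "isCont (\<lambda>z. exp (- \<alpha> * of_real z)) x"
      by (intro continuous_intros)
  next
    show "set_integrable lborel (einterval 0 \<infinity>) (\<lambda>z. exp (- \<alpha> * of_real z))"
      unfolding set_integrable_def ii by (rule decay_kernel_integrable[OF assms])
  next
    have "(?F \<longlongrightarrow> - exp (- \<alpha> * of_real 0) / \<alpha>) (at_right 0)"
      by (intro tendsto_intros) (use a0 in auto)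
    then show "((?F \<circ> real_of_ereal) \<longlongrightarrow> - 1 / \<alpha>) (at_right 0)"
      by (simp add: zero_ereal_def ereal_tendsto_simps)
  next
    have "((\<lambda>z. exp (- Re \<alpha> * z) / norm \<alpha>) \<longlongrightarrow> 0) at_top"
      using assms a0 by real_asymp
    then have "(?F \<longlongrightarrow> 0) at_top"
      by (rule Lim_null_comparison[rotated]) (simp add: norm_divide)
    then show "((?F \<circ> real_of_ereal) \<longlongrightarrow> 0) (at_left \<infinity>)"
      by (simp add: ereal_tendsto_simps)
  qed simp
  then show ?thesis
    unfolding interval_lebesgue_integral_def set_lebesgue_integral_def ii by simp
qed

lemma gaussian_fourier:
  fixes s x :: real assumes s: "s > 0"
  shows "integrable lborel (\<lambda>u. exp (- ((s * u)\<^sup>2) / 2))"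
    and "(LINT u|lborel. exp (- \<i> * of_real u * of_real x) * of_real (exp (- ((s * u)\<^sup>2) / 2))) =
      of_real (2 * pi / s * std_normal_density (x / s))"
proof -
  have "integrable lborel std_normal_density" by simp
  then have "integrable lborel (\<lambda>x. sqrt (2 * pi) * std_normal_density x)" by simp
  then have "integrable lborel (\<lambda>x::real. exp (- x\<^sup>2 / 2))"
    by (simp add: std_normal_density_def)
  from lborel_integrable_real_affine[OF this, of s 0] s
  show "integrable lborel (\<lambda>u. exp (- ((s * u)\<^sup>2) / 2))" by simp
  let ?f = "\<lambda>y. exp (- \<i> * of_real y * of_real (x / s)) * of_real (exp (- (y\<^sup>2) / 2))"
  have "complex_of_real (exp (- ((- x / s)\<^sup>2) / 2)) = char std_normal_distribution (- x / s)"
    by (simp add: char_std_normal_distribution)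
  also have "\<dots> = (LINT y|lborel. std_normal_density y *\<^sub>R iexp (- x / s * y))"
    unfolding char_def by (subst integral_density) (auto simp del: std_normal_density_def)
  also have "\<dots> = (LINT y|lborel. of_real (1 / sqrt (2 * pi)) * ?f y)"
    by (intro Bochner_Integration.integral_cong refl) (simp add: std_normal_density_def scaleR_conv_of_real mult_ac)
  also have "\<dots> = of_real (1 / sqrt (2 * pi)) * (LINT y|lborel. ?f y)"
    by simp
  also have "(LINT y|lborel. ?f y) = s *\<^sub>R (LINT u|lborel. ?f (0 + s * u))"
    using s by (subst lborel_integral_real_affine[of s _ 0]) auto
  also have "(LINT u|lborel. ?f (0 + s * u)) =
      (LINT u|lborel. exp (- \<i> * of_real u * of_real x) * of_real (exp (- ((s * u)\<^sup>2) / 2)))" (is "_ = ?I")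
    using s by (intro Bochner_Integration.integral_cong refl) (simp add: mult.assoc)
  finally have "complex_of_real (exp (- ((- x / s)\<^sup>2) / 2)) = of_real (1 / sqrt (2 * pi)) * (s *\<^sub>R ?I)" .
  then have "?I = of_real (sqrt (2 * pi) / s) * complex_of_real (exp (- ((- x / s)\<^sup>2) / 2))"
    using s by (simp add: scaleR_conv_of_real field_simps)
  also have "\<dots> = of_real (sqrt (2 * pi) / s * exp (- ((- x / s)\<^sup>2) / 2))" by simp
  also have "sqrt (2 * pi) / s * exp (- ((- x / s)\<^sup>2) / 2) = 2 * pi / s * std_normal_density (x / s)"
    using s real_sqrt_mult_self[of "2*pi"] by (simp add: std_normal_density_def field_simps del: real_sqrt_mult_self)
  finally show "?I = of_real (2 * pi / s * std_normal_density (x / s))" .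
qed

text \<open>
  The factor \<open>1 / (\<alpha> - i u)\<close> is the transform of \<open>decay_kernel \<alpha>\<close> and the Gaussian factor that of a
  normal density of standard deviation \<open>s\<close>, so the product is the transform of their convolution.
  With the Gaussian factor everything converges absolutely and Fubini's theorem proves the inversion.
\<close>

lemma gaussian_smoothed_decay_kernel:
  fixes s x :: real
  assumes s: "s > 0" and \<alpha>: "Re \<alpha> > 0"
  shows "(LINT u|lborel. exp (- \<i> * of_real u * of_real x) * of_real (exp (- ((s * u)\<^sup>2) / 2)) / (\<alpha> - \<i> * of_real u)) =
    2 * of_real pi * (LINT y|lborel. std_normal_density y *\<^sub>R decay_kernel \<alpha> (x - s * y))"
proof -
  let ?g = "\<lambda>u. complex_of_real (exp (- ((s * u)\<^sup>2) / 2))"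
  let ?F = "\<lambda>u z. exp (- \<i> * of_real u * of_real (x - z)) * ?g u * decay_kernel \<alpha> z"
  have F: "integrable (lborel \<Otimes>\<^sub>M lborel) (case_prod ?F)"
    by (rule lborel_pair.integrable_pair_dominated[where g = "\<lambda>u. exp (- ((s * u)\<^sup>2) / 2)" and h = "\<lambda>z. norm (decay_kernel \<alpha> z)"])
       (use gaussian_fourier(1)[OF s] decay_kernel_integrable[OF \<alpha>] in \<open>auto simp: norm_mult\<close>)
  have "(LINT z|lborel. ?F u z) = exp (- \<i> * of_real u * of_real x) * ?g u / (\<alpha> - \<i> * of_real u)" for u
  proof -
    have eq: "?F u = (\<lambda>z. exp (- \<i> * of_real u * of_real x) * ?g u * decay_kernel (\<alpha> - \<i> * of_real u) z)"
      by (rule ext) (simp add: decay_kernel_def algebra_simps flip: exp_add)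
    show ?thesis
      unfolding eq using decay_kernel_integral[of "\<alpha> - \<i> * of_real u"] \<alpha> by simp
  qed
  then have "(LINT u|lborel. exp (- \<i> * of_real u * of_real x) * ?g u / (\<alpha> - \<i> * of_real u)) =
      (LINT u|lborel. LINT z|lborel. ?F u z)" by simp
  also have "\<dots> = (LINT z|lborel. LINT u|lborel. ?F u z)"
    using lborel_pair.Fubini_integral[OF F] by simp
  also have "\<dots> = (LINT z|lborel. of_real (2 * pi / s * std_normal_density ((x - z) / s)) * decay_kernel \<alpha> z)"
    using gaussian_fourier(2)[OF s, of "x - _"] by simp
  also have "\<dots> = s *\<^sub>R (LINT y|lborel. of_real (2 * pi / s * std_normal_density ((x - (x + (-s) * y)) / s)) * decay_kernel \<alpha> (x + (-s) * y))"
    using s by (subst lborel_integral_real_affine[of "-s" _ x]) auto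
  also have "\<dots> = s *\<^sub>R (LINT y|lborel. (2 * pi / s) *\<^sub>R (std_normal_density y *\<^sub>R decay_kernel \<alpha> (x - s * y)))"
    using s by (simp add: scaleR_conv_of_real mult_ac)
  also have "\<dots> = 2 * of_real pi * (LINT y|lborel. std_normal_density y *\<^sub>R decay_kernel \<alpha> (x - s * y))"
    using s by (simp add: scaleR_conv_of_real)
  finally show ?thesis .
qed

lemma gaussian_smoothed_decay_kernel_tendsto:
  assumes \<alpha>: "Re \<alpha> \<ge> 0" and x: "x \<noteq> 0" and s: "s \<longlonglongrightarrow> 0"
  shows "(\<lambda>n. LINT y|lborel. std_normal_density y *\<^sub>R decay_kernel \<alpha> (x - s n * y)) \<longlonglongrightarrow> decay_kernel \<alpha> x"
proof -
  have c: "isCont (decay_kernel \<alpha>) x"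
  proof (cases "x > 0")
    case True
    have ev: "eventually (\<lambda>z. decay_kernel \<alpha> z = exp (- \<alpha> * of_real z)) (nhds x)"
      using eventually_nhds_in_open[of "{0<..}" x] True by (auto elim!: eventually_mono simp: decay_kernel_def)
    show ?thesis
      by (subst isCont_cong[OF ev]) (intro continuous_intros)
  next
    case False
    have ev: "eventually (\<lambda>z. decay_kernel \<alpha> z = 0) (nhds x)"
      using eventually_nhds_in_open[of "{..<0}" x] False x by (auto elim!: eventually_mono simp: decay_kernel_def)
    show ?thesis
      by (subst isCont_cong[OF ev]) (intro continuous_intros)
  qed
  have "(\<lambda>n. LINT y|lborel. std_normal_density y *\<^sub>R decay_kernel \<alpha> (x - s n * y)) \<longlonglongrightarrow>
      (LINT y|lborel. std_normal_density y *\<^sub>R decay_kernel \<alpha> x)"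
  proof (rule integral_dominated_convergence[where w = std_normal_density])
    show "AE y in lborel. (\<lambda>n. std_normal_density y *\<^sub>R decay_kernel \<alpha> (x - s n * y)) \<longlonglongrightarrow> std_normal_density y *\<^sub>R decay_kernel \<alpha> x"
    proof (intro AE_I2 tendsto_intros isCont_tendsto_compose[OF c])
      fix y
      show "(\<lambda>n. x - s n * y) \<longlonglongrightarrow> x"
        using tendsto_diff[OF tendsto_const[of x] tendsto_mult_right[OF s, of y]] by simp
    qed
    show "AE y in lborel. norm (std_normal_density y *\<^sub>R decay_kernel \<alpha> (x - s n * y)) \<le> std_normal_density y" for n
      using norm_decay_kernel_le_1[OF \<alpha>] by (intro AE_I2) (simp add: mult_left_le)
  qed (auto simp del: std_normal_density_def)
  also have "(LINT y|lborel. std_normal_density y *\<^sub>R decay_kernel \<alpha> x) = decay_kernel \<alpha> x"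
    by (subst integral_scaleR_left) (simp_all add: integral_normal_density)
  finally show ?thesis .
qed


lemma std_normal_char:
  "(LINT y|lborel. std_normal_density y *\<^sub>R exp (\<i> * of_real t * of_real y)) = of_real (exp (- (t\<^sup>2) / 2))"
proof -
  have "complex_of_real (exp (- (t\<^sup>2) / 2)) = char std_normal_distribution t"
    by (simp add: char_std_normal_distribution)
  also have "\<dots> = (LINT y|lborel. std_normal_density y *\<^sub>R iexp (t * y))"
    unfolding char_def by (subst integral_density) auto
  finally show ?thesis by (simp add: mult.assoc)
qed

text \<open>
  Here and below a transform is split as \<open>c + h u\<close> into its limit at infinity and a remainder.  The
  weight \<open>w\<close> may be complex; this covers exponentially tilted measures, which occur when the
  transform is taken along a line off the real axis.
\<close>

lemma transform_remainder_bounded: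
  assumes w: "integrable \<mu> w"
    and transform: "\<And>u. (LINT x|\<mu>. exp (\<i> * of_real u * of_real (Y x)) * w x) = c + h u"
  shows "norm (h u) \<le> norm c + (LINT x|\<mu>. norm (w x))"
proof -
  have "norm (h u) = norm ((LINT x|\<mu>. exp (\<i> * of_real u * of_real (Y x)) * w x) - c)"
    by (simp add: transform)
  also have "\<dots> \<le> norm (LINT x|\<mu>. exp (\<i> * of_real u * of_real (Y x)) * w x) + norm c"
    by (rule norm_triangle_ineq4)
  also have "norm (LINT x|\<mu>. exp (\<i> * of_real u * of_real (Y x)) * w x) \<le>
      (LINT x|\<mu>. norm (exp (\<i> * of_real u * of_real (Y x)) * w x))"
    by (rule integral_norm_bound)
  finally show ?thesis by (simp add: norm_mult)
qed

text \<open>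
  A very narrow Gaussian around \<open>b\<close> isolates the atom at \<open>b\<close>.  On the Fourier side it becomes a very
  wide one, which only sees the behaviour of the transform at infinity: the remainder disappears and
  the constant \<open>c\<close> leaves \<open>c exp (- (n b)\<^sup>2 / 2)\<close>.  So a transform with a limit at infinity has no atoms
  except one of mass \<open>c\<close> at \<open>0\<close>.
\<close>

lemma atom_of_transform:
  fixes Y :: "'b \<Rightarrow> real" and w :: "'b \<Rightarrow> complex" and h :: "real \<Rightarrow> complex"
  assumes sf: "sigma_finite_measure \<mu>" and w: "integrable \<mu> w"
    and Y[measurable]: "Y \<in> borel_measurable \<mu>" and h[measurable]: "h \<in> borel_measurable borel"
    and transform: "\<And>u. (LINT x|\<mu>. exp (\<i> * of_real u * of_real (Y x)) * w x) = c + h u"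
    and hlim: "(h \<longlongrightarrow> 0) at_infinity"
  shows "(LINT x|\<mu>. (if Y x = b then w x else 0)) = (if b = 0 then c else 0)"
proof -
  let ?R = "\<lambda>n y. std_normal_density y *\<^sub>R (exp (- \<i> * of_real (real n * y * b)) * h (real n * y))"
  interpret sigma_finite_measure \<mu> by fact
  interpret pair_sigma_finite \<mu> lborel ..
  have [measurable]: "w \<in> borel_measurable \<mu>" using w by auto
  let ?e = "\<lambda>(n::nat) d. complex_of_real (exp (- ((real n * d)\<^sup>2) / 2))"
  have lim_e: "(\<lambda>n. ?e n d) \<longlonglongrightarrow> (if d = 0 then 1 else 0)" for d
  proof (cases "d = 0")
    case False
    then have "(\<lambda>n. exp (- ((real n * d)\<^sup>2) / 2)) \<longlonglongrightarrow> 0" by real_asymp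
    then have "(\<lambda>n. ?e n d) \<longlonglongrightarrow> of_real 0" by (rule tendsto_of_real)
    with False show ?thesis by simp
  qed auto
  have L1: "(\<lambda>n. LINT x|\<mu>. ?e n (Y x - b) * w x) \<longlonglongrightarrow> (LINT x|\<mu>. (if Y x = b then w x else 0))"
  proof (rule integral_dominated_convergence[where w = "\<lambda>x. norm (w x)"])
    have "\<forall>x. (\<lambda>n. ?e n (Y x - b) * w x) \<longlonglongrightarrow> (if Y x - b = 0 then 1 else 0) * w x"
      by (intro allI tendsto_intros lim_e)
    then have "(\<lambda>n. ?e n (Y x - b) * w x) \<longlonglongrightarrow> (if Y x = b then w x else 0)" for x
      by (cases "Y x = b") (auto dest: spec[of _ x])
    then show "AE x in \<mu>. (\<lambda>n. ?e n (Y x - b) * w x) \<longlonglongrightarrow> (if Y x = b then w x else 0)"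
      by (intro AE_I2)
  qed (use w in \<open>auto simp: norm_mult mult_left_le_one_le\<close>)
  have eq: "(LINT x|\<mu>. ?e n (Y x - b) * w x) =
      c * ?e n b + (LINT y|lborel. ?R n y)" for n
  proof -
    let ?F = "\<lambda>x y. std_normal_density y *\<^sub>R (exp (\<i> * of_real (real n * (Y x - b)) * of_real y) * w x)"
    have F: "integrable (\<mu> \<Otimes>\<^sub>M lborel) (case_prod ?F)"
      by (rule integrable_pair_dominated[where g = "\<lambda>x. norm (w x)" and h = std_normal_density])
         (use w in \<open>auto simp: norm_mult simp del: std_normal_density_def\<close>)
    have "(LINT x|\<mu>. ?e n (Y x - b) * w x) = (LINT x|\<mu>. LINT y|lborel. ?F x y)"
    proof (intro Bochner_Integration.integral_cong refl)
      fix x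
      show "?e n (Y x - b) * w x = (LINT y|lborel. ?F x y)"
        unfolding std_normal_char[symmetric] mult_scaleR_left[symmetric] integral_mult_left_zero ..
    qed
    also have "\<dots> = (LINT y|lborel. LINT x|\<mu>. ?F x y)"
      using Fubini_integral[OF F] by simp
    also have "\<dots> = (LINT y|lborel. std_normal_density y *\<^sub>R (exp (- \<i> * of_real (real n * y * b)) * (c + h (real n * y))))"
    proof (intro Bochner_Integration.integral_cong refl)
      fix y
      have eq: "(\<lambda>x. ?F x y) = (\<lambda>x. std_normal_density y *\<^sub>R (exp (- \<i> * of_real (real n * y * b)) *
          (exp (\<i> * of_real (real n * y) * of_real (Y x)) * w x)))"
        by (rule ext) (simp add: algebra_simps flip: exp_add)
      show "(LINT x|\<mu>. ?F x y) = std_normal_density y *\<^sub>R (exp (- \<i> * of_real (real n * y * b)) * (c + h (real n * y)))"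
        unfolding eq transform[symmetric] by simp
    qed
    also have "\<dots> = (LINT y|lborel. c * (std_normal_density y *\<^sub>R exp (\<i> * of_real (- real n * b) * of_real y))
        + ?R n y)"
      by (intro Bochner_Integration.integral_cong refl) (simp add: algebra_simps scaleR_conv_of_real)
    also have "\<dots> = (LINT y|lborel. c * (std_normal_density y *\<^sub>R exp (\<i> * of_real (- real n * b) * of_real y)))
        + (LINT y|lborel. ?R n y)"
    proof (rule Bochner_Integration.integral_add)
      have int: "integrable lborel (\<lambda>y. std_normal_density y * K)" for K by simp
      show "integrable lborel (\<lambda>y. c * (std_normal_density y *\<^sub>R exp (\<i> * of_real (- real n * b) * of_real y)))"
        by (rule Bochner_Integration.integrable_bound[OF int[of "norm c"]])
           (auto simp: norm_mult simp del: std_normal_density_def)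
      show "integrable lborel (\<lambda>y. ?R n y)"
        by (rule Bochner_Integration.integrable_bound[OF int[of "norm c + (LINT x|\<mu>. norm (w x))"]])
           (use transform_remainder_bounded[OF w transform] in
            \<open>auto simp: norm_mult abs_mult intro!: mult_left_mono order_trans[OF _ abs_ge_self] simp del: std_normal_density_def\<close>)
    qed
    also have "(LINT y|lborel. c * (std_normal_density y *\<^sub>R exp (\<i> * of_real (- real n * b) * of_real y))) = c * ?e n b"
      unfolding integral_mult_right_zero std_normal_char by simp
    finally show ?thesis .
  qed
  have "(\<lambda>n. LINT y|lborel. ?R n y)
      \<longlonglongrightarrow> (LINT y::real|lborel. (0::complex))"
  proof (rule integral_dominated_convergence[where w = "\<lambda>y. std_normal_density y * (norm c + (LINT x|\<mu>. norm (w x)))"])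
    have "AE y in lborel. y \<noteq> (0::real)" by (rule AE_lborel_singleton)
    then show "AE y in lborel. (\<lambda>n. ?R n y) \<longlonglongrightarrow> (0::complex)"
    proof eventually_elim
      fix y :: real assume y: "y \<noteq> 0"
      have "filterlim (\<lambda>n. y * real n) at_infinity sequentially"
        by (rule tendsto_mult_filterlim_at_infinity[OF tendsto_const y
              filterlim_at_top_imp_at_infinity[OF filterlim_real_sequentially]])
      then have "filterlim (\<lambda>n. real n * y) at_infinity sequentially" by (simp only: mult.commute)
      then have "(\<lambda>n. h (real n * y)) \<longlonglongrightarrow> 0"
        by (rule filterlim_compose[OF hlim])
      from tendsto_mult_left[OF tendsto_norm[OF this], of "std_normal_density y"]
      show "(\<lambda>n. ?R n y) \<longlonglongrightarrow> (0::complex)"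
        by (rule Lim_null_comparison[OF always_eventually, rotated, OF tendsto_eq_rhs]) (auto simp: norm_mult)
    qed
  next
    show "AE y in lborel. norm (?R n y)
        \<le> std_normal_density y * (norm c + (LINT x|\<mu>. norm (w x)))" for n
    proof (rule AE_I2)
      fix y
      show "norm (?R n y)
          \<le> std_normal_density y * (norm c + (LINT x|\<mu>. norm (w x)))"
        using mult_left_mono[OF transform_remainder_bounded[OF w transform, of "real n * y"] normal_density_nonneg[of 0 1 y]]
        by (simp add: norm_mult)
    qed
    show "integrable lborel (\<lambda>y. std_normal_density y * (norm c + (LINT x|\<mu>. norm (w x))))"
      by simp
  qed measurable
  then have "(\<lambda>n. LINT x|\<mu>. ?e n (Y x - b) * w x) \<longlonglongrightarrow> c * (if b = 0 then 1 else 0) + 0"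
    unfolding eq by (intro tendsto_add tendsto_mult lim_e tendsto_const) simp
  with L1 have "(LINT x|\<mu>. (if Y x = b then w x else 0)) = c * (if b = 0 then 1 else 0) + 0"
    by (rule LIMSEQ_unique)
  then show ?thesis by (simp split: if_splits)
qed

text \<open>
  With a Gaussian factor of width \<open>1 / s\<close> the formula is Fubini's theorem.  As \<open>s\<close> tends to \<open>0\<close>, the
  smoothed kernel converges to the kernel except at its jump, where it converges to half the jump.
  This does not disturb the limit: by \<open>atom_of_transform\<close> the mass at the jump is \<open>c\<close> if \<open>b = 0\<close> and zero
  otherwise, so the contribution of the jump cancels against the constant \<open>c\<close> before the limit is
  taken, and the formula holds at every \<open>b\<close>.
\<close>

proposition decay_kernel_inversion:
  fixes Y :: "'b \<Rightarrow> real" and w :: "'b \<Rightarrow> complex" and h :: "real \<Rightarrow> complex"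
  assumes sf: "sigma_finite_measure \<mu>" and w: "integrable \<mu> w"
    and Y[measurable]: "Y \<in> borel_measurable \<mu>" and h[measurable]: "h \<in> borel_measurable borel"
    and \<alpha>: "Re \<alpha> > 0"
    and transform: "\<And>u. (LINT x|\<mu>. exp (\<i> * of_real u * of_real (Y x)) * w x) = c + h u"
    and hlim: "(h \<longlongrightarrow> 0) at_infinity"
    and hint: "integrable lborel (\<lambda>u. h u / (\<alpha> - \<i> * of_real u))"
  shows "(LINT x|\<mu>. decay_kernel \<alpha> (b - Y x) * w x) =
    c * decay_kernel \<alpha> b + 1 / (2 * of_real pi) *
      (LINT u|lborel. exp (- \<i> * of_real u * of_real b) * h u / (\<alpha> - \<i> * of_real u))"
proof -
  let ?e = "\<lambda>u. exp (- \<i> * of_real u * of_real b)"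
  let ?d = "\<lambda>u. \<alpha> - \<i> * of_real u"
  interpret sigma_finite_measure \<mu> by fact
  interpret pair_sigma_finite \<mu> lborel ..
  have [measurable]: "w \<in> borel_measurable \<mu>" using w by auto
  define s where "s n = inverse (real (Suc n))" for n
  have s: "s \<longlonglongrightarrow> 0" "\<And>n. s n > 0"
    unfolding s_def by (rule LIMSEQ_inverse_real_of_nat) simp
  define K where "K n x = (LINT y|lborel. std_normal_density y *\<^sub>R decay_kernel \<alpha> (x - s n * y))" for n x
  have K_meas[measurable]: "K n \<in> borel_measurable borel" for n
    unfolding K_def by measurable
  have K_bd: "norm (K n x) \<le> 1" for n x
  proof -
    have "norm (K n x) \<le> (LINT y|lborel. norm (std_normal_density y *\<^sub>R decay_kernel \<alpha> (x - s n * y)))"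
      unfolding K_def by (rule integral_norm_bound)
    also have "\<dots> \<le> (LINT y|lborel. std_normal_density y)"
      by (rule integral_mono') (use norm_decay_kernel_le_1[of \<alpha>] \<alpha> in \<open>auto simp: mult_left_le simp del: std_normal_density_def\<close>)
    finally show ?thesis by simp
  qed
  let ?g = "\<lambda>n u. complex_of_real (exp (- ((s n * u)\<^sup>2) / 2))"
  have K_lim: "x \<noteq> 0 \<Longrightarrow> (\<lambda>n. K n x) \<longlonglongrightarrow> decay_kernel \<alpha> x" for x
    unfolding K_def using \<alpha> by (intro gaussian_smoothed_decay_kernel_tendsto s) auto
  have K_eq: "(LINT u|lborel. exp (- \<i> * of_real u * of_real x) * ?g n u / (?d u)) = 2 * of_real pi * K n x" for n x
    unfolding K_def by (rule gaussian_smoothed_decay_kernel[OF s(2) \<alpha>])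
  have ge: "Re \<alpha> \<le> norm (?d u)" for u
    using complex_Re_le_cmod[of "\<alpha> - \<i> * of_real u"] by simp
  have nz: "\<alpha> - \<i> * of_real u \<noteq> 0" for u
    using \<alpha> by (auto simp: complex_eq_iff)
  have g_int: "integrable lborel (\<lambda>u. C * exp (- ((s n * u)\<^sup>2) / 2) / Re \<alpha>)" for n C
    using gaussian_fourier(1)[OF s(2)[of n]] by simp
  have quot: "norm (z / (?d u)) \<le> C / Re \<alpha>" if "norm z \<le> C" for z C u
  proof -
    have "0 \<le> C" using that norm_ge_zero order_trans by blast
    then show ?thesis
      unfolding norm_divide using that ge[of u] \<alpha> by (intro frac_le) auto
  qed
  have eq: "(LINT x|\<mu>. K n (b - Y x) * w x) = c * K n b + 1 / (2 * of_real pi) *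
      (LINT u|lborel. ?e u * ?g n u * h u / (?d u))" for n
  proof -
    let ?F = "\<lambda>x u. (exp (- \<i> * of_real u * of_real (b - Y x)) * ?g n u / (?d u)) * w x"
    have F: "integrable (\<mu> \<Otimes>\<^sub>M lborel) (case_prod ?F)"
    proof (rule integrable_pair_dominated[where g = "\<lambda>x. norm (w x)" and h = "\<lambda>u. 1 * exp (- ((s n * u)\<^sup>2) / 2) / Re \<alpha>"])
      fix x u
      show "norm (?F x u) \<le> norm (w x) * (1 * exp (- ((s n * u)\<^sup>2) / 2) / Re \<alpha>)"
        unfolding norm_mult[of _ "w x"] by (subst mult.commute, intro mult_left_mono quot) (auto simp: norm_mult)
    next
      show "integrable lborel (\<lambda>u. 1 * exp (- ((s n * u)\<^sup>2) / 2) / Re \<alpha>)" by (rule g_int)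
    qed (use w in auto)
    have "2 * of_real pi * (LINT x|\<mu>. K n (b - Y x) * w x) = (LINT x|\<mu>. (2 * of_real pi * K n (b - Y x)) * w x)"
      by (simp add: mult.assoc)
    also have "\<dots> = (LINT x|\<mu>. LINT u|lborel. ?F x u)"
      unfolding K_eq[symmetric] integral_mult_left_zero ..
    also have "\<dots> = (LINT u|lborel. LINT x|\<mu>. ?F x u)"
      using Fubini_integral[OF F] by simp
    also have "\<dots> = (LINT u|lborel. (?e u * ?g n u / (?d u)) * (c + h u))"
    proof (intro Bochner_Integration.integral_cong refl)
      fix u
      have eq: "(\<lambda>x. ?F x u) = (\<lambda>x. (?e u * ?g n u / (?d u)) *
          (exp (\<i> * of_real u * of_real (Y x)) * w x))"
        by (rule ext) (simp add: algebra_simps flip: exp_add)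
      show "(LINT x|\<mu>. ?F x u) = (?e u * ?g n u / (?d u)) * (c + h u)"
        unfolding eq transform[symmetric] by simp
    qed
    also have "\<dots> = (LINT u|lborel. c * (?e u * ?g n u / (?d u)) +
        ?e u * ?g n u * h u / (?d u))"
      by (intro Bochner_Integration.integral_cong refl) (simp add: algebra_simps add_divide_distrib)
    also have "\<dots> = (LINT u|lborel. c * (?e u * ?g n u / (?d u))) +
        (LINT u|lborel. ?e u * ?g n u * h u / (?d u))"
    proof (rule Bochner_Integration.integral_add)
      have "integrable lborel (\<lambda>u. ?e u * ?g n u / (?d u))"
      proof (rule Bochner_Integration.integrable_bound[OF g_int[of 1 n]])
        show "AE u in lborel. norm (?e u * ?g n u / (?d u)) \<le> norm (1 * exp (- ((s n * u)\<^sup>2) / 2) / Re \<alpha>)"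
        proof (rule AE_I2)
          fix u
          have "norm (?e u * ?g n u) \<le> exp (- ((s n * u)\<^sup>2) / 2)"
            by (simp add: norm_mult)
          from quot[OF this]
          show "norm (?e u * ?g n u / (?d u)) \<le> norm (1 * exp (- ((s n * u)\<^sup>2) / 2) / Re \<alpha>)"
            using \<alpha> by simp
        qed
      qed auto
      then show "integrable lborel (\<lambda>u. c * (?e u * ?g n u / (?d u)))"
        by (rule integrable_mult_right)
      show "integrable lborel (\<lambda>u. ?e u * ?g n u * h u / (?d u))"
        by (rule Bochner_Integration.integrable_bound[OF hint])
          (auto simp: norm_mult norm_divide mult_left_le_one_le intro!: divide_right_mono)
    qed
    finally show ?thesis unfolding integral_mult_right_zero K_eq by (simp add: field_simps)
  qed
  define N where "N = (LINT x|\<mu>. (if Y x = b then w x else 0))"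
  have N: "N = (if b = 0 then c else 0)"
    unfolding N_def by (rule atom_of_transform[OF sf w Y h transform hlim])
  \<comment> \<open>On the atom the smoothed kernel has the constant value \<open>K n 0\<close>; splitting it off here avoids the limit
    at the jump.\<close>
  have sub: "(LINT x|\<mu>. (if Y x = b then 0 else K n (b - Y x) * w x)) = (LINT x|\<mu>. K n (b - Y x) * w x) - K n 0 * N" for n
  proof -
    have wi: "integrable \<mu> (\<lambda>x. (if Y x = b then w x else 0))"
      by (rule Bochner_Integration.integrable_bound[OF w]) auto
    have "(LINT x|\<mu>. (if Y x = b then 0 else K n (b - Y x) * w x)) =
        (LINT x|\<mu>. K n (b - Y x) * w x - K n 0 * (if Y x = b then w x else 0))"
      by (intro Bochner_Integration.integral_cong refl) auto
    also have "\<dots> = (LINT x|\<mu>. K n (b - Y x) * w x) - (LINT x|\<mu>. K n 0 * (if Y x = b then w x else 0))"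
    proof (rule Bochner_Integration.integral_diff)
      show "integrable \<mu> (\<lambda>x. K n (b - Y x) * w x)"
        by (rule Bochner_Integration.integrable_bound[OF w])
           (use K_bd in \<open>auto simp: norm_mult mult_left_le_one_le\<close>)
    qed (use wi in simp)
    finally show ?thesis unfolding N_def by simp
  qed
  have L1: "(\<lambda>n. LINT x|\<mu>. (if Y x = b then 0 else K n (b - Y x) * w x)) \<longlonglongrightarrow> (LINT x|\<mu>. decay_kernel \<alpha> (b - Y x) * w x)"
  proof (rule integral_dominated_convergence[where w = "\<lambda>x. norm (w x)"])
    show "AE x in \<mu>. (\<lambda>n. if Y x = b then 0 else K n (b - Y x) * w x) \<longlonglongrightarrow> decay_kernel \<alpha> (b - Y x) * w x"
    proof (rule AE_I2)
      fix x
      show "(\<lambda>n. if Y x = b then 0 else K n (b - Y x) * w x) \<longlonglongrightarrow> decay_kernel \<alpha> (b - Y x) * w x"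
        by (cases "Y x = b") (auto simp: decay_kernel_def[of _ 0] intro!: tendsto_mult_right K_lim)
    qed
  qed (use w K_bd in \<open>auto simp: norm_mult mult_left_le_one_le\<close>)
  have L2: "(\<lambda>n. LINT u|lborel. ?e u * ?g n u * h u / (?d u)) \<longlonglongrightarrow>
      (LINT u|lborel. ?e u * 1 * h u / (?d u))"
  proof (rule integral_dominated_convergence[where w = "\<lambda>u. norm (h u / (?d u))"])
    show "AE u in lborel. (\<lambda>n. ?e u * ?g n u * h u / (?d u)) \<longlonglongrightarrow>
        ?e u * 1 * h u / (?d u)"
    proof (intro AE_I2 tendsto_intros nz)
      fix u
      have "(\<lambda>n. exp (- ((s n * u)\<^sup>2) / 2)) \<longlonglongrightarrow> exp (- ((0 * u)\<^sup>2) / 2)"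
        by (intro tendsto_intros s) simp
      then show "(\<lambda>n. ?g n u) \<longlonglongrightarrow> 1"
        using tendsto_of_real by fastforce
    qed
  next
    show "integrable lborel (\<lambda>u. norm (h u / (?d u)))"
      by (rule integrable_norm[OF hint])
  qed (auto simp: norm_mult norm_divide mult_left_le_one_le intro!: divide_right_mono)
  have "(\<lambda>n. c * K n b - K n 0 * N) \<longlonglongrightarrow> c * decay_kernel \<alpha> b"
  proof (cases "b = 0")
    case True then show ?thesis by (simp add: N decay_kernel_def mult.commute)
  next
    case False then show ?thesis by (simp add: N tendsto_mult_left K_lim)
  qed
  from tendsto_add[OF this tendsto_mult_left[OF L2, of "1 / (2 * of_real pi)"]]
  have "(\<lambda>n. LINT x|\<mu>. (if Y x = b then 0 else K n (b - Y x) * w x)) \<longlonglongrightarrow> c * decay_kernel \<alpha> b + 1 / (2 * of_real pi) *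
      (LINT u|lborel. ?e u * 1 * h u / (?d u))"
    unfolding sub eq by (simp add: algebra_simps)
  from LIMSEQ_unique[OF L1 this] show ?thesis by simp
qed


lemma one_plus_abs_powr_integrable:
  fixes p :: real assumes p: "p > 1"
  shows "integrable lborel (\<lambda>u. (1 + \<bar>u\<bar>) powr (- p))"
proof -
  let ?g = "\<lambda>u. indicator {0..} u *\<^sub>R (1 + u) powr (- p)"
  have "(\<integral>\<^sup>+ u. ennreal ((1 + u) powr (- p)) * indicator {0..} u \<partial>lborel) = ennreal (0 - (1 + 0) powr (1 - p) / (1 - p))"
  proof (rule nn_integral_FTC_atLeast)
    fix u :: real assume "0 \<le> u"
    then show "((\<lambda>u. (1 + u) powr (1 - p) / (1 - p)) has_real_derivative (1 + u) powr (- p)) (at u)"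
      using p by (auto intro!: derivative_eq_intros)
    show "0 \<le> (1 + u) powr (- p)" by simp
  next
    show "((\<lambda>u. (1 + u) powr (1 - p) / (1 - p)) \<longlongrightarrow> 0) at_top"
      using p by real_asymp
  qed auto
  moreover have "ennreal ((1 + u) powr (- p)) * indicator {0..} u = ennreal (norm (?g u))" for u
    by (simp split: split_indicator)
  ultimately have g: "integrable lborel ?g"
    by (intro integrableI_bounded) auto
  have g': "integrable lborel (\<lambda>u. ?g (- u))"
    using lborel_integrable_real_affine[OF g, of "-1" 0] by simp
  have "integrable lborel (\<lambda>u. ?g u + ?g (- u))"
    by (rule Bochner_Integration.integrable_add[OF g g'])
  then show ?thesis
    by (rule Bochner_Integration.integrable_bound) (auto split: split_indicator)
qed

lemma norm_affine_ge:
  assumes \<alpha>: "Re \<alpha> > 0"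
  shows "1 + \<bar>u\<bar> \<le> (1 + (1 + norm \<alpha>) / Re \<alpha>) * norm (\<alpha> - \<i> * of_real u)"
proof -
  let ?d = "norm (\<alpha> - \<i> * of_real u)"
  have 1: "Re \<alpha> \<le> ?d"
    using complex_Re_le_cmod[of "\<alpha> - \<i> * of_real u"] by simp
  have "\<bar>u\<bar> \<le> norm \<alpha> + ?d"
    using norm_triangle_ineq4[of \<alpha> "\<alpha> - \<i> * of_real u"] by (simp add: norm_mult)
  moreover have "(1 + norm \<alpha>) * 1 \<le> (1 + norm \<alpha>) * (?d / Re \<alpha>)"
    using 1 \<alpha> by (intro mult_left_mono) auto
  ultimately show ?thesis by (simp add: field_simps)
qed

text \<open>
  An elementary form of Young's inequality: bound the quotient by its value with both variables replaced by the
  smaller one.  It separates the two variables of the double integral although \<open>\<nu>\<close> may be arbitrarily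
  small.
\<close>

lemma powr_decay_product:
  fixes x y \<nu> :: real assumes "0 \<le> x" "0 \<le> y" and \<nu>: "\<nu> > 0"
  shows "(1 + x) powr (- \<nu>) / (1 + y) \<le> (1 + x) powr (- (1 + \<nu>)) + (1 + y) powr (- (1 + \<nu>))"
proof (cases "x \<le> y")
  case True
  have "(1 + x) powr (- \<nu>) / (1 + y) \<le> (1 + x) powr (- \<nu>) / (1 + x)"
    using assms True by (intro divide_left_mono) auto
  also have "\<dots> = (1 + x) powr (- (1 + \<nu>))"
    using assms by (simp add: powr_diff powr_minus divide_simps powr_add)
  finally show ?thesis using powr_ge_zero[of "1+y" "-(1+\<nu>)"] by linarith
next
  case False
  have "(1 + x) powr (- \<nu>) / (1 + y) \<le> (1 + y) powr (- \<nu>) / (1 + y)"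
    using assms False by (intro divide_right_mono powr_mono2') auto
  also have "\<dots> = (1 + y) powr (- (1 + \<nu>))"
    using assms by (simp add: powr_diff powr_minus divide_simps powr_add)
  finally show ?thesis using powr_ge_zero[of "1+x" "-(1+\<nu>)"] by linarith
qed

lemma powr_decay_quotient_integrable:
  fixes h :: "real \<Rightarrow> complex"
  assumes \<alpha>: "Re \<alpha> > 0" and \<nu>: "\<nu> > 0" and h[measurable]: "h \<in> borel_measurable borel"
    and bound: "\<And>u. norm (h u) \<le> C * (1 + \<bar>u\<bar>) powr (- \<nu>)"
  shows "integrable lborel (\<lambda>u. h u / (\<alpha> - \<i> * of_real u))"
proof -
  let ?D = "1 + (1 + norm \<alpha>) / Re \<alpha>"
  have D: "?D > 0" using \<alpha> by (simp add: add_pos_nonneg)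
  have "integrable lborel (\<lambda>u. (C * ?D) * (1 + \<bar>u\<bar>) powr (- (1 + \<nu>)))"
    using one_plus_abs_powr_integrable[of "1 + \<nu>"] \<nu> by simp
  then show ?thesis
  proof (rule Bochner_Integration.integrable_bound)
    show "AE u in lborel. norm (h u / (\<alpha> - \<i> * of_real u)) \<le> norm ((C * ?D) * (1 + \<bar>u\<bar>) powr (- (1 + \<nu>)))"
    proof (intro AE_I2)
      fix u
      let ?d = "norm (\<alpha> - \<i> * of_real u)"
      have d: "?d > 0" using \<alpha> by (auto simp: complex_eq_iff)
      have u0: "0 < 1 + \<bar>u\<bar>" by linarith
      have i: "1 / ?d \<le> ?D / (1 + \<bar>u\<bar>)"
        using norm_affine_ge[OF \<alpha>, of u] d u0 by (subst frac_le_eq) (auto simp: divide_le_0_iff)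
      have C: "0 \<le> C * (1 + \<bar>u\<bar>) powr (- \<nu>)"
        using bound[of u] norm_ge_zero order_trans by blast
      have "norm (h u / (\<alpha> - \<i> * of_real u)) = norm (h u) * (1 / ?d)"
        by (simp add: norm_divide)
      also have "\<dots> \<le> (C * (1 + \<bar>u\<bar>) powr (- \<nu>)) * (?D / (1 + \<bar>u\<bar>))"
        using bound[of u] i C by (intro mult_mono) auto
      also have "\<dots> = (C * ?D) * (1 + \<bar>u\<bar>) powr (- (1 + \<nu>))"
        using u0 powr_add[of "1 + \<bar>u\<bar>" "- \<nu>" "-1"] by (simp add: powr_minus_divide[of _ 1] algebra_simps)
      also have "\<dots> \<le> norm \<dots>" by simp
      finally show "norm (h u / (\<alpha> - \<i> * of_real u)) \<le> norm ((C * ?D) * (1 + \<bar>u\<bar>) powr (- (1 + \<nu>)))" .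
    qed
  qed simp
qed

text \<open>
  Over a compact interval the integral is a difference of values of the antiderivative, and both tend
  to \<open>0\<close> as the interval grows, independently at the two ends.  This covers integrals that converge
  only conditionally.
\<close>

lemma has_integral_0_of_vanishing_antiderivative:
  fixes f F :: "real \<Rightarrow> complex"
  assumes F: "\<And>u. (F has_vector_derivative f u) (at u)"
    and top: "(F \<longlongrightarrow> 0) at_top" and bot: "(F \<longlongrightarrow> 0) at_bot"
  shows "(f has_integral 0) UNIV"
proof -
  have i: "(f has_integral (F y - F x)) {x..y}" if "x \<le> y" for x y
    by (rule fundamental_theorem_of_calculus[OF that]) (use F in \<open>auto intro: has_vector_derivative_at_within\<close>)
  show ?thesis
    unfolding has_integral_alt'[of f 0 UNIV]
  proof (intro conjI allI impI)
    show "(\<lambda>x. if x \<in> UNIV then f x else 0) integrable_on cbox a b" for a b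
      using i[of a b] by (cases "a \<le> b") (auto simp: integrable_on_def)
    fix e :: real assume e: "e > 0"
    obtain B1 where B1: "\<And>u. u \<ge> B1 \<Longrightarrow> norm (F u) < e / 2"
      using tendstoD[OF top, of "e/2"] e by (auto simp: eventually_at_top_linorder)
    obtain B2 where B2: "\<And>u. u \<le> B2 \<Longrightarrow> norm (F u) < e / 2"
      using tendstoD[OF bot, of "e/2"] e by (auto simp: eventually_at_bot_linorder)
    let ?B = "max 1 (max \<bar>B1\<bar> \<bar>B2\<bar>)"
    show "\<exists>B>0. \<forall>a b. ball 0 B \<subseteq> cbox a b \<longrightarrow> norm (integral (cbox a b) (\<lambda>x. if x \<in> UNIV then f x else 0) - 0) < e"
    proof (intro exI[of _ ?B] conjI allI impI)
      fix a b :: real assume "ball 0 ?B \<subseteq> cbox a b"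
      then have "{- ?B <..< ?B} \<subseteq> {a..b}" by (simp add: ball_eq_greaterThanLessThan)
      then have ab: "a \<le> - ?B" "?B \<le> b"
        by (auto simp: greaterThanLessThan_subseteq_atLeastAtMost_iff)
      then have "norm (F b - F a) < e / 2 + e / 2"
        by (intro le_less_trans[OF norm_triangle_ineq4] add_strict_mono B1 B2) auto
      moreover have "integral {a..b} f = F b - F a"
        using i[of a b] ab by (intro integral_unique) auto
      ultimately show "norm (integral (cbox a b) (\<lambda>x. if x \<in> UNIV then f x else 0) - 0) < e" by simp
    qed auto
  qed
qed

text \<open>
  The integrand decays only like \<open>1 / u\<close>, so the integral is improper.  Integration by parts replaces
  the denominator by its square; the resulting absolutely convergent integral is the inversion formula
  for the exponential distribution, whose convolution with the kernel is \<open>\<alpha> b exp (- \<alpha> b)\<close>.  For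
  \<open>b = 0\<close> the integral diverges.
\<close>

proposition decay_kernel_has_integral:
  assumes \<alpha>: "\<alpha> > 0" and b: "b \<noteq> 0"
  shows "((\<lambda>u. exp (- \<i> * of_real u * of_real b) / (of_real \<alpha> - \<i> * of_real u)) has_integral
    (2 * of_real pi * decay_kernel (of_real \<alpha>) b)) UNIV"
proof -
  let ?e = "\<lambda>u. exp (- \<i> * of_real u * of_real b)"
  let ?a = "complex_of_real \<alpha>"
  have nz: "?a - \<i> * of_real u \<noteq> 0" for u using \<alpha> by (auto simp: complex_eq_iff)
  let ?h = "\<lambda>u::real. ?a / (?a - \<i> * of_real u)"
  have decay: "norm (?h u) \<le> (\<alpha> * (1 + (1 + \<alpha>) / \<alpha>)) * (1 + \<bar>u\<bar>) powr (- 1)" for u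
  proof -
    have "1 + \<bar>u\<bar> \<le> (1 + (1 + \<alpha>) / \<alpha>) * norm (?a - \<i> * of_real u)"
      using norm_affine_ge[of ?a u] \<alpha> by simp
    moreover have "0 < 1 + \<bar>u\<bar>" by linarith
    ultimately show ?thesis using \<alpha> nz[of u] by (simp add: norm_divide powr_minus divide_simps mult_ac)
  qed
  have hint: "integrable lborel (\<lambda>u. ?h u / (?a - \<i> * of_real u))"
    by (rule powr_decay_quotient_integrable[OF _ _ _ decay]) (use \<alpha> in auto)
  let ?E = "density lborel (exponential_density \<alpha>)"
  interpret E: prob_space ?E by (rule prob_space_exponential_density[OF \<alpha>])
  have E_int: "(LINT x|?E. f x) = (LINT x|lborel. ?a * (decay_kernel ?a x * f x))" if [measurable]: "f \<in> borel_measurable borel" for f :: "real \<Rightarrow> complex"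
  proof -
    have "(LINT x|?E. f x) = (LINT x|lborel. exponential_density \<alpha> x *\<^sub>R f x)"
      using \<alpha> by (subst integral_density) (auto simp: exponential_density_nonneg)
    also have "\<dots> = (LINT x|lborel. ?a * (decay_kernel ?a x * f x))"
      by (rule integral_cong_AE, measurable)
         (use AE_lborel_singleton[of "0::real"] in \<open>auto simp: exponential_density_def decay_kernel_def scaleR_conv_of_real mult_ac simp flip: exp_of_real elim!: eventually_mono\<close>)
    finally show ?thesis .
  qed
  have "(LINT x|?E. decay_kernel ?a (b - x) * 1) = 0 * decay_kernel ?a b + 1 / (2 * of_real pi) *
      (LINT u|lborel. ?e u * ?h u / (?a - \<i> * of_real u))"
  proof (rule decay_kernel_inversion)
    show "(LINT x|?E. exp (\<i> * of_real u * of_real x) * 1) = 0 + ?h u" for u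
    proof -
      have "(LINT x|?E. exp (\<i> * of_real u * of_real x) * 1) = (LINT x|lborel. ?a * (decay_kernel ?a x * exp (\<i> * of_real u * of_real x)))"
        by (simp add: E_int)
      also have "\<dots> = (LINT x|lborel. ?a * decay_kernel (?a - \<i> * of_real u) x)"
        by (intro Bochner_Integration.integral_cong refl) (simp add: decay_kernel_def algebra_simps flip: exp_add)
      finally show ?thesis using decay_kernel_integral[of "?a - \<i> * of_real u"] \<alpha> by simp
    qed
    have "((\<lambda>u. (\<alpha> * (1 + (1 + \<alpha>) / \<alpha>)) * (1 + \<bar>u\<bar>) powr (- 1)) \<longlongrightarrow> 0) at_infinity"
      unfolding at_infinity_eq_at_top_bot by (intro filterlim_sup; real_asymp)
    then show "(?h \<longlongrightarrow> 0) at_infinity"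
      by (rule Lim_null_comparison[OF always_eventually, rotated]) (use decay in auto)
  qed (use \<alpha> hint in \<open>auto intro: E.sigma_finite_measure_axioms\<close>)
  moreover have "(LINT x|?E. decay_kernel ?a (b - x) * 1) = ?a * b * decay_kernel ?a b"
  proof -
    have "(LINT x|?E. decay_kernel ?a (b - x) * 1) = (LINT x|lborel. ?a * (decay_kernel ?a x * decay_kernel ?a (b - x)))"
      by (simp add: E_int)
    also have "\<dots> = (LINT x|lborel. indicator {0<..<b} x *\<^sub>R (?a * decay_kernel ?a b))"
      by (intro Bochner_Integration.integral_cong refl)
         (auto simp: decay_kernel_def algebra_simps split: split_indicator simp flip: exp_add)
    also have "\<dots> = ?a * b * decay_kernel ?a b"
      by (auto simp: decay_kernel_def scaleR_conv_of_real)
    finally show ?thesis .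
  qed
  moreover have "integrable lborel (\<lambda>u. ?e u * ?h u / (?a - \<i> * of_real u))"
    by (rule Bochner_Integration.integrable_bound[OF hint]) (auto simp: norm_mult norm_divide)
  note int' = this
  from calculation have val: "(LINT u|lborel. ?e u * ?h u / (?a - \<i> * of_real u)) =
      2 * of_real pi * (?a * b * decay_kernel ?a b)" by (simp add: field_simps)
  have 1: "((\<lambda>u. ?e u * ?h u / (?a - \<i> * of_real u)) has_integral
      (2 * of_real pi * (?a * b * decay_kernel ?a b))) UNIV"
    using has_integral_integral_lborel[OF int'] unfolding val .
  let ?F = "\<lambda>u. ?e u / (- \<i> * of_real b * (?a - \<i> * of_real u))"
  let ?f = "\<lambda>u. ?e u / (?a - \<i> * of_real u) -
    ?e u * ?h u / (?a - \<i> * of_real u) / (?a * of_real b)"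
  have F: "(?F has_vector_derivative ?f u) (at u)" for u
  proof -
    let ?z = "complex_of_real u"
    have "((\<lambda>z. exp (- \<i> * z * of_real b) / (- \<i> * of_real b * (?a - \<i> * z))) has_field_derivative ?f u) (at ?z)"
      using nz[of u] b \<alpha> by (auto intro!: derivative_eq_intros simp: divide_simps) (simp add: algebra_simps)
    then show ?thesis
      by (rule has_vector_derivative_real_field)
  qed
  have F0: "norm (?F u) \<le> (1 / (\<bar>b\<bar> * \<alpha>)) * norm (?h u)" for u
    using \<alpha> b by (simp add: norm_mult norm_divide divide_simps)
  have F1: "norm (?F u) \<le> (1 / (\<bar>b\<bar> * \<alpha>)) * ((\<alpha> * (1 + (1 + \<alpha>) / \<alpha>)) * (1 + \<bar>u\<bar>) powr (- 1))" for u
    by (rule order_trans[OF F0 mult_left_mono[OF decay]]) (use \<alpha> in auto)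
  have "(?f has_integral 0) UNIV"
  proof (rule has_integral_0_of_vanishing_antiderivative[OF F])
    show "(?F \<longlongrightarrow> 0) at_top"
      by (rule Lim_null_comparison[OF always_eventually[OF allI[OF F1]]]) real_asymp
    show "(?F \<longlongrightarrow> 0) at_bot"
      by (rule Lim_null_comparison[OF always_eventually[OF allI[OF F1]]]) real_asymp
  qed
  from has_integral_add[OF this has_integral_divide[OF 1, of "?a * of_real b"]]
  show ?thesis using \<alpha> b by (simp add: field_simps)
qed

section \<open>Distribution functions and truncated transforms\<close>

lemma powr_decay_tendsto_0:
  fixes h :: "real \<Rightarrow> complex"
  assumes \<nu>: "\<nu> > 0" and bound: "\<And>u. norm (h u) \<le> C * (1 + \<bar>u\<bar>) powr (- \<nu>)"
  shows "(h \<longlongrightarrow> 0) at_infinity"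
proof (rule Lim_null_comparison[OF always_eventually[OF allI[OF bound]]])
  show "((\<lambda>u. C * (1 + \<bar>u\<bar>) powr (- \<nu>)) \<longlongrightarrow> 0) at_infinity"
    unfolding at_infinity_eq_at_top_bot
    by (intro filterlim_sup; use \<nu> in real_asymp)
qed

lemma i_times_Complex: "\<i> * Complex u w = of_real (- w) + \<i> * of_real u"
  by (simp add: complex_eq_iff)

lemma exp_i_Complex:
  "exp (\<i> * Complex u w * of_real y) = exp (\<i> * of_real u * of_real y) * of_real (exp (- w * y))"
proof -
  have "\<i> * Complex u w * of_real y = \<i> * of_real u * of_real y + of_real (- w * y)"
    by (simp add: complex_eq_iff)
  then show ?thesis by (simp only: exp_add exp_of_real)
qed

lemma norm_exp_i_times: "norm (exp (\<i> * z * of_real y)) = exp (- Im z * y)"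
  by simp

text \<open>
  The inversion formula for the measure tilted by \<open>exp (- w Y)\<close>, with kernel parameter \<open>w\<close>: up to
  the factor \<open>exp (- w y)\<close> the tilt and the kernel cancel and leave the indicator of \<open>Y < y\<close>.  The only
  possible atom is at \<open>0\<close> and has mass \<open>c\<close>, so the assumption \<open>nondeg\<close> says that \<open>y\<close> carries no mass.
\<close>

lemma cdf_inversion:
  fixes Y :: "'b \<Rightarrow> real" and h :: "real \<Rightarrow> complex"
  assumes P: "prob_space P" and Y[measurable]: "Y \<in> borel_measurable P" and w: "w > 0"
    and int: "integrable P (\<lambda>x. exp (- w * Y x))"
    and h[measurable]: "h \<in> borel_measurable borel" and \<nu>: "\<nu> > 0"
    and bound: "\<And>u. norm (h u) \<le> C * (1 + \<bar>u\<bar>) powr (- \<nu>)"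
    and transform: "\<And>u. (LINT x|P. exp (\<i> * Complex u w * of_real (Y x))) = c + h u"
    and nondeg: "y = 0 \<Longrightarrow> c = 0"
  shows "integrable lborel (\<lambda>u. exp (- \<i> * of_real y * Complex u w) * h u / (- \<i> * Complex u w))"
    and "complex_of_real (measure P {x \<in> space P. Y x \<le> y}) = (if y > 0 then c else 0) +
      1 / (2 * of_real pi) * (LINT u|lborel. exp (- \<i> * of_real y * Complex u w) * h u / (- \<i> * Complex u w))"
proof -
  let ?K = "\<lambda>u. exp (- \<i> * of_real u * of_real y) * h u / (of_real w - \<i> * of_real u)"
  let ?L = "{x \<in> space P. Y x < y}"
  let ?Y = "{x \<in> space P. Y x = y}"
  interpret prob_space P by fact
  define W where "W x = complex_of_real (exp (- w * Y x))" for x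
  have W: "integrable P W" unfolding W_def using int by simp
  have tr: "(LINT x|P. exp (\<i> * of_real u * of_real (Y x)) * W x) = c + h u" for u
    using transform[of u] unfolding exp_i_Complex W_def .
  note hlim = powr_decay_tendsto_0[OF \<nu> bound]
  have hint: "integrable lborel (\<lambda>u. h u / (of_real w - \<i> * of_real u))"
    by (rule powr_decay_quotient_integrable[OF _ \<nu> h bound]) (use w in simp)
  have den: "- \<i> * Complex u w = of_real w - \<i> * of_real u" for u
    by (simp add: complex_eq_iff)
  have ex: "exp (- \<i> * of_real y * Complex u w) = of_real (exp (w * y)) * exp (- \<i> * of_real u * of_real y)" for u
    using exp_i_Complex[of u w "- y"] by (simp add: mult_ac)
  have form: "exp (- \<i> * of_real y * Complex u w) * h u / (- \<i> * Complex u w) =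
      of_real (exp (w * y)) * (?K u)" for u
    unfolding ex den by simp
  have base: "integrable lborel (\<lambda>u. ?K u)"
    by (rule Bochner_Integration.integrable_bound[OF hint]) (auto simp: norm_mult norm_divide)
  show "integrable lborel (\<lambda>u. exp (- \<i> * of_real y * Complex u w) * h u / (- \<i> * Complex u w))"
    unfolding form using base by (rule integrable_mult_right)
  \<comment> \<open>For \<open>y = 0\<close> this is where \<open>nondeg\<close> enters.\<close>
  have at: "measure P ?Y = 0"
  proof -
    have "(LINT x|P. (if Y x = y then W x else 0)) = (if y = 0 then c else 0)"
      by (rule atom_of_transform[OF sigma_finite_measure_axioms W Y h tr hlim])
    also have "\<dots> = 0" using nondeg by simp
    also have "(LINT x|P. (if Y x = y then W x else 0)) = (LINT x|P. of_real (exp (- w * y)) * of_real (indicator ?Y x))"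
      by (intro Bochner_Integration.integral_cong refl) (auto simp: W_def indicator_def)
    also have "\<dots> = of_real (exp (- w * y)) * of_real (measure P (?Y \<inter> space P))"
      unfolding integral_mult_right_zero integral_complex_of_real by simp
    also have "?Y \<inter> space P = ?Y" by auto
    finally show ?thesis by simp
  qed
  have lt: "measure P {x \<in> space P. Y x \<le> y} = measure P ?L"
  proof -
    have "{x \<in> space P. Y x \<le> y} = ?L \<union> ?Y" by auto
    moreover have "measure P (?L \<union> ?Y) =
        measure P ?L + measure P ?Y"
      by (rule finite_measure_Union) auto
    ultimately show ?thesis using at by simp
  qed
  have "(LINT x|P. decay_kernel (of_real w) (y - Y x) * W x) = of_real (exp (- w * y)) * of_real (measure P ?L)"
  proof -
    have "(LINT x|P. decay_kernel (of_real w) (y - Y x) * W x) =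
        (LINT x|P. of_real (exp (- w * y)) * of_real (indicator ?L x))"
    proof (intro Bochner_Integration.integral_cong refl)
      fix x assume x: "x \<in> space P"
      have "exp (- of_real w * of_real (y - Y x)) * W x = of_real (exp (- w * y))" if "Y x < y"
        unfolding W_def by (simp add: algebra_simps flip: exp_of_real exp_add)
      then show "decay_kernel (of_real w) (y - Y x) * W x = of_real (exp (- w * y)) * of_real (indicator ?L x)"
        using x by (simp add: decay_kernel_def indicator_def)
    qed
    also have "\<dots> = of_real (exp (- w * y)) * of_real (measure P (?L \<inter> space P))"
      unfolding integral_mult_right_zero integral_complex_of_real by simp
    also have "?L \<inter> space P = ?L" by auto
    finally show ?thesis .
  qed
  moreover have "(LINT x|P. decay_kernel (of_real w) (y - Y x) * W x) = c * decay_kernel (of_real w) y + 1 / (2 * of_real pi) *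
      (LINT u|lborel. ?K u)"
    by (rule decay_kernel_inversion[OF sigma_finite_measure_axioms W Y h _ tr hlim hint]) (use w in simp)
  ultimately have "of_real (exp (w * y)) * (of_real (exp (- w * y)) * of_real (measure P ?L)) =
      of_real (exp (w * y)) * (c * decay_kernel (of_real w) y) + 1 / (2 * of_real pi) *
      (of_real (exp (w * y)) * (LINT u|lborel. ?K u))"
    by (simp add: algebra_simps)
  moreover have "complex_of_real (exp (w * y)) * (of_real (exp (- w * y)) * z) = z" for z
    by (simp add: exp_minus)
  moreover have "of_real (exp (w * y)) * (c * decay_kernel (of_real w) y) = (if y > 0 then c else 0)"
  proof -
    have "complex_of_real (exp (w * y)) * exp (- of_real w * of_real y) = 1"
      by (simp add: exp_minus flip: exp_of_real)
    then show ?thesis by (simp add: decay_kernel_def mult.left_commute)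
  qed
  ultimately show "complex_of_real (measure P {x \<in> space P. Y x \<le> y}) = (if y > 0 then c else 0) +
      1 / (2 * of_real pi) * (LINT u|lborel. exp (- \<i> * of_real y * Complex u w) * h u / (- \<i> * Complex u w))"
    unfolding form lt integral_mult_right_zero by (simp only:)
qed

text \<open>
  The same inversion for \<open>- Y\<close>.  The kernel parameter is now complex, \<open>\<alpha> = - i \<xi> - w\<close>, and the kernel
  produces the exponential \<open>exp (i \<xi> Y)\<close> above the level \<open>b\<close>.  The constant \<open>c\<close> does not appear, since
  \<open>b \<ge> 0\<close> and the kernel vanishes at \<open>- b\<close>.
\<close>

lemma tail_transform:
  fixes Y :: "'b \<Rightarrow> real" and h :: "real \<Rightarrow> complex"
  assumes P: "prob_space P" and Y[measurable]: "Y \<in> borel_measurable P"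
    and int: "integrable P (\<lambda>x. exp (- w * Y x))"
    and h[measurable]: "h \<in> borel_measurable borel" and \<nu>: "\<nu> > 0"
    and bound: "\<And>u. norm (h u) \<le> C * (1 + \<bar>u\<bar>) powr (- \<nu>)"
    and transform: "\<And>u. (LINT x|P. exp (\<i> * Complex u w * of_real (Y x))) = c + h u"
    and b: "b \<ge> 0" and \<xi>: "w < Im \<xi>"
  shows "(LINT x|P. of_bool (b < Y x) * exp (\<i> * \<xi> * of_real (Y x))) =
    exp (\<i> * \<xi> * of_real b) / (2 * of_real pi) *
      (LINT u|lborel. exp (- \<i> * of_real b * Complex u w) * h u / (\<i> * (Complex u w - \<xi>)))"
proof -
  let ?K = "\<lambda>\<alpha> u. exp (- \<i> * of_real u * of_real b) * h u / (\<alpha> + \<i> * of_real u)"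
  interpret prob_space P by fact
  define \<alpha> where "\<alpha> = - (\<i> * \<xi> + of_real w)"
  have \<alpha>: "Re \<alpha> > 0" using \<xi> by (simp add: \<alpha>_def)
  define W where "W x = complex_of_real (exp (- w * Y x))" for x
  have W: "integrable P W" unfolding W_def using int by simp
  have tr: "(LINT x|P. exp (\<i> * of_real u * of_real (- Y x)) * W x) = c + h (- u)" for u
    using transform[of "- u"] unfolding exp_i_Complex W_def by simp
  have bound': "norm (h (- u)) \<le> C * (1 + \<bar>u\<bar>) powr (- \<nu>)" for u
    using bound[of "- u"] by simp
  have hm: "(\<lambda>u. h (- u)) \<in> borel_measurable borel" by measurable
  have Ym: "(\<lambda>x. - Y x) \<in> borel_measurable P" by measurable
  have "(LINT x|P. decay_kernel \<alpha> (- b - - Y x) * W x) = c * decay_kernel \<alpha> (- b) + 1 / (2 * of_real pi) *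
      (LINT u|lborel. exp (- \<i> * of_real u * of_real (- b)) * h (- u) / (\<alpha> - \<i> * of_real u))"
    by (rule decay_kernel_inversion[OF sigma_finite_measure_axioms W Ym hm \<alpha> tr powr_decay_tendsto_0[OF \<nu> bound']
          powr_decay_quotient_integrable[OF \<alpha> \<nu> hm bound']])
  also have "(LINT u|lborel. exp (- \<i> * of_real u * of_real (- b)) * h (- u) / (\<alpha> - \<i> * of_real u)) =
      (LINT u|lborel. ?K \<alpha> u)"
    by (subst lborel_integral_real_affine[where c = "-1" and t = 0]) simp_all
  also have "decay_kernel \<alpha> (- b) = 0" using b by (simp add: decay_kernel_def)
  finally have K: "(LINT x|P. decay_kernel \<alpha> (Y x - b) * W x) = 1 / (2 * of_real pi) *
      (LINT u|lborel. ?K \<alpha> u)"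
    by simp
  have "(LINT x|P. of_bool (b < Y x) * exp (\<i> * \<xi> * of_real (Y x))) =
      (LINT x|P. exp (\<i> * \<xi> * of_real b) * of_real (exp (w * b)) * (decay_kernel \<alpha> (Y x - b) * W x))"
  proof (intro Bochner_Integration.integral_cong refl)
    fix x
    have "exp (\<i> * \<xi> * of_real b) * of_real (exp (w * b)) * (exp (- \<alpha> * of_real (Y x - b)) * W x) = exp (\<i> * \<xi> * of_real (Y x))"
      unfolding W_def \<alpha>_def by (simp add: algebra_simps flip: exp_of_real exp_add)
    then show "of_bool (b < Y x) * exp (\<i> * \<xi> * of_real (Y x)) = exp (\<i> * \<xi> * of_real b) * of_real (exp (w * b)) * (decay_kernel \<alpha> (Y x - b) * W x)"
      by (simp add: decay_kernel_def)
  qed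
  also have "\<dots> = exp (\<i> * \<xi> * of_real b) * of_real (exp (w * b)) * (1 / (2 * of_real pi) *
      (LINT u|lborel. ?K \<alpha> u))"
    unfolding integral_mult_right_zero K ..
  also have "\<dots> = exp (\<i> * \<xi> * of_real b) / (2 * of_real pi) *
      (LINT u|lborel. of_real (exp (w * b)) * (?K \<alpha> u))"
    unfolding integral_mult_right_zero by simp
  also have "(\<lambda>u. of_real (exp (w * b)) * (?K \<alpha> u)) =
      (\<lambda>u. exp (- \<i> * of_real b * Complex u w) * h u / (\<i> * (Complex u w - \<xi>)))"
  proof
    fix u
    have "\<alpha> + \<i> * of_real u = \<i> * (Complex u w - \<xi>)"
      unfolding \<alpha>_def by (simp add: complex_eq_iff)
    moreover have "exp (- \<i> * of_real b * Complex u w) = of_real (exp (w * b)) * exp (- \<i> * of_real u * of_real b)"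
      using exp_i_Complex[of u w "- b"] by (simp add: mult_ac)
    ultimately show "of_real (exp (w * b)) * (?K \<alpha> u) =
      exp (- \<i> * of_real b * Complex u w) * h u / (\<i> * (Complex u w - \<xi>))" by simp
  qed
  finally show ?thesis .
qed

text \<open>
  In absolute value the kernel is at most a constant times
  \<open>(1 + |s|) powr (- 1 - \<nu>2) * ((1 + |u|) powr (- \<nu>1) / (1 + |s - u|))\<close>, and \<open>powr_decay_product\<close> bounds
  the second factor by a function of \<open>u\<close> plus a function of \<open>s - u\<close>, both integrable.
\<close>

lemma double_kernel_integrable:
  fixes f g :: "real \<Rightarrow> complex"
  assumes f[measurable]: "f \<in> borel_measurable borel" and g[measurable]: "g \<in> borel_measurable borel"
    and \<nu>: "\<nu>1 > 0" "\<nu>2 > 0" and v: "v < 0" "0 < w"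
    and f_bd: "\<And>u. norm (f u) \<le> C1 * (1 + \<bar>u\<bar>) powr (- \<nu>1)"
    and g_bd: "\<And>s. norm (g s) \<le> C2 * (1 + \<bar>s\<bar>) powr (- \<nu>2)"
  shows "integrable (lborel \<Otimes>\<^sub>M lborel) (\<lambda>(u, s). f u * g s / (Complex s w * (Complex s w - Complex u v)))"
proof -
  let ?K = "\<lambda>u s. f u * g s / (Complex s w * (Complex s w - Complex u v))"
  define A where "A s = (1 + \<bar>s\<bar>) powr (- (1 + \<nu>2))" for s :: real
  define B where "B s = (1 + \<bar>s\<bar>) powr (- (1 + \<nu>1))" for s :: real
  have [measurable]: "A \<in> borel_measurable borel" "B \<in> borel_measurable borel"
    unfolding A_def[abs_def] B_def[abs_def] by measurable
  have "integrable lborel A"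
    unfolding A_def[abs_def] by (rule one_plus_abs_powr_integrable) (use \<nu> in simp)
  moreover have "A s \<ge> 0" for s by (simp add: A_def)
  ultimately have A: "integrable lborel A" "A s \<ge> 0" for s by auto
  have "integrable lborel B"
    unfolding B_def[abs_def] by (rule one_plus_abs_powr_integrable) (use \<nu> in simp)
  moreover have "B s \<ge> 0" for s by (simp add: B_def)
  ultimately have B: "integrable lborel B" "B s \<ge> 0" for s by auto
  define D1 where "D1 = 1 + (1 + w) / w"
  define D2 where "D2 = 1 + (1 + (w - v)) / (w - v)"
  have D: "D1 > 0" "D2 > 0" unfolding D1_def D2_def using v by (simp_all add: add_pos_nonneg)
  have C: "C1 \<ge> 0" "C2 \<ge> 0"
    using order_trans[OF norm_ge_zero f_bd[of 0]] order_trans[OF norm_ge_zero g_bd[of 0]] by simp_all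
  have d1: "1 + \<bar>s\<bar> \<le> D1 * norm (Complex s w)" for s
  proof -
    have "Complex s w = \<i> * (of_real w - \<i> * of_real s)" by (simp add: complex_eq_iff)
    then have "norm (Complex s w) = norm (complex_of_real w - \<i> * of_real s)" by (simp add: norm_mult)
    then show ?thesis using norm_affine_ge[of "of_real w" s] v unfolding D1_def by simp
  qed
  have d2: "1 + \<bar>s - u\<bar> \<le> D2 * norm (Complex s w - Complex u v)" for s u
  proof -
    have "Complex s w - Complex u v = \<i> * (of_real (w - v) - \<i> * of_real (s - u))" by (simp add: complex_eq_iff)
    then have "norm (Complex s w - Complex u v) = norm (complex_of_real (w - v) - \<i> * of_real (s - u))"
      by (simp add: norm_mult del: of_real_diff)
    then show ?thesis using norm_affine_ge[of "of_real (w - v)" "s - u"] v unfolding D2_def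
      by (simp del: of_real_diff)
  qed
  have bound: "norm (?K u s) \<le>
      C1 * C2 * D1 * D2 * (A s * (B u + B (s - u)))" for u s
  proof -
    have p: "0 < 1 + \<bar>s\<bar>" "0 < 1 + \<bar>s - u\<bar>" by linarith+
    have n1: "norm (Complex s w) > 0" using d1[of s] p D by (smt (verit) mult_nonneg_nonpos norm_ge_zero)
    have n2: "norm (Complex s w - Complex u v) > 0" using d2[of s u] p D by (smt (verit) mult_nonneg_nonpos norm_ge_zero)
    have i1: "1 / norm (Complex s w) \<le> D1 / (1 + \<bar>s\<bar>)"
      using d1[of s] n1 p by (simp add: divide_simps mult.commute)
    have i2: "1 / norm (Complex s w - Complex u v) \<le> D2 / (1 + \<bar>s - u\<bar>)"
      using d2[of s u] n2 p by (simp add: divide_simps mult.commute)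
    have "norm (?K u s) =
        (norm (g s) * (1 / norm (Complex s w))) * (norm (f u) * (1 / norm (Complex s w - Complex u v)))"
      by (simp add: norm_mult norm_divide)
    also have "\<dots> \<le> ((C2 * (1 + \<bar>s\<bar>) powr (- \<nu>2)) * (D1 / (1 + \<bar>s\<bar>))) * ((C1 * (1 + \<bar>u\<bar>) powr (- \<nu>1)) * (D2 / (1 + \<bar>s - u\<bar>)))"
      using C D p n1 n2 by (intro mult_mono f_bd g_bd i1 i2) auto
    also have "\<dots> = C1 * C2 * D1 * D2 * (((1 + \<bar>s\<bar>) powr (- \<nu>2) / (1 + \<bar>s\<bar>)) * ((1 + \<bar>u\<bar>) powr (- \<nu>1) / (1 + \<bar>s - u\<bar>)))"
      by simp
    also have "(1 + \<bar>s\<bar>) powr (- \<nu>2) / (1 + \<bar>s\<bar>) = A s"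
      unfolding A_def using p powr_add[of "1 + \<bar>s\<bar>" "- \<nu>2" "-1"] by (simp add: powr_minus_divide[of _ 1] algebra_simps)
    also have "C1 * C2 * D1 * D2 * (A s * ((1 + \<bar>u\<bar>) powr (- \<nu>1) / (1 + \<bar>s - u\<bar>))) \<le> C1 * C2 * D1 * D2 * (A s * (B u + B (s - u)))"
      using powr_decay_product[of "\<bar>u\<bar>" "\<bar>s - u\<bar>" \<nu>1] \<nu> C D A(2)[of s] unfolding B_def
      by (intro mult_left_mono) auto
    finally show ?thesis .
  qed
  have "integrable (lborel \<Otimes>\<^sub>M lborel) (\<lambda>(u, s). A s * B u)"
    by (rule lborel_pair.integrable_pair_dominated[where g = B and h = A]) (use A B in \<open>auto simp: abs_mult mult.commute\<close>)
  moreover have "integrable (lborel \<Otimes>\<^sub>M lborel) (\<lambda>(u, s). A s * B (s - u))"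
  proof -
    have "integrable (lborel \<Otimes>\<^sub>M lborel) (\<lambda>z. A (fst z) * B (fst z - snd z))"
    proof (rule lborel_pair.Fubini_integrable)
      have Bi: "integrable lborel (\<lambda>u. B (s - u))" for s
        using lborel_integrable_real_affine[OF B(1), of "-1" s] by simp
      have Bv: "(LINT u|lborel. B (s - u)) = (LINT u|lborel. B u)" for s
        by (subst (2) lborel_integral_real_affine[where c = "-1" and t = s]) simp_all
      show "AE s in lborel. integrable lborel (\<lambda>u. A (fst (s, u)) * B (fst (s, u) - snd (s, u)))"
        using Bi by simp
      have "(\<lambda>s. LINT u|lborel. norm (A (fst (s, u)) * B (fst (s, u) - snd (s, u)))) = (\<lambda>s. A s * (LINT u|lborel. B u))"
        using A B by (simp add: abs_mult Bv)
      then show "integrable lborel (\<lambda>s. LINT u|lborel. norm (A (fst (s, u)) * B (fst (s, u) - snd (s, u))))"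
        using A by simp
    qed measurable
    then show ?thesis
      by (subst lborel_pair.integrable_product_swap_iff[symmetric]) (simp add: case_prod_unfold)
  qed
  ultimately have "integrable (lborel \<Otimes>\<^sub>M lborel) (\<lambda>z. (case z of (u, s) \<Rightarrow> A s * B u) + (case z of (u, s) \<Rightarrow> A s * B (s - u)))"
    by (rule Bochner_Integration.integrable_add)
  then have "integrable (lborel \<Otimes>\<^sub>M lborel) (\<lambda>z. C1 * C2 * D1 * D2 * ((case z of (u, s) \<Rightarrow> A s * B u) + (case z of (u, s) \<Rightarrow> A s * B (s - u))))"
    by (rule integrable_mult_right)
  then show ?thesis
  proof (rule Bochner_Integration.integrable_bound)
    have Cm: "(\<lambda>s. Complex s w) = (\<lambda>s. of_real s + \<i> * of_real w)" "(\<lambda>s. Complex s v) = (\<lambda>s. of_real s + \<i> * of_real v)"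
      by (simp_all add: Complex_eq)
    have [measurable]: "(\<lambda>s. Complex s w) \<in> borel_measurable borel" "(\<lambda>s. Complex s v) \<in> borel_measurable borel"
      unfolding Cm by measurable
    show "(\<lambda>(u, s). ?K u s) \<in> borel_measurable (lborel \<Otimes>\<^sub>M lborel)"
      by measurable
    show "AE z in lborel \<Otimes>\<^sub>M lborel. norm (case z of (u, s) \<Rightarrow> ?K u s) \<le>
        norm (C1 * C2 * D1 * D2 * ((case z of (u, s) \<Rightarrow> A s * B u) + (case z of (u, s) \<Rightarrow> A s * B (s - u))))"
    proof (rule AE_I2)
      fix z :: "real \<times> real"
      obtain u s where z: "z = (u, s)" by force
      show "norm (case z of (u, s) \<Rightarrow> ?K u s) \<le>
        norm (C1 * C2 * D1 * D2 * ((case z of (u, s) \<Rightarrow> A s * B u) + (case z of (u, s) \<Rightarrow> A s * B (s - u))))"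
        using order_trans[OF bound[of u s] abs_ge_self] by (simp add: z distrib_left)
    qed
  qed
qed

lemma Complex_line_measurable [measurable]: "(\<lambda>u. Complex u w) \<in> borel_measurable borel"
  unfolding Complex_eq by measurable

text \<open>
  Think of \<open>m\<close> under \<open>\<mu>\<close> as the maximum and of \<open>n\<close> under \<open>\<nu>\<close> as the position relative to the maximum.
  For \<open>m > b\<close> the probability of \<open>n \<le> h - m\<close> is given by \<open>cdf_inversion\<close> at a negative point; the
  integral over \<open>m > b\<close> of the resulting exponentials is given by \<open>tail_transform\<close>.
\<close>

lemma max_crossing_probability:
  fixes \<mu> \<nu> :: "real measure" and f g :: "real \<Rightarrow> complex"
  assumes \<mu>: "prob_space \<mu>" "sets \<mu> = sets borel" and \<nu>: "prob_space \<nu>" "sets \<nu> = sets borel"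
    and v: "v < 0" and w: "0 < w"
    and int_\<mu>: "integrable \<mu> (\<lambda>m. exp (- v * m))" and int_\<nu>: "integrable \<nu> (\<lambda>n. exp (- w * n))"
    and f[measurable]: "f \<in> borel_measurable borel" and g[measurable]: "g \<in> borel_measurable borel"
    and rates: "r1 > 0" "r2 > 0"
    and f_bd: "\<And>u. norm (f u) \<le> C1 * (1 + \<bar>u\<bar>) powr (- r1)"
    and g_bd: "\<And>s. norm (g s) \<le> C2 * (1 + \<bar>s\<bar>) powr (- r2)"
    and \<mu>_tr: "\<And>u. (LINT m|\<mu>. exp (\<i> * Complex u v * of_real m)) = a + f u"
    and \<nu>_tr: "\<And>s. (LINT n|\<nu>. exp (\<i> * Complex s w * of_real n)) = a' + g s"
    and b: "0 \<le> b" and hb: "h \<le> b"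
  defines "J \<equiv> \<lambda>u. LINT s|lborel. exp (\<i> * Complex s w * of_real (b - h)) * g s / (Complex s w * (Complex s w - Complex u v))"
  shows "integrable lborel (\<lambda>s. exp (\<i> * Complex s w * of_real (b - h)) * g s / (Complex s w * (Complex s w - Complex u v)))"
    and "integrable lborel (\<lambda>u. exp (- \<i> * of_real b * Complex u v) * f u * J u)"
    and "complex_of_real (measure (\<mu> \<Otimes>\<^sub>M \<nu>) {z \<in> space (\<mu> \<Otimes>\<^sub>M \<nu>). b < fst z \<and> fst z + snd z \<le> h}) =
      - (1 / (2 * of_real pi)\<^sup>2) * (LINT u|lborel. exp (- \<i> * of_real b * Complex u v) * f u * J u)"
proof -
  let ?D = "\<lambda>u s. Complex s w * (Complex s w - Complex u v)"
  let ?eb = "\<lambda>u. exp (- \<i> * of_real b * Complex u v)"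
  let ?eh = "\<lambda>m s. exp (- \<i> * of_real (h - m) * Complex s w)"
  let ?n = "\<lambda>s. norm (g s / (of_real w - \<i> * of_real s))"
  let ?c2 = "1 / (2 * complex_of_real pi)\<^sup>2"
  interpret \<mu>: prob_space \<mu> by fact
  interpret \<nu>: prob_space \<nu> by fact
  interpret MN: pair_prob_space \<mu> \<nu> ..
  interpret PL: pair_sigma_finite \<mu> lborel ..
  have [measurable_cong]: "sets \<mu> = sets borel" "sets \<nu> = sets borel" by (fact \<mu>(2), fact \<nu>(2))
  have [simp]: "space \<mu> = UNIV" "space \<nu> = UNIV"
    using sets_eq_imp_space_eq[OF \<mu>(2)] sets_eq_imp_space_eq[OF \<nu>(2)] by simp_all
  define F where "F u = ?eb u * f u" for u
  define G where "G s = exp (\<i> * Complex s w * of_real (b - h)) * g s" for s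
  have [measurable]: "F \<in> borel_measurable borel" "G \<in> borel_measurable borel"
    unfolding F_def[abs_def] G_def[abs_def] by measurable
  have F_le: "norm (F u) \<le> norm (f u)" for u
  proof -
    have "v * b \<le> 0" using v b by (intro mult_nonpos_nonneg) auto
    then have "norm (?eb u) \<le> 1" by (simp add: mult.commute)
    then show ?thesis unfolding F_def norm_mult by (intro mult_left_le_one_le) auto
  qed
  have G_le: "norm (G s) \<le> norm (g s)" for s
  proof -
    have "0 \<le> w * (b - h)" using w hb by (intro mult_nonneg_nonneg) auto
    then have "norm (exp (\<i> * Complex s w * of_real (b - h))) \<le> 1" unfolding norm_exp_i_times by simp
    then show ?thesis unfolding G_def norm_mult by (intro mult_left_le_one_le) auto
  qed
  have K: "integrable (lborel \<Otimes>\<^sub>M lborel) (\<lambda>(u, s). F u * G s / (?D u s))"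
    by (rule double_kernel_integrable[OF _ _ rates v w order_trans[OF F_le f_bd] order_trans[OF G_le g_bd]]) measurable
  have w0: "Re (complex_of_real w) > 0" using w by simp
  have g_int: "integrable lborel (\<lambda>s. g s / (of_real w - \<i> * of_real s))"
    by (rule powr_decay_quotient_integrable[OF w0 rates(2) g g_bd])
  have line_w: "- \<i> * Complex s w = of_real w - \<i> * of_real s" for s
    by (simp add: complex_eq_iff)
  have norm_w: "norm (Complex s w) = norm (of_real w - \<i> * of_real s)" for s
    unfolding line_w[symmetric] by (simp add: norm_mult)
  show inner: "integrable lborel (\<lambda>s. exp (\<i> * Complex s w * of_real (b - h)) * g s / (?D u s))" for u
  proof -
    have "integrable lborel (\<lambda>s. ?n s / (w - v))"
      using integrable_norm[OF g_int] by simp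
    then have "integrable lborel (\<lambda>s. G s / (?D u s))"
    proof (rule Bochner_Integration.integrable_bound)
      show "AE s in lborel. norm (G s / (?D u s)) \<le> norm (?n s / (w - v))"
      proof (rule AE_I2)
        fix s
        have d: "w - v \<le> norm (Complex s w - Complex u v)"
          using abs_Im_le_cmod[of "Complex s w - Complex u v"] by simp
        have "norm (G s / (?D u s)) = (norm (G s) / norm (Complex s w)) / norm (Complex s w - Complex u v)"
          by (simp add: norm_divide norm_mult)
        also have "\<dots> \<le> (norm (g s) / norm (Complex s w)) / (w - v)"
          using d v w by (intro frac_le divide_right_mono G_le) auto
        also have "\<dots> = norm (?n s / (w - v))"
          using v w by (simp add: norm_w norm_divide)
        finally show "norm (G s / (?D u s)) \<le> norm (?n s / (w - v))" .
      qed
    qed measurable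
    then show ?thesis unfolding G_def .
  qed
  have J: "(LINT s|lborel. F u * G s / (?D u s)) = ?eb u * f u * J u" for u
    unfolding J_def F_def[symmetric] G_def[symmetric] integral_mult_right_zero[symmetric] by simp
  show "integrable lborel (\<lambda>u. ?eb u * f u * J u)"
    using lborel_pair.integrable_fst[OF K] unfolding J .
  let ?A = "{z \<in> space (\<mu> \<Otimes>\<^sub>M \<nu>). b < fst z \<and> fst z + snd z \<le> h}"
  let ?H = "\<lambda>m s. of_bool (b < m) * (1 / (2 * of_real pi) * (?eh m s * g s / (- \<i> * Complex s w)))"
  have A[measurable]: "?A \<in> sets (\<mu> \<Otimes>\<^sub>M \<nu>)" by measurable
  have id_\<mu>: "(\<lambda>m. m) \<in> borel_measurable \<mu>" and id_\<nu>: "(\<lambda>n. n) \<in> borel_measurable \<nu>" by measurable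
  have slice: "complex_of_real (LINT n|\<nu>. indicat_real ?A (m, n)) = (LINT s|lborel. ?H m s)" for m
  proof (cases "b < m")
    case False
    then have "indicat_real ?A (m, n) = 0" for n by (simp add: indicator_def)
    then show ?thesis using False by simp
  next
    case True
    have "indicat_real ?A (m, n) = indicator {n. n \<le> h - m} n" for n
      using True by (auto simp: indicator_def space_pair_measure)
    then have "(LINT n|\<nu>. indicat_real ?A (m, n)) = measure \<nu> {n. n \<le> h - m}" by simp
    also have "complex_of_real (measure \<nu> {n. n \<le> h - m}) = (if h - m > 0 then a' else 0) +
        1 / (2 * of_real pi) * (LINT s|lborel. ?eh m s * g s / (- \<i> * Complex s w))"
      using cdf_inversion(2)[OF \<nu>(1) id_\<nu> w int_\<nu> g rates(2) g_bd \<nu>_tr, of "h - m"] True hb by simp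
    also have "(if h - m > 0 then a' else 0) = 0" using True hb by simp
    also have "0 + 1 / (2 * of_real pi) * (LINT s|lborel. ?eh m s * g s / (- \<i> * Complex s w)) =
        (LINT s|lborel. ?H m s)"
      using True unfolding integral_mult_right_zero by simp
    finally show ?thesis .
  qed
  have H_int: "integrable (\<mu> \<Otimes>\<^sub>M lborel) (case_prod ?H)"
  proof (rule PL.integrable_pair_dominated[where g = "\<lambda>_. 1 / (2 * pi)" and h = "\<lambda>s. ?n s"])
    show "case_prod ?H \<in> borel_measurable (\<mu> \<Otimes>\<^sub>M lborel)" by measurable
    show "integrable lborel (\<lambda>s. ?n s)" by (rule integrable_norm[OF g_int])
    fix m s :: real
    show "norm (?H m s) \<le> 1 / (2 * pi) * ?n s"
    proof (cases "b < m")
      case True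
      have "w * (h - m) \<le> 0" using w True hb by (intro mult_nonneg_nonpos) auto
      then have "norm (?eh m s) \<le> 1" by (simp add: mult.commute)
      then have "norm (?eh m s) * ?n s \<le> ?n s"
        by (intro mult_left_le_one_le) auto
      then have "1 / (2 * pi) * (norm (?eh m s) * ?n s)
          \<le> 1 / (2 * pi) * ?n s"
        by (intro mult_left_mono) auto
      moreover have "norm (?H m s) = 1 / (2 * pi) * (norm (?eh m s) * ?n s)"
        unfolding line_w using True by (simp only: norm_mult norm_divide) simp
      ultimately show ?thesis by (simp only:)
    qed simp
  qed simp
  have swap: "(LINT m|\<mu>. ?H m s) = - ?c2 * (LINT u|lborel. F u * G s / (?D u s))" for s
  proof -
    let ?c = "1 / (2 * of_real pi) * (exp (- \<i> * of_real h * Complex s w) * g s / (- \<i> * Complex s w))"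
    have "?H m s = ?c * (of_bool (b < m) * exp (\<i> * Complex s w * of_real m))" for m
      by (simp add: algebra_simps flip: exp_add)
    then have "(LINT m|\<mu>. ?H m s) = ?c * (LINT m|\<mu>. of_bool (b < m) * exp (\<i> * Complex s w * of_real m))"
      by (simp only: integral_mult_right_zero)
    also have "(LINT m|\<mu>. of_bool (b < m) * exp (\<i> * Complex s w * of_real m)) =
        exp (\<i> * Complex s w * of_real b) / (2 * of_real pi) *
        (LINT u|lborel. ?eb u * f u / (\<i> * (Complex u v - Complex s w)))"
      by (rule tail_transform[OF \<mu>(1) id_\<mu> int_\<mu> f rates(1) f_bd \<mu>_tr b]) (use v w in simp)
    also have "?c * (exp (\<i> * Complex s w * of_real b) / (2 * of_real pi) *
        (LINT u|lborel. ?eb u * f u / (\<i> * (Complex u v - Complex s w)))) =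
        (LINT u|lborel. ?c * (exp (\<i> * Complex s w * of_real b) / (2 * of_real pi)) *
          (F u / (\<i> * (Complex u v - Complex s w))))"
      unfolding F_def[symmetric] integral_mult_right_zero by (simp only: mult.assoc)
    also have "\<dots> = (LINT u|lborel. - ?c2 * (F u * G s / (?D u s)))"
    proof (intro Bochner_Integration.integral_cong refl)
      fix u
      have e: "exp (- \<i> * of_real h * Complex s w) * exp (\<i> * Complex s w * of_real b) = exp (\<i> * Complex s w * of_real (b - h))"
        by (simp add: algebra_simps flip: exp_add)
      have "?c * (exp (\<i> * Complex s w * of_real b) / (2 * of_real pi)) * (F u / (\<i> * (Complex u v - Complex s w))) =
          ?c2 * ((exp (- \<i> * of_real h * Complex s w) * exp (\<i> * Complex s w * of_real b)) * g s * F u /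
            ((- \<i> * Complex s w) * (\<i> * (Complex u v - Complex s w))))"
        by (simp add: power2_eq_square mult_ac)
      also have "(- \<i> * Complex s w) * (\<i> * (Complex u v - Complex s w)) = - (?D u s)"
        by (simp add: algebra_simps)
      finally show "?c * (exp (\<i> * Complex s w * of_real b) / (2 * of_real pi)) * (F u / (\<i> * (Complex u v - Complex s w))) =
          - ?c2 * (F u * G s / (?D u s))"
        unfolding e G_def by simp
    qed
    also have "\<dots> = - ?c2 * (LINT u|lborel. F u * G s / (?D u s))"
      by (rule integral_mult_right_zero)
    finally show ?thesis .
  qed
  have iA: "integrable (\<mu> \<Otimes>\<^sub>M \<nu>) (indicat_real ?A)"
    by (rule MN.integrable_const_bound[of _ 1]) auto
  have sp: "?A \<inter> space (\<mu> \<Otimes>\<^sub>M \<nu>) = ?A" by auto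
  have "measure (\<mu> \<Otimes>\<^sub>M \<nu>) ?A = (LINT z|(\<mu> \<Otimes>\<^sub>M \<nu>). indicat_real ?A z)"
    using sp by simp
  also have "\<dots> = (LINT m|\<mu>. LINT n|\<nu>. indicat_real ?A (m, n))"
    by (rule MN.integral_fst'[OF iA, symmetric])
  finally have "complex_of_real (measure (\<mu> \<Otimes>\<^sub>M \<nu>) ?A) = (LINT m|\<mu>. complex_of_real (LINT n|\<nu>. indicat_real ?A (m, n)))"
    by (simp only: integral_complex_of_real)
  also have "\<dots> = (LINT m|\<mu>. LINT s|lborel. ?H m s)"
    by (simp only: slice)
  also have "\<dots> = (LINT s|lborel. LINT m|\<mu>. ?H m s)"
    by (rule PL.Fubini_integral[OF H_int, symmetric])
  also have "\<dots> = (LINT s|lborel. - ?c2 * (LINT u|lborel. F u * G s / (?D u s)))"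
    by (simp only: swap)
  also have "\<dots> = - ?c2 * (LINT s|lborel. LINT u|lborel. F u * G s / (?D u s))"
    by (rule integral_mult_right_zero)
  also have "(LINT s|lborel. LINT u|lborel. F u * G s / (?D u s)) =
      (LINT u|lborel. LINT s|lborel. F u * G s / (?D u s))"
    by (rule lborel_pair.Fubini_integral[OF K])
  also have "\<dots> = (LINT u|lborel. ?eb u * f u * J u)"
    by (simp only: J)
  finally show "complex_of_real (measure (\<mu> \<Otimes>\<^sub>M \<nu>) ?A) =
      - ?c2 * (LINT u|lborel. ?eb u * f u * J u)" .
qed

text \<open>
  Almost every section of an integrable function is integrable, so at least one is, and the sections of
  \<open>exp (c (m + n))\<close> are multiples of one another.
\<close>

lemma pair_exp_integrable_factors:
  fixes \<mu> \<nu> :: "real measure"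
  assumes \<mu>: "prob_space \<mu>" "sets \<mu> = sets borel" and \<nu>: "prob_space \<nu>" "sets \<nu> = sets borel"
    and int: "integrable (\<mu> \<Otimes>\<^sub>M \<nu>) (\<lambda>z. exp (c * (fst z + snd z)))"
  shows "integrable \<mu> (\<lambda>m. exp (c * m))" and "integrable \<nu> (\<lambda>n. exp (c * n))"
proof -
  interpret \<mu>: prob_space \<mu> by fact
  interpret \<nu>: prob_space \<nu> by fact
  interpret MN: pair_prob_space \<mu> \<nu> ..
  have factor: "integrable \<kappa> (\<lambda>n. exp (c * n))"
    if "AE m in \<rho>. integrable \<kappa> (\<lambda>n. exp (c * (m + n)))" "prob_space \<rho>" for \<kappa> \<rho> :: "real measure"
  proof -
    interpret \<rho>: prob_space \<rho> by fact
    have "\<exists>m. integrable \<kappa> (\<lambda>n. exp (c * (m + n)))"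
    proof (rule ccontr)
      assume "\<nexists>m. integrable \<kappa> (\<lambda>n. exp (c * (m + n)))"
      then have "AE m in \<rho>. False" using that(1) by simp
      then show False by simp
    qed
    then obtain m where "integrable \<kappa> (\<lambda>n. exp (c * (m + n)))" ..
    then have "integrable \<kappa> (\<lambda>n. exp (- (c * m)) * exp (c * (m + n)))" by (rule integrable_mult_right)
    then show ?thesis by (simp add: algebra_simps flip: exp_add)
  qed
  have "AE m in \<mu>. integrable \<nu> (\<lambda>n. exp (c * (m + n)))"
    using MN.AE_integrable_fst'[OF int] by simp
  then show "integrable \<nu> (\<lambda>n. exp (c * n))" by (rule factor[OF _ \<mu>(1)])
  have int': "integrable (\<mu> \<Otimes>\<^sub>M \<nu>) (case_prod (\<lambda>m n. exp (c * (m + n))))"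
    using int by (simp add: case_prod_unfold)
  have "AE n in \<nu>. integrable \<mu> (\<lambda>m. exp (c * (n + m)))"
    using MN.AE_integrable_snd[OF int'] by (simp add: add.commute)
  then show "integrable \<mu> (\<lambda>m. exp (c * m))" by (rule factor[OF _ \<nu>(1)])
qed

lemma line_decay:
  fixes \<phi> :: "complex \<Rightarrow> complex"
  assumes "norm (\<phi> (Complex u w)) \<le> C * (1 + norm (Complex u w)) powr (- \<nu>)" "C > 0" "\<nu> > 0" "\<nu>' \<le> \<nu>" "0 < \<nu>'"
  shows "norm (\<phi> (Complex u w)) \<le> C * (1 + \<bar>u\<bar>) powr (- \<nu>')"
proof -
  have "\<bar>u\<bar> \<le> norm (Complex u w)" using abs_Re_le_cmod[of "Complex u w"] by simp
  then have "(1 + norm (Complex u w)) powr (- \<nu>) \<le> (1 + \<bar>u\<bar>) powr (- \<nu>)"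
    using assms by (intro powr_mono2') auto
  also have "\<dots> \<le> (1 + \<bar>u\<bar>) powr (- \<nu>')"
    using assms by (intro powr_mono) auto
  finally show ?thesis using assms by (smt (verit) mult_left_mono)
qed

section \<open>Wiener-Hopf factorization of random walks at a geometric time\<close>

abbreviation steps :: "real measure \<Rightarrow> nat \<Rightarrow> (nat \<Rightarrow> real) measure" where
  "steps \<nu> n \<equiv> PiM {..<n} (\<lambda>_. \<nu>)"

definition walk :: "(nat \<Rightarrow> real) \<Rightarrow> nat \<Rightarrow> real" where
  "walk x j = (\<Sum>i<j. x i)"

definition walk_max :: "nat \<Rightarrow> (nat \<Rightarrow> real) \<Rightarrow> real" where
  "walk_max k x = Max (walk x ` {..k})"

definition walk_min :: "nat \<Rightarrow> (nat \<Rightarrow> real) \<Rightarrow> real" where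
  "walk_min k x = Min (walk x ` {..k})"

definition geometric_expectation :: "real \<Rightarrow> (nat \<Rightarrow> real) \<Rightarrow> real" where
  "geometric_expectation r c = (\<Sum>k. (1 - r) * r ^ k * c k)"

locale random_walk = prob_space \<nu> for \<nu> :: "real measure" +
  assumes sets_step [measurable_cong, simp]: "sets \<nu> = sets borel"
begin

lemma space_step: "space \<nu> = UNIV"
  using sets_eq_imp_space_eq[OF sets_step] by simp

lemma step_measurable [measurable]: "(\<lambda>x. x i) \<in> borel_measurable (steps \<nu> n)"
proof (cases "i < n")
  case True
  then show ?thesis
    using measurable_component_singleton[of i "{..<n}" "\<lambda>_. \<nu>"]
    by (simp add: measurable_cong_sets[OF refl sets_step])
next
  case False
  have "(\<lambda>x. x i) \<in> borel_measurable (steps \<nu> n) \<longleftrightarrow> (\<lambda>x. undefined :: real) \<in> borel_measurable (steps \<nu> n)"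
    using False by (intro measurable_cong) (auto simp: space_PiM PiE_def extensional_def)
  then show ?thesis by simp
qed

lemma walk_measurable [measurable]: "(\<lambda>x. walk x j) \<in> borel_measurable (steps \<nu> n)"
  unfolding walk_def by measurable

lemma walk_max_measurable [measurable]: "walk_max n \<in> borel_measurable (steps \<nu> n)"
  unfolding walk_max_def by measurable

lemma walk_min_measurable [measurable]: "walk_min n \<in> borel_measurable (steps \<nu> n)"
  unfolding walk_min_def by measurable

interpretation P: product_sigma_finite "\<lambda>_::nat. \<nu>" ..

lemma prob_space_steps: "prob_space (steps \<nu> n)"
  by (intro prob_space_PiM prob_space_axioms)

text \<open>
  Concatenation of \<open>l\<close> and \<open>m\<close> steps; outside the index set it takes the value \<open>undefined\<close>, as the
  points of a product measure space do.
\<close>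

definition append_steps :: "nat \<Rightarrow> nat \<Rightarrow> (nat \<Rightarrow> real) \<times> (nat \<Rightarrow> real) \<Rightarrow> nat \<Rightarrow> real" where
  "append_steps l m = (\<lambda>(x, y). \<lambda>i\<in>{..<l + m}. if i < l then x i else y (i - l))"

lemma append_measurable [measurable]: "append_steps l m \<in> steps \<nu> l \<Otimes>\<^sub>M steps \<nu> m \<rightarrow>\<^sub>M steps \<nu> (l + m)"
  unfolding append_steps_def case_prod_beta
proof (rule measurable_restrict)
  fix i assume i: "i \<in> {..<l + m}"
  show "(\<lambda>z. if i < l then fst z i else snd z (i - l)) \<in> steps \<nu> l \<Otimes>\<^sub>M steps \<nu> m \<rightarrow>\<^sub>M \<nu>"
  proof (cases "i < l")
    case True
    have "(\<lambda>z. fst z i) \<in> steps \<nu> l \<Otimes>\<^sub>M steps \<nu> m \<rightarrow>\<^sub>M \<nu>"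
      by (rule measurable_compose[OF measurable_fst measurable_component_singleton]) (use True in auto)
    with True show ?thesis by simp
  next
    case False
    have "(\<lambda>z. snd z (i - l)) \<in> steps \<nu> l \<Otimes>\<^sub>M steps \<nu> m \<rightarrow>\<^sub>M \<nu>"
      by (rule measurable_compose[OF measurable_snd measurable_component_singleton]) (use False i in auto)
    with False show ?thesis by simp
  qed
qed

lemma distr_append: "distr (steps \<nu> l \<Otimes>\<^sub>M steps \<nu> m) (steps \<nu> (l + m)) (append_steps l m) = steps \<nu> (l + m)"
proof (rule P.PiM_eqI)
  let ?P = "steps \<nu> l \<Otimes>\<^sub>M steps \<nu> m"
  let ?A = "\<lambda>A. Pi\<^sub>E {..<l} A"
  let ?B = "\<lambda>A. Pi\<^sub>E {..<m} (\<lambda>i. A (l + i))"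
  let ?C = "\<lambda>A. Pi\<^sub>E {..<l + m} A"
  interpret L: prob_space "steps \<nu> l" by (rule prob_space_steps)
  interpret R: prob_space "steps \<nu> m" by (rule prob_space_steps)
  fix A :: "nat \<Rightarrow> real set" assume A: "\<And>i. i \<in> {..<l + m} \<Longrightarrow> A i \<in> sets \<nu>"
  have box: "?C A \<in> sets (steps \<nu> (l + m))"
    using A by (intro sets_PiM_I_finite) auto
  have "append_steps l m -` ?C A \<inter> space ?P =
      ?A A \<times> ?B A" (is "?L = ?R")
  proof (intro equalityI subrelI)
    fix x y assume "(x, y) \<in> ?L"
    then have j: "append_steps l m (x, y) \<in> ?C A" and "(x, y) \<in> space ?P" by auto
    then have ext: "x \<in> extensional {..<l}" "y \<in> extensional {..<m}"
      by (auto simp: space_pair_measure space_PiM PiE_def)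
    have a: "append_steps l m (x, y) i \<in> A i" if "i < l + m" for i
      using j that by (auto simp: PiE_iff)
    have "x \<in> ?A A"
    proof -
      have "x i \<in> A i" if "i < l" for i
        using a[of i] that by (simp add: append_steps_def)
      with ext show ?thesis by (auto simp: PiE_iff)
    qed
    moreover have "y \<in> ?B A"
    proof -
      have "y i \<in> A (l + i)" if "i < m" for i
        using a[of "l + i"] that by (simp add: append_steps_def)
      with ext show ?thesis by (auto simp: PiE_iff)
    qed
    ultimately show "(x, y) \<in> ?R" by simp
  next
    fix x y assume "(x, y) \<in> ?R"
    then have xy: "x \<in> ?A A" "y \<in> ?B A" by auto
    have "append_steps l m (x, y) \<in> ?C A"
    proof (rule PiE_I)
      fix i assume "i \<in> {..<l + m}"
      then show "append_steps l m (x, y) i \<in> A i"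
        using PiE_mem[OF xy(1), of i] PiE_mem[OF xy(2), of "i - l"] by (auto simp: append_steps_def)
    qed (auto simp: append_steps_def)
    moreover have "(x, y) \<in> space ?P"
      using xy by (simp add: space_pair_measure space_PiM PiE_iff space_step)
    ultimately show "(x, y) \<in> ?L" by simp
  qed
  then have "emeasure (distr ?P (steps \<nu> (l + m)) (append_steps l m)) (?C A) =
      emeasure ?P (?A A \<times> ?B A)"
    using box by (simp add: emeasure_distr)
  also have "\<dots> = emeasure (steps \<nu> l) (?A A) * emeasure (steps \<nu> m) (?B A)"
    using A by (intro R.emeasure_pair_measure_Times sets_PiM_I_finite) auto
  also have "\<dots> = (\<Prod>i<l. emeasure \<nu> (A i)) * (\<Prod>i<m. emeasure \<nu> (A (l + i)))"
    using A by (subst (1 2) P.emeasure_PiM) auto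
  also have "\<dots> = (\<Prod>i<l + m. emeasure \<nu> (A i))"
    by (induction m) (simp_all add: mult_ac)
  finally show "emeasure (distr ?P (steps \<nu> (l + m)) (append_steps l m)) (?C A) =
      (\<Prod>i<l + m. emeasure \<nu> (A i))" .
qed auto

lemma walk_append_le: "j \<le> l \<Longrightarrow> walk (append_steps l m (x, y)) j = walk x j"
  unfolding walk_def by (intro sum.cong) (auto simp: append_steps_def)

lemma walk_append_ge: "j \<le> m \<Longrightarrow> walk (append_steps l m (x, y)) (l + j) = walk x l + walk y j"
proof (induction j)
  case 0 then show ?case using walk_append_le[of l l m x y] by (simp add: walk_def)
next
  case (Suc j)
  then have "append_steps l m (x, y) (l + j) = y j" by (simp add: append_steps_def)
  with Suc show ?case by (simp add: walk_def)
qed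

definition first_max_at :: "nat \<Rightarrow> nat \<Rightarrow> (nat \<Rightarrow> real) \<Rightarrow> bool" where
  "first_max_at k l x \<longleftrightarrow> (\<forall>j<l. walk x j < walk x l) \<and> (\<forall>j. l \<le> j \<and> j \<le> k \<longrightarrow> walk x j \<le> walk x l)"

lemma first_max_unique: "\<exists>!l. l \<le> k \<and> first_max_at k l x"
proof -
  let ?l = "LEAST l. l \<le> k \<and> walk x l = walk_max k x"
  have "walk_max k x \<in> walk x ` {..k}"
    unfolding walk_max_def by (intro Max_in) auto
  then have ex: "\<exists>l. l \<le> k \<and> walk x l = walk_max k x" by force
  have l: "?l \<le> k" "walk x ?l = walk_max k x"
    using LeastI_ex[OF ex] by auto
  have le: "walk x j \<le> walk_max k x" if "j \<le> k" for j
    unfolding walk_max_def using that by (intro Max_ge) auto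
  have less: "walk x j < walk_max k x" if "j < ?l" for j
    using not_less_Least[OF that] le[of j] that l(1) by force
  have "first_max_at k ?l x"
    unfolding first_max_at_def l(2) using less le by auto
  moreover have "l' = ?l" if "l' \<le> k" "first_max_at k l' x" for l'
  proof (rule ccontr)
    assume "l' \<noteq> ?l"
    then consider "l' < ?l" | "?l < l'" by linarith
    then show False
    proof cases
      case 1
      then have "walk x ?l \<le> walk x l'"
        using that(2) l(1) by (auto simp: first_max_at_def)
      then show False using less[OF 1] l(2) by simp
    next
      case 2
      then have "walk x ?l < walk x l'"
        using that(2) by (auto simp: first_max_at_def)
      then show False using le[OF that(1)] l(2) by simp
    qed
  qed
  ultimately show ?thesis using l(1) by blast
qed

lemma first_max_walk_max:
  assumes "l \<le> k" "first_max_at k l x"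
  shows "walk_max k x = walk x l"
  unfolding walk_max_def
proof (rule Max_eqI)
  fix y assume "y \<in> walk x ` {..k}"
  then obtain j where "j \<le> k" "y = walk x j" by auto
  then show "y \<le> walk x l"
    using assms(2) by (cases "j < l") (auto simp: first_max_at_def less_imp_le)
qed (use assms in auto)

text \<open>
  The index \<open>l\<close> is the first maximum exactly if the first \<open>l\<close> steps end in a strict record and the
  later steps never rise above their starting point.  These are conditions on disjoint blocks of steps.
\<close>

lemma first_max_append:
  "first_max_at (l + m) l (append_steps l m (x, y)) \<longleftrightarrow> (\<forall>j<l. walk x j < walk x l) \<and> (\<forall>j\<le>m. walk y j \<le> 0)"
proof -
  have "(\<forall>j. l \<le> j \<and> j \<le> l + m \<longrightarrow> walk (append_steps l m (x, y)) j \<le> walk x l) \<longleftrightarrow> (\<forall>j\<le>m. walk (append_steps l m (x, y)) (l + j) \<le> walk x l)"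
    by (auto simp: le_iff_add)
  also have "\<dots> \<longleftrightarrow> (\<forall>j\<le>m. walk y j \<le> 0)"
    by (auto simp: walk_append_ge)
  finally show ?thesis
    by (auto simp: first_max_at_def walk_append_le)
qed

definition ladder_up :: "(real \<Rightarrow> real) \<Rightarrow> nat \<Rightarrow> real" where
  "ladder_up f l = (LINT x|steps \<nu> l. f (walk x l) * of_bool (\<forall>j<l. walk x j < walk x l))"

definition stay_below :: "(real \<Rightarrow> real) \<Rightarrow> nat \<Rightarrow> real" where
  "stay_below g m = (LINT y|steps \<nu> m. g (walk y m) * of_bool (\<forall>j\<le>m. walk y j \<le> 0))"

definition max_split :: "(real \<Rightarrow> real) \<Rightarrow> (real \<Rightarrow> real) \<Rightarrow> nat \<Rightarrow> real" where
  "max_split f g k = (LINT x|steps \<nu> k. f (walk_max k x) * g (walk x k - walk_max k x))"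

lemma first_max_measurable [measurable]: "Measurable.pred (steps \<nu> k) (first_max_at k l)"
  unfolding first_max_at_def[abs_def] not_less[symmetric]
  by (rule pred_intros_logic(3); rule pred_intros_countable(1), rule pred_intros_imp',
      (rule pred_intros_logic(2))?, rule borel_measurable_pred_less, rule walk_measurable, rule walk_measurable)

context
  fixes f g :: "real \<Rightarrow> real"
  assumes f_meas[measurable]: "f \<in> borel_measurable borel" and f_bd: "\<And>x. \<bar>f x\<bar> \<le> 1"
    and g_meas[measurable]: "g \<in> borel_measurable borel" and g_bd: "\<And>x. \<bar>g x\<bar> \<le> 1"
begin

text \<open>
  Sum over the position of the first maximum.  Given that position, the value at the maximum is a
  function of the steps before it and the remaining displacement a function of the steps after it.
\<close>

lemma max_split_convolution: "max_split f g k = (\<Sum>l\<le>k. ladder_up f l * stay_below g (k - l))"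
proof -
  let ?P = "\<lambda>l m. steps \<nu> l \<Otimes>\<^sub>M steps \<nu> m"
  interpret K: prob_space "steps \<nu> k" by (rule prob_space_steps)
  let ?F = "\<lambda>l x. of_bool (first_max_at k l x) * (f (walk x l) * g (walk x k - walk x l))"
  have "max_split f g k = (LINT x|steps \<nu> k. (\<Sum>l\<le>k. ?F l x))"
    unfolding max_split_def
  proof (intro Bochner_Integration.integral_cong refl)
    fix x
    obtain l where l: "l \<le> k \<and> first_max_at k l x" and
      uniq: "\<forall>l'. l' \<le> k \<and> first_max_at k l' x \<longrightarrow> l' = l"
      using first_max_unique[of k x] by (elim ex1E)
    have "(\<Sum>l\<le>k. ?F l x) = (\<Sum>l'\<in>{l}. ?F l' x)"
    proof (rule sum.mono_neutral_right)
      show "\<forall>l'\<in>{..k} - {l}. ?F l' x = 0"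
      proof
        fix l' assume "l' \<in> {..k} - {l}"
        then have "\<not> first_max_at k l' x" using spec[OF uniq, of l'] by fastforce
        then show "?F l' x = 0" by simp
      qed
    qed (use l in auto)
    moreover have "walk_max k x = walk x l"
      using l by (intro first_max_walk_max) auto
    ultimately show "f (walk_max k x) * g (walk x k - walk_max k x) = (\<Sum>l\<le>k. ?F l x)"
      using l by simp
  qed
  also have "\<dots> = (\<Sum>l\<le>k. LINT x|steps \<nu> k. ?F l x)"
  proof (rule Bochner_Integration.integral_sum)
    fix l assume "l \<in> {..k}"
    then have [measurable]: "l \<le> k" by simp
    show "integrable (steps \<nu> k) (?F l)"
      by (rule K.integrable_const_bound[of _ 1])
         (use f_bd g_bd in \<open>auto simp: abs_mult intro!: mult_le_one\<close>)
  qed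
  also have "\<dots> = (\<Sum>l\<le>k. ladder_up f l * stay_below g (k - l))"
  proof (intro sum.cong refl)
    fix l assume l: "l \<in> {..k}"
    define m where "m = k - l"
    have k: "k = l + m" and [measurable]: "l \<le> l + m" using l by (auto simp: m_def)
    interpret L: prob_space "steps \<nu> l" by (rule prob_space_steps)
    interpret R: prob_space "steps \<nu> m" by (rule prob_space_steps)
    interpret LR: pair_prob_space "steps \<nu> l" "steps \<nu> m" ..
    let ?A = "\<lambda>x. f (walk x l) * of_bool (\<forall>j<l. walk x j < walk x l)"
    let ?B = "\<lambda>y. g (walk y m) * of_bool (\<forall>j\<le>m. walk y j \<le> 0)"
    have [measurable]: "?A \<in> borel_measurable (steps \<nu> l)" "?B \<in> borel_measurable (steps \<nu> m)"
      by (measurable; simp)+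
    have bd: "\<bar>?A x * ?B y\<bar> \<le> 1" for x y
      using f_bd g_bd by (auto simp: abs_mult intro!: mult_le_one)
    have Fm: "(\<lambda>x. of_bool (first_max_at (l + m) l x) * (f (walk x l) * g (walk x (l + m) - walk x l)))
        \<in> borel_measurable (steps \<nu> (l + m))"
      by measurable
    have "(LINT x|steps \<nu> k. ?F l x) = (LINT x|distr (?P l m) (steps \<nu> (l + m)) (append_steps l m).
        of_bool (first_max_at (l + m) l x) * (f (walk x l) * g (walk x (l + m) - walk x l)))"
      by (simp only: distr_append k)
    also have "\<dots> = (LINT z|(?P l m).
        of_bool (first_max_at (l + m) l (append_steps l m z)) * (f (walk (append_steps l m z) l) * g (walk (append_steps l m z) (l + m) - walk (append_steps l m z) l)))"
      by (rule integral_distr[OF append_measurable Fm])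
    also have "\<dots> = (LINT z|(?P l m). ?A (fst z) * ?B (snd z))"
    proof (rule Bochner_Integration.integral_cong[OF refl])
      fix z :: "(nat \<Rightarrow> real) \<times> (nat \<Rightarrow> real)"
      obtain x y where z: "z = (x, y)" by force
      show "of_bool (first_max_at (l + m) l (append_steps l m z)) * (f (walk (append_steps l m z) l) * g (walk (append_steps l m z) (l + m) - walk (append_steps l m z) l)) = ?A (fst z) * ?B (snd z)"
        unfolding z first_max_append by (simp add: walk_append_le walk_append_ge of_bool_conj mult_ac)
    qed
    also have "\<dots> = (LINT x|steps \<nu> l. LINT y|steps \<nu> m. ?A x * ?B y)"
    proof -
      have "integrable (?P l m) (\<lambda>z. ?A (fst z) * ?B (snd z))"
      proof (rule LR.integrable_const_bound[of _ 1])
        show "AE z in (?P l m). norm (?A (fst z) * ?B (snd z)) \<le> 1"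
          unfolding real_norm_def by (rule AE_I2, rule bd)
      qed measurable
      from LR.integral_fst'[OF this] show ?thesis by simp
    qed
    also have "\<dots> = ladder_up f l * stay_below g m"
      by (simp add: ladder_up_def stay_below_def)
    finally show "(LINT x|steps \<nu> k. ?F l x) = ladder_up f l * stay_below g (k - l)"
      by (simp add: m_def)
  qed
  finally show ?thesis .
qed

lemma ladder_up_bounded: "\<bar>ladder_up f l\<bar> \<le> 1"
proof -
  interpret L: prob_space "steps \<nu> l" by (rule prob_space_steps)
  have "\<bar>ladder_up f l\<bar> \<le> (LINT x|steps \<nu> l. \<bar>f (walk x l) * of_bool (\<forall>j<l. walk x j < walk x l)\<bar>)"
    unfolding ladder_up_def by (rule integral_abs_bound)
  also have "\<dots> \<le> (LINT x|steps \<nu> l. 1)"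
    by (rule integral_mono') (use f_bd in \<open>auto\<close>)
  finally show ?thesis by (simp add: L.prob_space)
qed

lemma stay_below_bounded: "\<bar>stay_below g l\<bar> \<le> 1"
proof -
  interpret L: prob_space "steps \<nu> l" by (rule prob_space_steps)
  have "\<bar>stay_below g l\<bar> \<le> (LINT x|steps \<nu> l. \<bar>g (walk x l) * of_bool (\<forall>j\<le>l. walk x j \<le> 0)\<bar>)"
    unfolding stay_below_def by (rule integral_abs_bound)
  also have "\<dots> \<le> (LINT x|steps \<nu> l. 1)"
    by (rule integral_mono') (use g_bd in \<open>auto\<close>)
  finally show ?thesis by (simp add: L.prob_space)
qed

lemma max_split_sums:
  assumes r: "0 < r" "r < 1"
  shows "(\<lambda>k. r ^ k * max_split f g k) sums ((\<Sum>l. r ^ l * ladder_up f l) * (\<Sum>m. r ^ m * stay_below g m))"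
proof -
  have "summable (\<lambda>l. norm (r ^ l * ladder_up f l))"
    by (rule summable_comparison_test'[OF summable_geometric[of r]])
       (use r ladder_up_bounded in \<open>auto simp: abs_mult mult_left_le\<close>)
  moreover have "summable (\<lambda>l. norm (r ^ l * stay_below g l))"
    by (rule summable_comparison_test'[OF summable_geometric[of r]])
       (use r stay_below_bounded in \<open>auto simp: abs_mult mult_left_le\<close>)
  ultimately have "(\<lambda>k. \<Sum>l\<le>k. (r ^ l * ladder_up f l) * (r ^ (k - l) * stay_below g (k - l))) sums
      ((\<Sum>l. r ^ l * ladder_up f l) * (\<Sum>m. r ^ m * stay_below g m))"
    by (rule Cauchy_product_sums)
  moreover have "(\<Sum>l\<le>k. (r ^ l * ladder_up f l) * (r ^ (k - l) * stay_below g (k - l))) = r ^ k * max_split f g k" for k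
    unfolding max_split_convolution sum_distrib_left
  proof (intro sum.cong refl)
    fix l assume "l \<in> {..k}"
    then have "r ^ k = r ^ l * r ^ (k - l)" by (simp flip: power_add)
    then show "r ^ l * ladder_up f l * (r ^ (k - l) * stay_below g (k - l)) = r ^ k * (ladder_up f l * stay_below g (k - l))"
      by simp
  qed
  ultimately show ?thesis by simp
qed

end

text \<open>
  The generating function of \<open>max_split f g\<close> is a product \<open>A f * B g\<close>.  The normalization
  \<open>(1 - r) * A 1 * B 1 = 1\<close> turns this product into the product of the two marginals.
\<close>

proposition discrete_wiener_hopf:
  assumes f: "f \<in> borel_measurable borel" "\<And>x. \<bar>f x\<bar> \<le> 1"
    and g: "g \<in> borel_measurable borel" "\<And>x. \<bar>g x\<bar> \<le> 1"
    and r: "0 < r" "r < 1"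
  shows "geometric_expectation r (max_split f g) =
    geometric_expectation r (max_split f (\<lambda>_. 1)) * geometric_expectation r (max_split (\<lambda>_. 1) g)"
proof -
  let ?A = "\<lambda>f. (\<Sum>l. r ^ l * ladder_up f l)" and ?B = "\<lambda>g. (\<Sum>m. r ^ m * stay_below g m)"
  have W: "geometric_expectation r (max_split f g) = (1 - r) * (?A f * ?B g)"
    if "f \<in> borel_measurable borel" "\<And>x. \<bar>f x\<bar> \<le> 1" "g \<in> borel_measurable borel" "\<And>x. \<bar>g x\<bar> \<le> 1" for f g
  proof -
    have "(\<lambda>k. (1 - r) * (r ^ k * max_split f g k)) sums ((1 - r) * (?A f * ?B g))"
      by (intro sums_mult max_split_sums that r)
    then show ?thesis unfolding geometric_expectation_def by (simp add: sums_iff mult.assoc)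
  qed
  have one: "max_split (\<lambda>_. 1) (\<lambda>_. 1) = (\<lambda>_. 1)"
    unfolding max_split_def using prob_space.prob_space[OF prob_space_steps] by simp
  have "geometric_expectation r (max_split (\<lambda>_. 1) (\<lambda>_. 1)) = 1"
    unfolding one geometric_expectation_def using r by (simp add: suminf_mult suminf_geometric summable_geometric)
  then have "(1 - r) * (?A (\<lambda>_. 1) * ?B (\<lambda>_. 1)) = 1"
    by (subst (asm) W) auto
  then have "(1 - r) * (?A f * ?B g) = (1 - r) * (?A f * ?B g) * ((1 - r) * (?A (\<lambda>_. 1) * ?B (\<lambda>_. 1)))"
    by simp
  also have "\<dots> = ((1 - r) * (?A f * ?B (\<lambda>_. 1))) * ((1 - r) * (?A (\<lambda>_. 1) * ?B g))"
    by (simp only: mult_ac)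
  finally show ?thesis
    using f g by (subst (1 2 3) W) auto
qed

definition reversal :: "nat \<Rightarrow> (nat \<Rightarrow> real) \<Rightarrow> nat \<Rightarrow> real" where
  "reversal k x = (\<lambda>i\<in>{..<k}. x (k - Suc i))"

lemma reversal_bij: "bij_betw (\<lambda>i. k - Suc i) {..<k} {..<k}"
  by (rule bij_betwI[where g = "\<lambda>i. k - Suc i"]) auto

lemma distr_reversal: "distr (steps \<nu> k) (steps \<nu> k) (reversal k) = steps \<nu> k"
  unfolding reversal_def
  using distr_PiM_reindex[of "{..<k}" "\<lambda>_. \<nu>" "\<lambda>i. k - Suc i" "{..<k}"] reversal_bij[of k] prob_space_axioms
  by (auto simp: bij_betw_def)

lemma reversal_measurable [measurable]: "reversal k \<in> steps \<nu> k \<rightarrow>\<^sub>M steps \<nu> k"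
  unfolding reversal_def by (intro measurable_restrict measurable_component_singleton) auto

lemma walk_reversal: "j \<le> k \<Longrightarrow> walk (reversal k x) (k - j) = walk x k - walk x j"
proof -
  assume j: "j \<le> k"
  have "walk (reversal k x) (k - j) = (\<Sum>i<k - j. x (k - Suc i))"
    unfolding walk_def by (intro sum.cong) (auto simp: reversal_def)
  also have "\<dots> = (\<Sum>i\<in>{j..<k}. x i)"
    by (rule sum.reindex_bij_witness[of _ "\<lambda>i. k - Suc i" "\<lambda>i. k - Suc i"]) (use j in auto)
  also have "\<dots> = walk x k - walk x j"
    unfolding walk_def using j by (simp add: lessThan_atLeast0 sum_diff_nat_ivl)
  finally show ?thesis .
qed

text \<open>
  The steps in reverse order have the same law.  The reversed walk at time \<open>k - j\<close> is the displacement
  of the original walk from time \<open>j\<close> to time \<open>k\<close>, so its minimum is the final value minus the maximum.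
\<close>

lemma max_split_eq_min:
  assumes [measurable]: "g \<in> borel_measurable borel"
  shows "max_split (\<lambda>_. 1) g k = (LINT x|steps \<nu> k. g (walk_min k x))"
proof -
  have *: "walk x k - walk_max k x = walk_min k (reversal k x)" for x
    unfolding walk_min_def
  proof (rule Min_eqI[symmetric])
    fix y assume "y \<in> walk (reversal k x) ` {..k}"
    then obtain j where j: "j \<le> k" "y = walk (reversal k x) j" by auto
    then have "y = walk x k - walk x (k - j)"
      using walk_reversal[of "k - j" k x] by simp
    moreover have "walk x (k - j) \<le> walk_max k x"
      unfolding walk_max_def by (intro Max_ge) auto
    ultimately show "walk x k - walk_max k x \<le> y" by simp
  next
    have "walk_max k x \<in> walk x ` {..k}"
      unfolding walk_max_def by (intro Max_in) auto
    then obtain j where "j \<le> k" "walk_max k x = walk x j" by auto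
    then show "walk x k - walk_max k x \<in> walk (reversal k x) ` {..k}"
      using walk_reversal[of j k x] by (intro image_eqI[of _ _ "k - j"]) auto
  qed auto
  have "max_split (\<lambda>_. 1) g k = (LINT x|steps \<nu> k. g (walk_min k (reversal k x)))"
    by (simp add: max_split_def *)
  also have "\<dots> = (LINT x|distr (steps \<nu> k) (steps \<nu> k) (reversal k). g (walk_min k x))"
    by (rule integral_distr[symmetric]) measurable
  finally show ?thesis by (simp add: distr_reversal)
qed

end

section \<open>Characteristic exponents of Levy processes\<close>

text \<open>
  Near \<open>0\<close> the values are close to \<open>1\<close>, so the principal logarithm is additive there, and additivity
  together with the limit at \<open>0\<close> makes it linear on a small interval.  Powers extend this to all times.
\<close>

lemma multiplicative_imp_exponential:
  fixes f :: "real \<Rightarrow> complex"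
  assumes f0: "f 0 = 1" and mult: "\<And>s t. 0 \<le> s \<Longrightarrow> 0 \<le> t \<Longrightarrow> f (s + t) = f s * f t"
    and lim: "(f \<longlongrightarrow> 1) (at_right 0)"
  shows "\<exists>z. \<forall>t\<ge>0. f t = exp (- of_real t * z)"
proof -
  obtain d where d: "d > 0" and near: "\<And>t. 0 < t \<Longrightarrow> t < d \<Longrightarrow> norm (f t - 1) < 1 / 2"
    using tendstoD[OF lim, of "1/2"] by (auto simp: eventually_at_right_field dist_norm)
  define \<delta> where "\<delta> = d / 2"
  have \<delta>: "\<delta> > 0" using d by (simp add: \<delta>_def)
  have near': "norm (f t - 1) < 1 / 2" if "0 \<le> t" "t \<le> \<delta>" for t
    using near[of t] that d by (cases "t = 0") (auto simp: \<delta>_def f0)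
  define L where "L t = Ln (f t)" for t
  have nz: "f t \<noteq> 0" if "0 \<le> t" "t \<le> \<delta>" for t
    using near'[OF that] by auto
  \<comment> \<open>The logarithms are at most \<open>1\<close> in norm, so their sums stay in the strip where \<open>Ln\<close> inverts \<open>exp\<close>.\<close>
  have expL: "exp (L t) = f t" if "0 \<le> t" "t \<le> \<delta>" for t
    using nz[OF that] by (simp add: L_def)
  have Lle: "norm (L t) \<le> 2 * norm (f t - 1)" if "0 \<le> t" "t \<le> \<delta>" for t
    using norm_Ln_le[of "f t - 1"] near'[OF that] by (simp add: L_def)
  have Lle1: "norm (L t) \<le> 1" if "0 \<le> t" "t \<le> \<delta>" for t
    using Lle[OF that] near'[OF that] by simp
  have Ladd: "L (s + t) = L s + L t" if st: "0 \<le> s" "0 \<le> t" "s + t \<le> \<delta>" for s t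
  proof -
    have "\<bar>Im (L s + L t)\<bar> \<le> norm (L s) + norm (L t)"
      using abs_Im_le_cmod[of "L s + L t"] norm_triangle_ineq[of "L s" "L t"] by linarith
    also have "\<dots> \<le> 2" using Lle1[of s] Lle1[of t] st by simp
    finally have "\<bar>Im (L s + L t)\<bar> < pi" using pi_gt3 by linarith
    then have "Ln (exp (L s + L t)) = L s + L t" by (intro Ln_exp) auto
    moreover have "exp (L s + L t) = f (s + t)" using expL st mult by (simp add: exp_add)
    ultimately show ?thesis by (simp add: L_def)
  qed
  have Lmult: "L (real k * s) = of_nat k * L s" if "0 \<le> s" "real k * s \<le> \<delta>" for k s
    using that
  proof (induction k)
    case 0 then show ?case by (simp add: L_def f0)
  next
    case (Suc k)
    have "real k * s \<le> \<delta>" using Suc.prems by (simp add: algebra_simps)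
    then show ?case
      using Suc Ladd[of "real k * s" s] by (simp add: algebra_simps)
  qed
  have linear: "L t = of_real (t / \<delta>) * L \<delta>" if t: "0 \<le> t" "t \<le> \<delta>" for t
  proof -
    have "norm (L t - of_real (t / \<delta>) * L \<delta>) \<le> e" if e: "e > 0" for e
    proof -
      obtain b where b: "b > 0" and bs: "\<And>t. 0 < t \<Longrightarrow> t < b \<Longrightarrow> norm (f t - 1) < e / 4"
        using tendstoD[OF lim, of "e/4"] e by (auto simp: eventually_at_right_field dist_norm)
      obtain n :: nat where "max 1 (\<delta> / b) < real n"
        using reals_Archimedean2 by blast
      then have n: "n > 0" "\<delta> / b < real n" by auto
      define s where "s = \<delta> / real n"
      have s: "0 < s" "s < b" "real n * s = \<delta>" using n \<delta> b by (auto simp: s_def field_simps)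
      have sd: "s \<le> \<delta>" using n \<delta> by (simp add: s_def field_simps)
      have small: "norm (L r) \<le> e / 2" if "0 \<le> r" "r \<le> s" for r
      proof (cases "r = 0")
        case True then show ?thesis using e by (simp add: L_def f0)
      next
        case False
        then have "norm (f r - 1) < e / 4" using that s by (intro bs) auto
        then show ?thesis using Lle[of r] that sd by simp
      qed
      define k where "k = nat \<lfloor>t / s\<rfloor>"
      have k: "real k * s \<le> t" "t < real k * s + s"
      proof -
        have "0 \<le> t / s" using t s by simp
        then have kk: "real k = of_int \<lfloor>t / s\<rfloor>" by (simp add: k_def)
        have "real k \<le> t / s" "t / s < real k + 1" unfolding kk by linarith+
        then show "real k * s \<le> t" "t < real k * s + s" using s by (simp_all add: field_simps)
      qed
      have "L t = L (real k * s) + L (t - real k * s)"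
        using Ladd[of "real k * s" "t - real k * s"] k t s by simp
      then have "L t = of_nat k * L s + L (t - real k * s)"
        using Lmult[of s k] k t s by simp
      moreover have "L \<delta> = of_nat n * L s"
        using Lmult[of s n] s by simp
      ultimately have "L t - of_real (t / \<delta>) * L \<delta> = of_real (real k - t / s) * L s + L (t - real k * s)"
        using n \<delta> by (simp add: s_def field_simps)
      also have "norm \<dots> \<le> \<bar>real k - t / s\<bar> * norm (L s) + norm (L (t - real k * s))"
        by (rule order_trans[OF norm_triangle_ineq]) (simp add: norm_mult del: of_real_diff)
      also have "\<dots> \<le> 1 * (e / 2) + e / 2"
      proof (intro add_mono mult_mono small)
        have "real k \<le> t / s" "t / s \<le> real k + 1" using k s by (simp_all add: field_simps)
        then show "\<bar>real k - t / s\<bar> \<le> 1" by linarith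
      qed (use k s in auto)
      finally show ?thesis by simp
    qed
    then have "norm (L t - of_real (t / \<delta>) * L \<delta>) \<le> 0"
      by (rule field_le_epsilon) simp
    then show ?thesis by simp
  qed
  have pow: "f (real n * s) = f s ^ n" if "0 \<le> s" for n s
  proof (induction n)
    case (Suc n)
    have "f (real (Suc n) * s) = f (real n * s + s)" by (simp add: algebra_simps)
    also have "\<dots> = f (real n * s) * f s" using that by (intro mult) auto
    finally show ?case using Suc by simp
  qed (simp add: f0)
  have "f t = exp (- of_real t * (- L \<delta> / of_real \<delta>))" if t: "0 \<le> t" for t
  proof -
    obtain n :: nat where "max 1 (t / \<delta>) < real n"
      using reals_Archimedean2 by blast
    then have n: "n > 0" "t / \<delta> < real n" by auto
    have s: "0 \<le> t / real n" "t / real n \<le> \<delta>" using n t \<delta> by (auto simp: field_simps)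
    have "f t = f (t / real n) ^ n" using pow[OF s(1), of n] n by simp
    also have "\<dots> = exp (of_nat n * L (t / real n))" using expL[OF s] by (simp add: exp_of_nat_mult)
    also have "of_nat n * L (t / real n) = - of_real t * (- L \<delta> / of_real \<delta>)"
      using linear[OF s] n \<delta> by (simp add: field_simps)
    finally show ?thesis .
  qed
  then show ?thesis by blast
qed

text \<open>
  The period of the exponential function is harmless because all times are tested: at a time so small
  that the difference of the exponents has norm at most \<open>1\<close>, the principal logarithm recovers it.
\<close>

lemma exponential_rate_unique:
  fixes z z' :: complex
  assumes "\<And>t. t \<ge> 0 \<Longrightarrow> exp (- of_real t * z) = exp (- of_real t * z')"
  shows "z = z'"
proof -
  let ?t = "1 / (1 + norm (z' - z))"
  have pos: "1 + norm (z' - z) > 0" by (simp add: add_pos_nonneg)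
  have t: "?t > 0" using pos by simp
  let ?w = "of_real ?t * (z' - z)"
  have "exp ?w = exp (- of_real ?t * z) / exp (- of_real ?t * z')"
    by (simp add: algebra_simps diff_divide_distrib flip: exp_diff)
  also have "\<dots> = 1" using assms[of ?t] t by simp
  finally have e: "exp ?w = 1" .
  have "norm ?w = norm (z' - z) / (1 + norm (z' - z))"
    using t by (simp add: norm_mult norm_divide del: of_real_divide)
  also have "\<dots> \<le> 1" using pos by (simp add: divide_simps)
  finally have "\<bar>Im ?w\<bar> < pi" using abs_Im_le_cmod[of ?w] pi_gt3 by linarith
  then have "- pi < Im ?w" "Im ?w \<le> pi" by linarith+
  then have "Ln (exp ?w) = ?w" by (rule Ln_exp)
  then have "?w = 0" unfolding e by simp
  moreover have "complex_of_real ?t \<noteq> 0" using t unfolding of_real_eq_0_iff by linarith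
  ultimately show ?thesis by (simp del: of_real_divide)
qed

lemma char_exponent_eqI:
  assumes "\<And>t. t \<ge> 0 \<Longrightarrow> (LINT \<omega>|M. exp (\<i> * \<xi> * of_real (X t \<omega>))) = exp (- of_real t * z)"
  shows "char_exponent M X \<xi> = z"
  unfolding char_exponent_def
proof (rule the_equality)
  fix z' assume "\<forall>t\<ge>0. (LINT \<omega>|M. exp (\<i> * \<xi> * of_real (X t \<omega>))) = exp (- of_real t * z')"
  then have "exp (- of_real t * z') = exp (- of_real t * z)" if "t \<ge> 0" for t
    using assms[OF that] that by (metis (no_types))
  then show "z' = z" by (rule exponential_rate_unique)
qed (intro allI impI assms)

locale levy = prob_space M for M :: "'a measure" +
  fixes X :: "real \<Rightarrow> 'a \<Rightarrow> real"
  assumes levy_process: "levy_process M X"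
begin

lemma X_measurable: "t \<ge> 0 \<Longrightarrow> X t \<in> borel_measurable M"
  and X_0: "AE \<omega> in M. X 0 \<omega> = 0"
  and X_cadlag: "\<omega> \<in> space M \<Longrightarrow> cadlag (\<lambda>t. X t \<omega>)"
  and X_increments_indep: "0 \<le> t' 0 \<Longrightarrow> (\<And>i. i < n \<Longrightarrow> t' i \<le> t' (Suc i)) \<Longrightarrow>
    indep_vars (\<lambda>_. borel) (\<lambda>i \<omega>. X (t' (Suc i)) \<omega> - X (t' i) \<omega>) {..<n::nat}"
  and X_stationary: "s \<ge> 0 \<Longrightarrow> t \<ge> 0 \<Longrightarrow> distr M borel (\<lambda>\<omega>. X (s + t) \<omega> - X s \<omega>) = distr M borel (X t)"
proof -
  note lp = levy_process[unfolded levy_process_def]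
  show "t \<ge> 0 \<Longrightarrow> X t \<in> borel_measurable M" using lp by simp
  show "AE \<omega> in M. X 0 \<omega> = 0" using lp by simp
  show "\<omega> \<in> space M \<Longrightarrow> cadlag (\<lambda>t. X t \<omega>)" using lp by simp
  have "\<forall>(n::nat) (t::nat \<Rightarrow> real). 0 \<le> t 0 \<longrightarrow> (\<forall>i<n. t i \<le> t (Suc i)) \<longrightarrow>
        indep_vars (\<lambda>_. borel) (\<lambda>i \<omega>. X (t (Suc i)) \<omega> - X (t i) \<omega>) {..<n}"
    using lp by (elim conjE)
  from this[rule_format, of t' n] show "0 \<le> t' 0 \<Longrightarrow> (\<And>i. i < n \<Longrightarrow> t' i \<le> t' (Suc i)) \<Longrightarrow>
    indep_vars (\<lambda>_. borel) (\<lambda>i \<omega>. X (t' (Suc i)) \<omega> - X (t' i) \<omega>) {..<n}" .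
  show "s \<ge> 0 \<Longrightarrow> t \<ge> 0 \<Longrightarrow> distr M borel (\<lambda>\<omega>. X (s + t) \<omega> - X s \<omega>) = distr M borel (X t)"
    using lp by simp
qed

lemma increments_pair_distr:
  assumes s: "s \<ge> 0" and t: "t \<ge> 0"
  shows "distr M (borel \<Otimes>\<^sub>M borel) (\<lambda>\<omega>. (X s \<omega>, X (s + t) \<omega> - X s \<omega>)) = distr M borel (X s) \<Otimes>\<^sub>M distr M borel (X t)"
proof -
  have [measurable]: "X s \<in> borel_measurable M" "X (s + t) \<in> borel_measurable M" "X 0 \<in> borel_measurable M"
    using s t by (auto intro: X_measurable)
  define \<tau> where "\<tau> i = (if i = 0 then 0 else if i = Suc 0 then s else s + t)" for i :: nat
  let ?D = "\<lambda>i \<omega>. X (\<tau> (Suc i)) \<omega> - X (\<tau> i) \<omega>"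
  have "indep_vars (\<lambda>_. borel) ?D {..<2}"
    by (rule X_increments_indep) (use s t in \<open>auto simp: \<tau>_def\<close>)
  from indep_var_restrict[OF this, of "{0}" "{1}"]
  have r: "indep_var (PiM {0} (\<lambda>_. borel)) (\<lambda>\<omega>. \<lambda>i\<in>{0}. ?D i \<omega>) (PiM {1} (\<lambda>_. borel)) (\<lambda>\<omega>. \<lambda>i\<in>{1}. ?D i \<omega>)"
    by simp
  have "indep_var borel ((\<lambda>x. x 0) \<circ> (\<lambda>\<omega>. \<lambda>i\<in>{0}. ?D i \<omega>)) borel ((\<lambda>x. x 1) \<circ> (\<lambda>\<omega>. \<lambda>i\<in>{1}. ?D i \<omega>))"
    by (rule indep_var_compose[OF r]) simp_all
  then have "indep_var borel (?D 0) borel (?D 1)"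
    by (simp add: comp_def)
  then have ind: "indep_var borel (\<lambda>\<omega>. X s \<omega> - X 0 \<omega>) borel (\<lambda>\<omega>. X (s + t) \<omega> - X s \<omega>)"
    by (simp add: \<tau>_def)
  have "distr M (borel \<Otimes>\<^sub>M borel) (\<lambda>\<omega>. (X s \<omega>, X (s + t) \<omega> - X s \<omega>)) =
      distr M (borel \<Otimes>\<^sub>M borel) (\<lambda>\<omega>. (X s \<omega> - X 0 \<omega>, X (s + t) \<omega> - X s \<omega>))"
    by (rule distr_cong_AE) (use X_0 in \<open>auto elim!: eventually_mono\<close>)
  also have "\<dots> = distr M borel (\<lambda>\<omega>. X s \<omega> - X 0 \<omega>) \<Otimes>\<^sub>M distr M borel (\<lambda>\<omega>. X (s + t) \<omega> - X s \<omega>)"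
    using ind unfolding indep_var_distribution_eq by simp
  also have "distr M borel (\<lambda>\<omega>. X s \<omega> - X 0 \<omega>) = distr M borel (X s)"
    by (rule distr_cong_AE) (use X_0 in \<open>auto elim!: eventually_mono\<close>)
  also have "distr M borel (\<lambda>\<omega>. X (s + t) \<omega> - X s \<omega>) = distr M borel (X t)"
    by (rule X_stationary[OF s t])
  finally show ?thesis .
qed

lemma nn_moment_add:
  assumes s: "s \<ge> 0" and t: "t \<ge> 0"
  shows "(\<integral>\<^sup>+\<omega>. exp (- \<gamma> * X (s + t) \<omega>) \<partial>M) = (\<integral>\<^sup>+\<omega>. exp (- \<gamma> * X s \<omega>) \<partial>M) * (\<integral>\<^sup>+\<omega>. exp (- \<gamma> * X t \<omega>) \<partial>M)"
proof -
  have [measurable]: "X s \<in> borel_measurable M" "X (s + t) \<in> borel_measurable M" "X t \<in> borel_measurable M"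
    using s t by (auto intro: X_measurable)
  interpret S: prob_space "distr M borel (X s)" by (rule prob_space_distr) simp
  interpret T: prob_space "distr M borel (X t)" by (rule prob_space_distr) simp
  have "(\<integral>\<^sup>+\<omega>. exp (- \<gamma> * X (s + t) \<omega>) \<partial>M) =
      (\<integral>\<^sup>+\<omega>. (case (X s \<omega>, X (s + t) \<omega> - X s \<omega>) of (x, y) \<Rightarrow> ennreal (exp (- \<gamma> * x)) * ennreal (exp (- \<gamma> * y))) \<partial>M)"
    by (intro nn_integral_cong) (simp add: algebra_simps flip: ennreal_mult exp_add)
  also have "\<dots> = (\<integral>\<^sup>+z. (case z of (x, y) \<Rightarrow> ennreal (exp (- \<gamma> * x)) * ennreal (exp (- \<gamma> * y)))
      \<partial>(distr M (borel \<Otimes>\<^sub>M borel) (\<lambda>\<omega>. (X s \<omega>, X (s + t) \<omega> - X s \<omega>))))"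
    by (rule nn_integral_distr[symmetric]) measurable
  also have "\<dots> = (\<integral>\<^sup>+x. \<integral>\<^sup>+y. ennreal (exp (- \<gamma> * x)) * ennreal (exp (- \<gamma> * y)) \<partial>distr M borel (X t) \<partial>distr M borel (X s))"
    unfolding increments_pair_distr[OF s t] by (subst T.nn_integral_fst[symmetric]) (simp_all add: case_prod_beta)
  also have "\<dots> = (\<integral>\<^sup>+x. ennreal (exp (- \<gamma> * x)) \<partial>distr M borel (X s)) * (\<integral>\<^sup>+y. ennreal (exp (- \<gamma> * y)) \<partial>distr M borel (X t))"
    by (simp add: nn_integral_cmult nn_integral_multc)
  finally show ?thesis by (simp add: nn_integral_distr)
qed

lemma nn_moment_pos: "t \<ge> 0 \<Longrightarrow> (\<integral>\<^sup>+\<omega>. exp (- \<gamma> * X t \<omega>) \<partial>M) \<noteq> 0"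
proof
  assume t: "t \<ge> 0" and "(\<integral>\<^sup>+\<omega>. exp (- \<gamma> * X t \<omega>) \<partial>M) = 0"
  then have "AE \<omega> in M. False"
    using X_measurable[OF t] by (subst (asm) nn_integral_0_iff_AE) auto
  then show False by simp
qed

text \<open>
  For \<open>s \<le> 1\<close> the moment at time \<open>1\<close> is the product of the moments at the times \<open>s\<close> and \<open>1 - s\<close>, and
  neither of them is zero; hence both are finite.  Larger times are multiples of smaller ones.
\<close>

lemma exp_moment_integrable:
  assumes int: "integrable M (\<lambda>\<omega>. exp (- \<gamma> * X 1 \<omega>))" and t: "t \<ge> 0"
  shows "integrable M (\<lambda>\<omega>. exp (- \<gamma> * X t \<omega>))"
proof -
  let ?m = "\<lambda>t. (\<integral>\<^sup>+\<omega>. exp (- \<gamma> * X t \<omega>) \<partial>M)"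
  have m1: "?m 1 < \<infinity>"
    using int by (simp add: integrable_iff_bounded)
  have unit: "?m s < \<infinity>" if "0 \<le> s" "s \<le> 1" for s
  proof (rule ccontr)
    assume "\<not> ?m s < \<infinity>"
    then have "?m s = \<infinity>" unfolding infinity_ennreal_def top.not_eq_extremum[symmetric] by blast
    moreover have "?m 1 = ?m s * ?m (1 - s)"
      using nn_moment_add[of s "1 - s" \<gamma>] that by simp
    ultimately show False
      using m1 nn_moment_pos[of "1 - s" \<gamma>] that by (simp add: ennreal_top_mult split: if_splits)
  qed
  have "?m (real n * s) < \<infinity>" if "0 \<le> s" "s \<le> 1" for n s
  proof (induction n)
    case 0
    then show ?case using unit[of 0] by simp
  next
    case (Suc n)
    have "?m (real n * s + s) = ?m (real n * s) * ?m s"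
      using that by (intro nn_moment_add) auto
    also have "\<dots> < \<infinity>" using Suc unit[OF that] by (simp add: ennreal_mult_less_top)
    finally show ?case by (simp add: algebra_simps)
  qed
  note pow = this
  obtain n :: nat where "max 1 t < real n"
    using reals_Archimedean2 by blast
  then have n: "n > 0" "t \<le> real n" by auto
  have "?m (real n * (t / real n)) < \<infinity>"
    using t n by (intro pow) (auto simp: field_simps)
  then show ?thesis
    using n X_measurable[OF t] by (intro integrableI_bounded) auto
qed

lemma X_tendsto_0: "AE \<omega> in M. ((\<lambda>t. X t \<omega>) \<longlongrightarrow> 0) (at_right 0)"
  using X_0 AE_space
proof eventually_elim
  fix \<omega> assume "X 0 \<omega> = 0" "\<omega> \<in> space M"
  then show "((\<lambda>t. X t \<omega>) \<longlongrightarrow> 0) (at_right 0)"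
    using X_cadlag[of \<omega>] unfolding cadlag_def by (metis order_refl)
qed

lemma expectation_tendsto_at_0:
  fixes f :: "real \<Rightarrow> 'c::{banach, second_countable_topology}"
  assumes f: "continuous_on UNIV f" and bd: "\<And>x. norm (f x) \<le> B"
  shows "((\<lambda>t. LINT \<omega>|M. f (X t \<omega>)) \<longlongrightarrow> f 0) (at_right 0)"
  unfolding tendsto_at_iff_sequentially
proof (intro allI impI)
  fix S :: "nat \<Rightarrow> real" assume S: "\<forall>i. S i \<in> {0<..} - {0}" "S \<longlonglongrightarrow> 0"
  have S_pos: "0 < S i" for i using S(1) by auto
  have S_nz: "S i \<noteq> 0" for i using S_pos[of i] by simp
  have [measurable]: "f \<in> borel_measurable borel"
    using f by (rule borel_measurable_continuous_onI)
  have [measurable]: "X (S i) \<in> borel_measurable M" for i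
    using S_pos by (intro X_measurable less_imp_le)
  have "(\<lambda>i. LINT \<omega>|M. f (X (S i) \<omega>)) \<longlonglongrightarrow> (LINT \<omega>|M. f 0)"
  proof (rule integral_dominated_convergence[where w = "\<lambda>_. B"])
    show "AE \<omega> in M. (\<lambda>i. f (X (S i) \<omega>)) \<longlonglongrightarrow> f 0"
      using X_tendsto_0
    proof eventually_elim
      fix \<omega> assume *: "((\<lambda>t. X t \<omega>) \<longlongrightarrow> 0) (at_right 0)"
      have "filterlim S (at_right 0) sequentially"
        using S(2) by (simp add: filterlim_at S_pos S_nz)
      then have "(\<lambda>i. X (S i) \<omega>) \<longlonglongrightarrow> 0" by (rule filterlim_compose[OF *])
      moreover have "isCont f 0" using f by (simp add: continuous_on_eq_continuous_at)
      ultimately show "(\<lambda>i. f (X (S i) \<omega>)) \<longlonglongrightarrow> f 0" by (rule isCont_tendsto_compose[rotated])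
    qed
  qed (use bd in auto)
  then show "((\<lambda>t. LINT \<omega>|M. f (X t \<omega>)) \<circ> S) \<longlonglongrightarrow> f 0"
    by (simp add: comp_def prob_space)
qed

context
  fixes \<gamma> :: real
  assumes moment: "integrable M (\<lambda>\<omega>. exp (- \<gamma> * X 1 \<omega>))"
begin

abbreviation mgf :: "real \<Rightarrow> real" where
  "mgf t \<equiv> (LINT \<omega>|M. exp (- \<gamma> * X t \<omega>))"

lemma nn_mgf: "t \<ge> 0 \<Longrightarrow> (\<integral>\<^sup>+\<omega>. exp (- \<gamma> * X t \<omega>) \<partial>M) = ennreal (mgf t)"
  by (rule nn_integral_eq_integral[OF exp_moment_integrable[OF moment]], assumption, simp)

lemma mgf_pos: "t \<ge> 0 \<Longrightarrow> mgf t > 0"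
proof -
  assume t: "t \<ge> 0"
  have "ennreal (mgf t) \<noteq> 0" using nn_moment_pos[OF t, of \<gamma>] unfolding nn_mgf[OF t] .
  then show ?thesis unfolding ennreal_eq_0_iff by linarith
qed

lemma mgf_add: "s \<ge> 0 \<Longrightarrow> t \<ge> 0 \<Longrightarrow> mgf (s + t) = mgf s * mgf t"
proof -
  assume st: "s \<ge> 0" "t \<ge> 0"
  then have pos: "mgf s > 0" "mgf t > 0" "mgf (s + t) > 0"
    using st by (simp_all only: mgf_pos add_nonneg_nonneg)
  have "ennreal (mgf (s + t)) = ennreal (mgf s) * ennreal (mgf t)"
    using nn_moment_add[OF st, of \<gamma>] unfolding nn_mgf[OF st(1)] nn_mgf[OF st(2)] nn_mgf[OF add_nonneg_nonneg[OF st]] .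
  also have "\<dots> = ennreal (mgf s * mgf t)"
    using pos by (intro ennreal_mult[symmetric]) (auto intro: less_imp_le)
  finally show ?thesis
    using pos by (subst (asm) ennreal_inj) (auto intro: less_imp_le)
qed

text \<open>
  The variables \<open>exp (- \<gamma> X t)\<close> come without an integrable bound that is uniform in \<open>t\<close>, so the limit
  is not immediate.  Truncation at \<open>1\<close> gives the lower bound \<open>1/2\<close> for small \<open>t\<close>.  Since
  \<open>mgf t * mgf (t0 - t) = mgf t0\<close>, this is also an upper bound, so the additive function \<open>ln (mgf t)\<close> is
  bounded on \<open>[0, t0]\<close>; then its absolute value is at most \<open>C / n\<close> on \<open>[0, t0 / n]\<close>.
\<close>

lemma mgf_tendsto_1: "(mgf \<longlongrightarrow> 1) (at_right 0)"
proof -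
  have "((\<lambda>t. LINT \<omega>|M. min 1 (exp (- \<gamma> * X t \<omega>))) \<longlongrightarrow> min 1 (exp (- \<gamma> * 0))) (at_right 0)"
    by (rule expectation_tendsto_at_0[where B = 1]) (auto intro!: continuous_intros)
  then have "((\<lambda>t. LINT \<omega>|M. min 1 (exp (- \<gamma> * X t \<omega>))) \<longlongrightarrow> 1) (at_right 0)" by simp
  from order_tendstoD(1)[OF this, of "1/2"] obtain d where d: "d > 0"
    and dd: "\<And>t. 0 < t \<Longrightarrow> t < d \<Longrightarrow> 1/2 < (LINT \<omega>|M. min 1 (exp (- \<gamma> * X t \<omega>)))"
    by (auto simp: eventually_at_right_field)
  have low: "1/2 \<le> mgf t" if "0 \<le> t" "t < d" for t
  proof (cases "t = 0")
    case True
    have "mgf 0 = mgf 0 * mgf 0" using mgf_add[of 0 0] by simp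
    then have "mgf 0 = 1" using mgf_pos[of 0] by simp
    with True show ?thesis by simp
  next
    case False
    then have "1/2 < (LINT \<omega>|M. min 1 (exp (- \<gamma> * X t \<omega>)))" using that by (intro dd) auto
    also have "\<dots> \<le> mgf t"
      using exp_moment_integrable[OF moment, of t] that by (intro integral_mono') auto
    finally show ?thesis by simp
  qed
  \<comment> \<open>On \<open>[0, t0]\<close> the lower bound holds at both \<open>t\<close> and \<open>t0 - t\<close>.\<close>
  define t0 where "t0 = d / 2"
  have t0: "0 < t0" "t0 < d" using d by (auto simp: t0_def)
  define C where "C = \<bar>ln (mgf t0)\<bar> + ln 2"
  have bdd: "\<bar>ln (mgf t)\<bar> \<le> C" if "0 \<le> t" "t \<le> t0" for t
  proof -
    have "mgf t0 = mgf t * mgf (t0 - t)" using mgf_add[of t "t0 - t"] that by simp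
    then have "ln (mgf t0) = ln (mgf t) + ln (mgf (t0 - t))"
      using mgf_pos[of t] mgf_pos[of "t0 - t"] that by (simp add: ln_mult)
    moreover have "- ln 2 \<le> ln (mgf r)" if "0 \<le> r" "r \<le> t0" for r
    proof -
      have "ln (1/2) \<le> ln (mgf r)" using low[of r] that t0 by (subst ln_le_cancel_iff) auto
      then show ?thesis by (simp add: ln_div)
    qed
    from this[of t] this[of "t0 - t"] have "- ln 2 \<le> ln (mgf t)" "- ln 2 \<le> ln (mgf (t0 - t))" using that by auto
    moreover have "0 \<le> ln (2::real)" by simp
    ultimately show ?thesis unfolding C_def by linarith
  qed
  have lnmult: "ln (mgf (real n * t)) = real n * ln (mgf t)" if "t \<ge> 0" for n t
  proof (induction n)
    case 0
    have "mgf 0 = mgf 0 * mgf 0" using mgf_add[of 0 0] by simp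
    then have "mgf 0 = 1" using mgf_pos[of 0] by simp
    then show ?case by simp
  next
    case (Suc n)
    have "mgf (real (Suc n) * t) = mgf (real n * t + t)" by (simp add: algebra_simps)
    also have "\<dots> = mgf (real n * t) * mgf t" using that by (intro mgf_add) auto
    finally have "mgf (real (Suc n) * t) = mgf (real n * t) * mgf t" .
    then show ?case using Suc that mgf_pos[of t] mgf_pos[of "real n * t"] by (simp add: ln_mult algebra_simps)
  qed
  have "((\<lambda>t. ln (mgf t)) \<longlongrightarrow> 0) (at_right 0)"
  proof (rule tendstoI)
    fix e :: real assume e: "e > 0"
    obtain n :: nat where "max 1 (C / e) < real n" using reals_Archimedean2 by blast
    then have n: "n > 0" "C < e * real n" using e by (auto simp: field_simps)
    have "\<bar>ln (mgf t)\<bar> < e" if "0 < t" "t < t0 / real n" for t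
    proof -
      have "real n * \<bar>ln (mgf t)\<bar> = \<bar>ln (mgf (real n * t))\<bar>"
        using lnmult[of t n] that by (simp add: abs_mult)
      also have "\<dots> \<le> C" using that n by (intro bdd) (auto simp: field_simps)
      also have "\<dots> < real n * e" using n by (simp add: mult.commute)
      finally show ?thesis using n by simp
    qed
    moreover have "0 < t0 / real n" using n t0 by simp
    ultimately show "\<forall>\<^sub>F t in at_right 0. dist (ln (mgf t)) 0 < e"
      unfolding eventually_at_right_field by (auto simp: dist_norm)
  qed
  then have "((\<lambda>t. exp (ln (mgf t))) \<longlongrightarrow> exp 0) (at_right 0)"
    by (rule tendsto_exp)
  moreover have "\<forall>\<^sub>F t in at_right 0. exp (ln (mgf t)) = mgf t"
    using mgf_pos by (auto simp: eventually_at_right_field intro!: exI[of _ 1])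
  ultimately show ?thesis unfolding exp_zero by (rule Lim_transform_eventually)
qed

lemma complex_moment_integrable:
  assumes "Im \<xi> = \<gamma>" "t \<ge> 0"
  shows "integrable M (\<lambda>\<omega>. exp (\<i> * \<xi> * of_real (X t \<omega>)))"
proof (rule Bochner_Integration.integrable_bound[OF exp_moment_integrable[OF moment assms(2)]])
  have [measurable]: "X t \<in> borel_measurable M" by (rule X_measurable[OF assms(2)])
  show "(\<lambda>\<omega>. exp (\<i> * \<xi> * of_real (X t \<omega>))) \<in> borel_measurable M" by measurable
  show "AE \<omega> in M. norm (exp (\<i> * \<xi> * of_real (X t \<omega>))) \<le> norm (exp (- \<gamma> * X t \<omega>))"
    by (rule AE_I2) (simp add: assms(1))
qed

lemma complex_moment_add:
  assumes \<xi>: "Im \<xi> = \<gamma>" and s: "s \<ge> 0" and t: "t \<ge> 0"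
  shows "(LINT \<omega>|M. exp (\<i> * \<xi> * of_real (X (s + t) \<omega>))) =
    (LINT \<omega>|M. exp (\<i> * \<xi> * of_real (X s \<omega>))) * (LINT \<omega>|M. exp (\<i> * \<xi> * of_real (X t \<omega>)))"
proof -
  have [measurable]: "X s \<in> borel_measurable M" "X (s + t) \<in> borel_measurable M" "X t \<in> borel_measurable M"
    using s t by (auto intro: X_measurable)
  interpret S: prob_space "distr M borel (X s)" by (rule prob_space_distr) simp
  interpret T: prob_space "distr M borel (X t)" by (rule prob_space_distr) simp
  interpret ST: pair_sigma_finite "distr M borel (X s)" "distr M borel (X t)" ..
  let ?F = "\<lambda>z. exp (\<i> * \<xi> * of_real (fst z)) * exp (\<i> * \<xi> * of_real (snd z))"
  let ?Z = "\<lambda>\<omega>. (X s \<omega>, X (s + t) \<omega> - X s \<omega>)"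
  have eq: "?F (?Z \<omega>) = exp (\<i> * \<xi> * of_real (X (s + t) \<omega>))" for \<omega>
    by (simp add: algebra_simps flip: exp_add)
  have int: "integrable (distr M borel (X s) \<Otimes>\<^sub>M distr M borel (X t)) ?F"
    unfolding increments_pair_distr[OF s t, symmetric]
  proof (subst integrable_distr_eq)
    show "integrable M (\<lambda>\<omega>. ?F (?Z \<omega>))"
      unfolding eq using s t by (intro complex_moment_integrable \<xi>) simp
  qed measurable
  have "(LINT \<omega>|M. exp (\<i> * \<xi> * of_real (X (s + t) \<omega>))) = (LINT \<omega>|M. ?F (?Z \<omega>))"
    by (simp only: eq)
  also have "\<dots> = (LINT z|distr M (borel \<Otimes>\<^sub>M borel) ?Z. ?F z)"
    by (rule integral_distr[symmetric]) measurable
  also have "\<dots> = (LINT x|distr M borel (X s). LINT y|distr M borel (X t). ?F (x, y))"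
    unfolding increments_pair_distr[OF s t] using ST.integral_fst'[OF int] by simp
  also have "\<dots> = (LINT x|distr M borel (X s). exp (\<i> * \<xi> * of_real x)) * (LINT y|distr M borel (X t). exp (\<i> * \<xi> * of_real y))"
    by simp
  finally show ?thesis by (simp add: integral_distr)
qed

text \<open>
  This is Scheffe's argument: \<open>\<bar>y - 1\<bar> = y - 1 + 2 (1 - min 1 y)\<close> for \<open>y > 0\<close>, so that
  convergence of the expectations of \<open>exp (- \<gamma> X t)\<close> implies convergence in mean, and the oscillating
  factor is bounded.
\<close>

lemma complex_moment_tendsto_1:
  assumes \<xi>: "Im \<xi> = \<gamma>"
  shows "((\<lambda>t. LINT \<omega>|M. exp (\<i> * \<xi> * of_real (X t \<omega>))) \<longlongrightarrow> 1) (at_right 0)"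
proof -
  let ?e = "\<lambda>t \<omega>. exp (\<i> * \<xi> * of_real (X t \<omega>))"
  let ?v = "\<lambda>t \<omega>. exp (\<i> * of_real (Re \<xi>) * of_real (X t \<omega>))"
  let ?m = "\<lambda>t \<omega>. min 1 (exp (- \<gamma> * X t \<omega>))"
  have e0: "exp (\<i> * \<xi> * of_real x) = exp (\<i> * of_real (Re \<xi>) * of_real x) * of_real (exp (- \<gamma> * x))" for x
  proof -
    have "\<i> * \<xi> * of_real x = \<i> * of_real (Re \<xi>) * of_real x + of_real (- \<gamma> * x)"
      using \<xi> by (simp add: complex_eq_iff)
    then show ?thesis by (simp only: exp_add exp_of_real)
  qed
  have 1: "((\<lambda>t. LINT \<omega>|M. ?v t \<omega>) \<longlongrightarrow> exp (\<i> * of_real (Re \<xi>) * of_real 0)) (at_right 0)"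
    by (rule expectation_tendsto_at_0[where B = 1]) (auto intro!: continuous_intros)
  have 2: "((\<lambda>t. LINT \<omega>|M. ?m t \<omega>) \<longlongrightarrow> min 1 (exp (- \<gamma> * 0))) (at_right 0)"
    by (rule expectation_tendsto_at_0[where B = 1]) (auto intro!: continuous_intros)
  have "((\<lambda>t. mgf t - 1 + 2 * (1 - (LINT \<omega>|M. ?m t \<omega>))) \<longlongrightarrow> 1 - 1 + 2 * (1 - min 1 (exp (- \<gamma> * 0)))) (at_right 0)"
    by (intro tendsto_intros mgf_tendsto_1 2)
  then have b0: "((\<lambda>t. mgf t - 1 + 2 * (1 - (LINT \<omega>|M. ?m t \<omega>))) \<longlongrightarrow> 0) (at_right 0)" by simp
  have bound: "norm ((LINT \<omega>|M. ?e t \<omega>) - (LINT \<omega>|M. ?v t \<omega>))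
      \<le> mgf t - 1 + 2 * (1 - (LINT \<omega>|M. ?m t \<omega>))" if t: "t \<ge> 0" for t
  proof -
    have [measurable]: "X t \<in> borel_measurable M" using t by (rule X_measurable)
    note i1 = complex_moment_integrable[OF \<xi> t] and i2 = exp_moment_integrable[OF moment t]
    have i3: "integrable M (\<lambda>\<omega>. ?v t \<omega>)"
      by (rule integrable_const_bound[of _ 1]) auto
    have i4: "integrable M (\<lambda>\<omega>. ?m t \<omega>)"
      by (rule integrable_const_bound[of _ 1]) auto
    have "norm ((LINT \<omega>|M. ?e t \<omega>) - (LINT \<omega>|M. ?v t \<omega>))
      = norm (LINT \<omega>|M. ?e t \<omega> - ?v t \<omega>)"
      using i1 i3 by simp
    also have "\<dots> \<le> (LINT \<omega>|M. norm (?e t \<omega> - ?v t \<omega>))"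
      by (rule integral_norm_bound)
    also have "\<dots> = (LINT \<omega>|M. exp (- \<gamma> * X t \<omega>) - 1 + 2 * (1 - ?m t \<omega>))"
    proof (intro Bochner_Integration.integral_cong refl)
      fix \<omega>
      let ?u = "?v t \<omega>"
      have "?e t \<omega> - ?u = ?u * of_real (exp (- \<gamma> * X t \<omega>) - 1)"
        unfolding e0 by (simp add: algebra_simps)
      then have "norm (?e t \<omega> - ?u) = \<bar>exp (- \<gamma> * X t \<omega>) - 1\<bar>"
        by (simp only: norm_mult norm_of_real) simp
      then show "norm (?e t \<omega> - ?u) = exp (- \<gamma> * X t \<omega>) - 1 + 2 * (1 - ?m t \<omega>)"
        by (simp add: min_def abs_if)
    qed
    also have "\<dots> = mgf t - 1 + 2 * (1 - (LINT \<omega>|M. ?m t \<omega>))"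
      using i2 i4 by (simp add: prob_space)
    finally show ?thesis .
  qed
  have "((\<lambda>t. (LINT \<omega>|M. ?e t \<omega>) - (LINT \<omega>|M. ?v t \<omega>)) \<longlongrightarrow> 0) (at_right 0)"
    by (rule Lim_null_comparison[OF _ b0])
       (use bound in \<open>auto simp: eventually_at_right_field intro!: exI[of _ 1]\<close>)
  from tendsto_add[OF this 1] show ?thesis by simp
qed

proposition char_exponent_moment:
  assumes \<xi>: "Im \<xi> = \<gamma>" and t: "t \<ge> 0"
  shows "(LINT \<omega>|M. exp (\<i> * \<xi> * of_real (X t \<omega>))) = exp (- of_real t * char_exponent M X \<xi>)"
proof -
  let ?f = "\<lambda>t. LINT \<omega>|M. exp (\<i> * \<xi> * of_real (X t \<omega>))"
  have f0: "?f 0 = 1"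
  proof -
    have [measurable]: "X 0 \<in> borel_measurable M" by (rule X_measurable) simp
    have "?f 0 = (LINT \<omega>|M. 1)"
      by (rule integral_cong_AE) (use X_0 in \<open>auto elim!: eventually_mono\<close>)
    then show ?thesis by (simp add: prob_space)
  qed
  have "\<exists>z. \<forall>t\<ge>0. ?f t = exp (- of_real t * z)"
    by (rule multiplicative_imp_exponential[OF f0 complex_moment_add[OF \<xi>] complex_moment_tendsto_1[OF \<xi>]])
  then obtain z where z: "\<And>t. t \<ge> 0 \<Longrightarrow> ?f t = exp (- of_real t * z)" by blast
  then have "char_exponent M X \<xi> = z" by (rule char_exponent_eqI)
  with z t show ?thesis by simp
qed

end

end

section \<open>Cadlag paths on grids and exponential times\<close>

text \<open>
  The one-sided limits bound the function near every point of the interval; finitely many of these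
  neighbourhoods cover it.
\<close>

lemma cadlag_bounded:
  assumes f: "cadlag f"
  shows "\<exists>B. \<forall>s\<in>{0..t}. \<bar>f s\<bar> \<le> B"
proof -
  have loc: "\<exists>a b B. a < x \<and> x < b \<and> (\<forall>s\<in>{a<..<b}. 0 \<le> s \<longrightarrow> \<bar>f s\<bar> \<le> B)" if x: "x \<ge> 0" for x
  proof -
    have "(f \<longlongrightarrow> f x) (at_right x)" using f x by (simp add: cadlag_def)
    from tendstoD[OF this, of 1] obtain b where b: "b > x" "\<And>s. x < s \<Longrightarrow> s < b \<Longrightarrow> \<bar>f s - f x\<bar> < 1"
      by (auto simp: eventually_at_right_field dist_norm)
    show ?thesis
    proof (cases "x = 0")
      case True
      have "\<bar>f s\<bar> \<le> \<bar>f x\<bar> + 1" if "s \<in> {-1<..<b}" "0 \<le> s" for s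
        using b(2)[of s] that True by (cases "s = 0") auto
      then show ?thesis using b(1) True by (intro exI[of _ "-1"] exI[of _ b] exI[of _ "\<bar>f x\<bar> + 1"]) auto
    next
      case False
      then obtain l where "(f \<longlongrightarrow> l) (at_left x)" using f x by (force simp: cadlag_def)
      from tendstoD[OF this, of 1] obtain a where a: "a < x" "\<And>s. a < s \<Longrightarrow> s < x \<Longrightarrow> \<bar>f s - l\<bar> < 1"
        by (auto simp: eventually_at_left_field dist_norm)
      have "\<bar>f s\<bar> \<le> \<bar>f x\<bar> + \<bar>l\<bar> + 1" if "s \<in> {a<..<b}" for s
      proof -
        consider "s < x" | "s = x" | "x < s" by linarith
        then show ?thesis
        proof cases
          case 1 then show ?thesis using a(2)[of s] that by auto
        next
          case 3 then show ?thesis using b(2)[of s] that by auto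
        qed auto
      qed
      then show ?thesis using a(1) b(1) by (intro exI[of _ a] exI[of _ b] exI[of _ "\<bar>f x\<bar> + \<bar>l\<bar> + 1"]) auto
    qed
  qed
  then obtain a b B where abB: "\<And>x. x \<ge> 0 \<Longrightarrow> a x < x \<and> x < b x \<and> (\<forall>s\<in>{a x<..<b x}. 0 \<le> s \<longrightarrow> \<bar>f s\<bar> \<le> B x)"
    by metis
  have "compact {0..t}" by simp
  then obtain C where C: "C \<subseteq> {0..t}" "finite C" "{0..t} \<subseteq> (\<Union>x\<in>C. {a x<..<b x})"
    by (rule compactE_image[of _ "{0..t}" "\<lambda>x. {a x<..<b x}"]) (use abB in force)+
  have "\<bar>f s\<bar> \<le> (\<Sum>x\<in>C. \<bar>B x\<bar>)" if s: "s \<in> {0..t}" for s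
  proof -
    obtain x where x: "x \<in> C" "s \<in> {a x<..<b x}" using C(3) s by blast
    have "\<bar>f s\<bar> \<le> B x" using abB[of x] x s C(1) by auto
    also have "\<dots> \<le> \<bar>B x\<bar>" by simp
    also have "\<dots> \<le> (\<Sum>x\<in>C. \<bar>B x\<bar>)" using x(1) C(2) by (intro member_le_sum) auto
    finally show ?thesis .
  qed
  then show ?thesis by blast
qed

lemma cadlag_uminus: "cadlag f \<Longrightarrow> cadlag (\<lambda>t. - f t)"
  unfolding cadlag_def
proof (elim conjE, intro conjI allI impI)
  fix t :: real
  assume "\<forall>t\<ge>0. (f \<longlongrightarrow> f t) (at_right t)" "0 \<le> t"
  then show "((\<lambda>t. - f t) \<longlongrightarrow> - f t) (at_right t)" by (intro tendsto_minus) simp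
next
  fix t :: real
  assume "\<forall>t>0. \<exists>l. (f \<longlongrightarrow> l) (at_left t)" "0 < t"
  then obtain l where "(f \<longlongrightarrow> l) (at_left t)" by blast
  then have "((\<lambda>t. - f t) \<longlongrightarrow> - l) (at_left t)" by (rule tendsto_minus)
  then show "\<exists>l. ((\<lambda>t. - f t) \<longlongrightarrow> l) (at_left t)" by blast
qed

lemma cadlag_bdd_above: "cadlag f \<Longrightarrow> bdd_above (f ` {0..t})"
proof -
  assume "cadlag f"
  then obtain B where "\<forall>s\<in>{0..t}. \<bar>f s\<bar> \<le> B" using cadlag_bounded by blast
  then show ?thesis by (intro bdd_aboveI[of _ B]) (auto simp: abs_le_iff)
qed

text \<open>
  For \<open>t \<ge> 0\<close> this is the index of the first grid point strictly after \<open>t\<close>.  Approaching \<open>t\<close> strictly from above is what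
  makes right-continuity sufficient for the convergence of the discretized process.
\<close>

definition grid_index :: "nat \<Rightarrow> real \<Rightarrow> nat" where
  "grid_index n t = Suc (nat \<lfloor>t * real (Suc n)\<rfloor>)"

definition grid_point :: "nat \<Rightarrow> nat \<Rightarrow> real" where
  "grid_point n j = real j / real (Suc n)"

lemma grid_index_bounds:
  assumes "t \<ge> 0"
  shows "t < grid_point n (grid_index n t)" "grid_point n (grid_index n t) \<le> t + inverse (real (Suc n))"
proof -
  have 0: "0 \<le> t * real (Suc n)" using assms by simp
  have eq: "real (grid_index n t) = of_int \<lfloor>t * real (Suc n)\<rfloor> + 1"
    using 0 by (simp add: grid_index_def)
  have "t * real (Suc n) < real (grid_index n t)" "real (grid_index n t) \<le> t * real (Suc n) + 1"
    unfolding eq by linarith+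
  then show "t < grid_point n (grid_index n t)" "grid_point n (grid_index n t) \<le> t + inverse (real (Suc n))"
    unfolding grid_point_def by (simp_all add: pos_less_divide_eq pos_divide_le_eq distrib_right)
qed

lemma grid_index_mono: "s \<le> t \<Longrightarrow> grid_index n s \<le> grid_index n t"
proof -
  assume "s \<le> t"
  then have "nat \<lfloor>s * real (Suc n)\<rfloor> \<le> nat \<lfloor>t * real (Suc n)\<rfloor>"
    by (intro nat_mono floor_mono mult_right_mono) auto
  then show ?thesis unfolding grid_index_def by (simp only: Suc_le_mono)
qed

lemma grid_point_le:
  assumes t: "t \<ge> 0" and j: "j < grid_index n t"
  shows "grid_point n j \<le> t"
proof -
  have "0 \<le> t * real (Suc n)" using t by simp
  then have "real j \<le> t * real (Suc n)"
    using j unfolding grid_index_def by (simp add: le_nat_iff le_floor_iff less_Suc_eq_le)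
  then show ?thesis by (simp add: grid_point_def field_simps)
qed

lemma cadlag_grid_tendsto:
  assumes f: "cadlag f" and t: "t \<ge> 0"
  shows "(\<lambda>n. f (grid_point n (grid_index n t))) \<longlonglongrightarrow> f t"
proof -
  have "(f \<longlongrightarrow> f t) (at_right t)" using f t by (simp add: cadlag_def)
  moreover have "filterlim (\<lambda>n. grid_point n (grid_index n t)) (at_right t) sequentially"
  proof -
    have "(\<lambda>n. grid_point n (grid_index n t)) \<longlonglongrightarrow> t"
    proof (rule tendsto_sandwich[OF _ _ tendsto_const])
      show "(\<lambda>n. t + inverse (real (Suc n))) \<longlonglongrightarrow> t"
        using tendsto_add[OF tendsto_const LIMSEQ_inverse_real_of_nat, of t] by simp
    qed (use grid_index_bounds[OF t] in \<open>auto intro!: always_eventually less_imp_le\<close>)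
    moreover have "t < grid_point n (grid_index n t)" for n
      by (rule grid_index_bounds(1)[OF t])
    ultimately show ?thesis
      by (simp add: filterlim_at less_imp_neq[symmetric] less_imp_neq[THEN not_sym])
  qed
  ultimately show ?thesis by (rule filterlim_compose)
qed

definition grid_max :: "nat \<Rightarrow> nat \<Rightarrow> (real \<Rightarrow> real) \<Rightarrow> real" where
  "grid_max n k f = Max ((\<lambda>j. f (grid_point n j)) ` {..k})"

definition grid_min :: "nat \<Rightarrow> nat \<Rightarrow> (real \<Rightarrow> real) \<Rightarrow> real" where
  "grid_min n k f = Min ((\<lambda>j. f (grid_point n j)) ` {..k})"

text \<open>
  For every \<open>s \<le> t\<close> the grid point just after \<open>s\<close> is among those that enter the maximum, so the maximum
  is eventually above any value below \<open>f s\<close>.  Only one of the grid points used lies after \<open>t\<close>, and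
  the value there tends to \<open>f t\<close>.
\<close>

lemma cadlag_grid_max_tendsto:
  assumes f: "cadlag f" and t: "t \<ge> 0"
  shows "(\<lambda>n. grid_max n (grid_index n t) f) \<longlonglongrightarrow> (SUP s\<in>{0..t}. f s)"
proof (rule order_tendstoI)
  let ?S = "SUP s\<in>{0..t}. f s"
  have bdd: "bdd_above (f ` {0..t})" by (rule cadlag_bdd_above[OF f])
  fix a assume "a < ?S"
  then obtain s where s: "s \<in> {0..t}" "a < f s"
    using less_cSUP_iff[OF _ bdd, of a] t by auto
  have "(\<lambda>n. f (grid_point n (grid_index n s))) \<longlonglongrightarrow> f s"
    using s by (intro cadlag_grid_tendsto f) auto
  from order_tendstoD(1)[OF this s(2)]
  show "\<forall>\<^sub>F n in sequentially. a < grid_max n (grid_index n t) f"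
  proof eventually_elim
    fix n assume "a < f (grid_point n (grid_index n s))"
    also have "\<dots> \<le> grid_max n (grid_index n t) f"
      unfolding grid_max_def using grid_index_mono[of s t n] s by (intro Max_ge) auto
    finally show "a < grid_max n (grid_index n t) f" .
  qed
next
  let ?S = "SUP s\<in>{0..t}. f s"
  have bdd: "bdd_above (f ` {0..t})" by (rule cadlag_bdd_above[OF f])
  fix a assume a: "?S < a"
  have "f t \<le> ?S" using t by (intro cSUP_upper bdd) auto
  then have "f t < a" using a by simp
  from order_tendstoD(2)[OF cadlag_grid_tendsto[OF f t] this]
  show "\<forall>\<^sub>F n in sequentially. grid_max n (grid_index n t) f < a"
  proof eventually_elim
    fix n assume *: "f (grid_point n (grid_index n t)) < a"
    have "f (grid_point n j) < a" if "j \<le> grid_index n t" for j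
    proof (cases "j = grid_index n t")
      case False
      then have "grid_point n j \<le> t" using that t by (intro grid_point_le) auto
      moreover have "0 \<le> grid_point n j" by (simp add: grid_point_def)
      ultimately have "f (grid_point n j) \<le> ?S" by (intro cSUP_upper bdd) auto
      then show ?thesis using a by simp
    qed (use * in simp)
    then show "grid_max n (grid_index n t) f < a"
      unfolding grid_max_def by (subst Max_less_iff) auto
  qed
qed

lemma grid_min_eq: "grid_min n k f = - grid_max n k (\<lambda>t. - f t)"
proof -
  have "- Max ((\<lambda>j. - f (grid_point n j)) ` {..k}) = Min ((\<lambda>j. f (grid_point n j)) ` {..k})"
    by (subst minus_Max_eq_Min) (auto simp: image_image)
  then show ?thesis by (simp add: grid_min_def grid_max_def)
qed

lemma cadlag_grid_min_tendsto:
  assumes f: "cadlag f" and t: "t \<ge> 0"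
  shows "(\<lambda>n. grid_min n (grid_index n t) f) \<longlonglongrightarrow> (INF s\<in>{0..t}. f s)"
proof -
  have "(INF s\<in>{0..t}. f s) = - (SUP s\<in>{0..t}. - f s)"
    by (simp add: Inf_real_def image_image)
  then show ?thesis
    unfolding grid_min_eq using tendsto_minus[OF cadlag_grid_max_tendsto[OF cadlag_uminus[OF f] t]] by simp
qed

lemma exponential_tail:
  assumes q: "q > 0" and a: "a \<ge> 0"
  shows "measure (density lborel (exponential_density q)) {a..} = exp (- q * a)"
proof -
  interpret E: prob_space "density lborel (exponential_density q)"
    by (rule prob_space_exponential_density[OF q])
  let ?E = "density lborel (exponential_density q)"
  have D: "distributed ?E lborel (\<lambda>x. x) (exponential_density q)"
    unfolding distributed_def using q by (simp add: distr_id2 exponential_density_nonneg)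
  have "AE x in lborel. x \<noteq> a" by (rule AE_lborel_singleton)
  then have "AE x in ?E. x \<noteq> a" by (subst AE_density) auto
  then have "measure ?E {a..} = measure ?E {x \<in> space ?E. a < x}"
    by (intro E.finite_measure_eq_AE) (auto elim!: eventually_mono)
  also have "\<dots> = exp (- a * q)" by (rule E.exponential_distributedD_gt[OF D a q])
  finally show ?thesis by (simp add: mult.commute)
qed

text \<open>
  The event \<open>k \<le> \<lfloor>t * m\<rfloor>\<close> has probability \<open>exp (- q / m) ^ k\<close>, so the integer part of \<open>t * m\<close> is
  geometrically distributed, starting at \<open>0\<close>.
\<close>

lemma exponential_floor_integral:
  fixes c :: "nat \<Rightarrow> real"
  assumes q: "q > 0" and m: "m > 0" and c: "\<And>k. \<bar>c k\<bar> \<le> 1"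
  shows "(LINT t|density lborel (exponential_density q). c (nat \<lfloor>t * m\<rfloor>)) = geometric_expectation (exp (- q / m)) c"
proof -
  let ?E = "density lborel (exponential_density q)"
  interpret E: prob_space ?E by (rule prob_space_exponential_density[OF q])
  define r where "r = exp (- q / m)"
  have r: "0 < r" "r < 1" using q m by (auto simp: r_def)
  let ?A = "\<lambda>k. {t. nat \<lfloor>t * m\<rfloor> = k}"
  have meas[measurable]: "(\<lambda>t::real. nat \<lfloor>t * m\<rfloor>) \<in> borel \<rightarrow>\<^sub>M count_space UNIV" by measurable
  have A[measurable]: "?A k \<in> sets borel" for k by measurable
  have tail: "measure ?E {t. k \<le> nat \<lfloor>t * m\<rfloor>} = r ^ k" for k
  proof (cases "k = 0")
    case True
    then show ?thesis using E.prob_space by simp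
  next
    case False
    have "k \<le> nat z \<longleftrightarrow> int k \<le> z" for z using False by arith
    then have "{t. k \<le> nat \<lfloor>t * m\<rfloor>} = {real k / m..}"
      using m by (auto simp: le_floor_iff pos_divide_le_eq)
    moreover have "r ^ k = exp (- q * (real k / m))"
      by (simp add: r_def mult_ac flip: exp_of_nat_mult)
    ultimately show ?thesis using exponential_tail[OF q, of "real k / m"] m by simp
  qed
  have meas_A: "measure ?E (?A k) = (1 - r) * r ^ k" for k
  proof -
    have "?A k = {t. k \<le> nat \<lfloor>t * m\<rfloor>} - {t. Suc k \<le> nat \<lfloor>t * m\<rfloor>}" by auto
    moreover have "measure ?E ({t. k \<le> nat \<lfloor>t * m\<rfloor>} - {t. Suc k \<le> nat \<lfloor>t * m\<rfloor>}) =
        measure ?E {t. k \<le> nat \<lfloor>t * m\<rfloor>} - measure ?E {t. Suc k \<le> nat \<lfloor>t * m\<rfloor>}"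
      by (rule E.finite_measure_Diff) auto
    ultimately have "measure ?E (?A k) = r ^ k - r ^ Suc k"
      by (simp only: tail)
    then show ?thesis by (simp add: algebra_simps)
  qed
  have "(\<lambda>k. LINT t|?E. c k * indicator (?A k) t) sums (LINT t|?E. (\<Sum>k. c k * indicator (?A k) t))"
  proof (rule sums_integral)
    show "AE t in ?E. summable (\<lambda>k. norm (c k * indicator (?A k) t))"
    proof (rule AE_I2)
      fix t :: real
      show "summable (\<lambda>k. norm (c k * indicator (?A k) t))"
        by (rule summable_finite[of "{nat \<lfloor>t * m\<rfloor>}"]) auto
    qed
    show "summable (\<lambda>k. LINT t|?E. norm (c k * indicator (?A k) t))"
    proof (rule summable_comparison_test'[where N = 0])
      show "summable (\<lambda>k. (1 - r) * r ^ k)" using r by (intro summable_mult summable_geometric) auto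
      fix k
      have "(LINT t|?E. norm (c k * indicator (?A k) t)) = \<bar>c k\<bar> * measure ?E (?A k)"
        by (simp add: abs_mult)
      also have "\<dots> \<le> 1 * measure ?E (?A k)" by (intro mult_right_mono c) auto
      finally show "norm (LINT t|?E. norm (c k * indicator (?A k) t)) \<le> (1 - r) * r ^ k"
        unfolding meas_A by (simp add: abs_mult)
    qed
    show "integrable ?E (\<lambda>t. c k * indicator (?A k) t)" for k
      by (intro integrable_mult_right integrable_real_indicator) (auto simp: less_top[symmetric])
  qed
  moreover have "(\<Sum>k. c k * indicator (?A k) t) = c (nat \<lfloor>t * m\<rfloor>)" for t
    by (subst suminf_finite[of "{nat \<lfloor>t * m\<rfloor>}"]) auto
  moreover have "(LINT t|?E. c k * indicator (?A k) t) = (1 - r) * r ^ k * c k" for k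
    using meas_A[of k] by simp
  ultimately have "(\<lambda>k. (1 - r) * r ^ k * c k) sums (LINT t|?E. c (nat \<lfloor>t * m\<rfloor>))"
    by (simp only:)
  then show ?thesis
    unfolding geometric_expectation_def r_def[symmetric] by (rule sums_unique)
qed

text \<open>
  The grid index of the clock starts at \<open>1\<close>, whereas the discrete factorization needs a geometric time
  starting at \<open>0\<close>.  The difference disappears as \<open>r\<close> tends to \<open>1\<close>.
\<close>

lemma geometric_expectation_shift:
  assumes r: "0 < r" "r < 1" and c: "\<And>k. \<bar>c k\<bar> \<le> 1"
  shows "geometric_expectation r c = (1 - r) * c 0 + r * geometric_expectation r (\<lambda>k. c (Suc k))"
proof -
  have s: "summable (\<lambda>k. (1 - r) * r ^ k * c (j + k))" for j
  proof (rule summable_comparison_test'[where N = 0])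
    show "summable (\<lambda>k. (1 - r) * r ^ k)" using r by (intro summable_mult summable_geometric) auto
    show "norm ((1 - r) * r ^ k * c (j + k)) \<le> (1 - r) * r ^ k" for k
      using c[of "j + k"] r by (simp add: abs_mult mult_left_le)
  qed
  have "geometric_expectation r c = (1 - r) * r ^ 0 * c 0 + (\<Sum>k. (1 - r) * r ^ Suc k * c (Suc k))"
    unfolding geometric_expectation_def using suminf_split_head[OF s[of 0]] by simp
  also have "(\<Sum>k. (1 - r) * r ^ Suc k * c (Suc k)) = r * geometric_expectation r (\<lambda>k. c (Suc k))"
    unfolding geometric_expectation_def using suminf_mult[OF s[of 1], of r] by (simp add: mult_ac)
  finally show ?thesis by simp
qed

lemma borel_measure_eqI_greaterThan:
  fixes \<mu> \<nu> :: "real measure"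
  assumes "finite_measure \<mu>" and [simp]: "sets \<mu> = sets borel" "sets \<nu> = sets borel"
    and eq: "\<And>b. emeasure \<mu> {b<..} = emeasure \<nu> {b<..}"
  shows "\<mu> = \<nu>"
proof -
  interpret finite_measure \<mu> by fact
  show ?thesis
  proof (rule measure_eqI_generator_eq[where E = "range greaterThan" and \<Omega> = UNIV and A = "\<lambda>i. {- real i <..}"])
    show "Int_stable (range greaterThan :: real set set)"
    proof (rule Int_stableI)
      fix A B :: "real set" assume "A \<in> range greaterThan" "B \<in> range greaterThan"
      then obtain a b where "A = {a<..}" "B = {b<..}" by auto
      then have "A \<inter> B = {max a b<..}" by auto
      then show "A \<inter> B \<in> range greaterThan" by simp
    qed
    show "sets \<mu> = sigma_sets UNIV (range greaterThan)" "sets \<nu> = sigma_sets UNIV (range greaterThan)"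
      by (simp_all add: borel_Ioi)
    show "(\<Union>i. {- real i <..}) = (UNIV :: real set)"
    proof (rule UNIV_eq_I[symmetric])
      fix x :: real
      obtain n :: nat where "- x < real n" using reals_Archimedean2 by blast
      then show "x \<in> (\<Union>i. {- real i <..})" by (auto intro!: exI[of _ n])
    qed
    show "emeasure \<mu> {- real i <..} \<noteq> \<infinity>" for i by simp
  qed (use eq in \<open>auto simp del: emeasure_finite\<close>)
qed

section \<open>Wiener-Hopf factorization at an exponential time\<close>

context levy
begin

abbreviation lattice_increment :: "nat \<Rightarrow> nat \<Rightarrow> 'a \<Rightarrow> real" where
  "lattice_increment n i \<omega> \<equiv> X (grid_point n (Suc i)) \<omega> - X (grid_point n i) \<omega>"

abbreviation step_law :: "nat \<Rightarrow> real measure" where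
  "step_law n \<equiv> distr M borel (X (grid_point n 1))"

lemma grid_point_nonneg [simp]: "0 \<le> grid_point n j"
  by (simp add: grid_point_def)

lemma X_grid_measurable [measurable]: "X (grid_point n j) \<in> borel_measurable M"
  by (rule X_measurable) simp

lemma random_walk_step_law: "random_walk (step_law n)"
proof -
  interpret S: prob_space "step_law n" by (rule prob_space_distr) measurable
  show ?thesis by unfold_locales simp
qed

lemma increment_law: "distr M borel (lattice_increment n i) = step_law n"
proof -
  have "grid_point n (Suc i) = grid_point n i + grid_point n 1"
    by (simp add: grid_point_def add_divide_distrib)
  then show ?thesis using X_stationary[of "grid_point n i" "grid_point n 1"] by simp
qed

text \<open>
  Stated with \<open>steps\<close> as the target space, so that the random walk theory applies verbatim.  Zero
  steps need a separate argument, because the characterization of independence by product measures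
  requires a nonempty index set.
\<close>

lemma increments_law:
  "distr M (steps (step_law n) k) (\<lambda>\<omega>. \<lambda>i\<in>{..<k}. lattice_increment n i \<omega>) = steps (step_law n) k"
proof (cases "k = 0")
  case True
  interpret N: random_walk "step_law n" by (rule random_walk_step_law)
  interpret P: product_sigma_finite "\<lambda>_::nat. step_law n" ..
  show ?thesis
  proof (rule P.PiM_eqI)
    fix A :: "nat \<Rightarrow> real set"
    have "(\<lambda>\<omega>. \<lambda>i\<in>{..<k}. lattice_increment n i \<omega>) \<in> M \<rightarrow>\<^sub>M steps (step_law n) k"
      by (intro measurable_restrict) measurable
    moreover have "(\<lambda>\<omega>. \<lambda>i\<in>{..<k}. lattice_increment n i \<omega>) -` Pi\<^sub>E {..<k} A \<inter> space M = space M"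
      using True by (auto simp: restrict_def)
    moreover have "Pi\<^sub>E {..<k} A \<in> sets (steps (step_law n) k)"
      using True by (simp add: sets_PiM_empty)
    ultimately show "emeasure (distr M (steps (step_law n) k) (\<lambda>\<omega>. \<lambda>i\<in>{..<k}. lattice_increment n i \<omega>)) (Pi\<^sub>E {..<k} A) =
        (\<Prod>i<k. emeasure (step_law n) (A i))"
      using True by (simp add: emeasure_distr emeasure_space_1)
  qed auto
next
  case False
  have "indep_vars (\<lambda>_. borel) (lattice_increment n) {..<k}"
    by (rule X_increments_indep) (auto simp: grid_point_def divide_right_mono)
  then have "distr M (\<Pi>\<^sub>M i\<in>{..<k}. borel) (\<lambda>\<omega>. \<lambda>i\<in>{..<k}. lattice_increment n i \<omega>) =
      (\<Pi>\<^sub>M i\<in>{..<k}. distr M borel (lattice_increment n i))"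
    using False by (subst (asm) indep_vars_iff_distr_eq_PiM) auto
  then show ?thesis
    unfolding increment_law by (subst distr_cong[OF refl, of _ "\<Pi>\<^sub>M i\<in>{..<k}. borel"]) (auto intro!: sets_PiM_cong)
qed

lemma increments_measurable [measurable]:
  "(\<lambda>\<omega>. \<lambda>i\<in>{..<k}. lattice_increment n i \<omega>) \<in> M \<rightarrow>\<^sub>M steps (step_law n) k"
  by (intro measurable_restrict) measurable

lemma walk_increments:
  assumes "X 0 \<omega> = 0" "j \<le> k"
  shows "walk (\<lambda>i\<in>{..<k}. lattice_increment n i \<omega>) j = X (grid_point n j) \<omega>"
proof -
  have "walk (\<lambda>i\<in>{..<k}. lattice_increment n i \<omega>) j = (\<Sum>i<j. lattice_increment n i \<omega>)"
    unfolding walk_def using assms(2) by (intro sum.cong) auto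
  also have "\<dots> = X (grid_point n j) \<omega> - X (grid_point n 0) \<omega>"
    by (induction j) auto
  finally show ?thesis using assms(1) by (simp add: grid_point_def)
qed

lemma grid_max_measurable [measurable]: "(\<lambda>\<omega>. grid_max n k (\<lambda>t. X t \<omega>)) \<in> borel_measurable M"
  unfolding grid_max_def by measurable

lemma grid_min_measurable [measurable]: "(\<lambda>\<omega>. grid_min n k (\<lambda>t. X t \<omega>)) \<in> borel_measurable M"
  unfolding grid_min_def by measurable

lemma max_split_process:
  assumes [measurable]: "f \<in> borel_measurable borel" "g \<in> borel_measurable borel"
  shows "(LINT \<omega>|M. f (grid_max n k (\<lambda>t. X t \<omega>)) * g (X (grid_point n k) \<omega> - grid_max n k (\<lambda>t. X t \<omega>))) =
    random_walk.max_split (step_law n) f g k"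
proof -
  let ?F = "\<lambda>\<omega>. f (grid_max n k (\<lambda>t. X t \<omega>)) * g (X (grid_point n k) \<omega> - grid_max n k (\<lambda>t. X t \<omega>))"
  let ?G = "\<lambda>x. f (walk_max k x) * g (walk x k - walk_max k x)"
  interpret N: random_walk "step_law n" by (rule random_walk_step_law)
  let ?D = "\<lambda>\<omega>. \<lambda>i\<in>{..<k}. lattice_increment n i \<omega>"
  have "N.max_split f g k = (LINT x|distr M (steps (step_law n) k) ?D. f (walk_max k x) * g (walk x k - walk_max k x))"
    unfolding increments_law N.max_split_def ..
  also have "\<dots> = (LINT \<omega>|M. ?G (?D \<omega>))"
    by (rule integral_distr) measurable
  also have "\<dots> = (LINT \<omega>|M. ?F \<omega>)"
  proof (rule integral_cong_AE)
    show "AE \<omega> in M. ?G (?D \<omega>) =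
        ?F \<omega>"
      using X_0
    proof eventually_elim
      fix \<omega> assume 0: "X 0 \<omega> = 0"
      have "walk_max k (?D \<omega>) = grid_max n k (\<lambda>t. X t \<omega>)"
        unfolding walk_max_def grid_max_def
        by (intro arg_cong[where f = Max] image_cong refl walk_increments[OF 0]) simp
      then show "?G (?D \<omega>) =
        ?F \<omega>"
        by (simp only: walk_increments[OF 0 order_refl])
    qed
  qed measurable
  finally show ?thesis by simp
qed

lemma min_process:
  assumes [measurable]: "g \<in> borel_measurable borel"
  shows "(LINT \<omega>|M. g (grid_min n k (\<lambda>t. X t \<omega>))) = random_walk.max_split (step_law n) (\<lambda>_. 1) g k"
proof -
  interpret N: random_walk "step_law n" by (rule random_walk_step_law)
  let ?D = "\<lambda>\<omega>. \<lambda>i\<in>{..<k}. lattice_increment n i \<omega>"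
  have "N.max_split (\<lambda>_. 1) g k = (LINT x|distr M (steps (step_law n) k) ?D. g (walk_min k x))"
    unfolding increments_law by (rule N.max_split_eq_min) measurable
  also have "\<dots> = (LINT \<omega>|M. g (walk_min k (?D \<omega>)))"
    by (rule integral_distr) measurable
  also have "\<dots> = (LINT \<omega>|M. g (grid_min n k (\<lambda>t. X t \<omega>)))"
  proof (rule integral_cong_AE)
    show "AE \<omega> in M. g (walk_min k (?D \<omega>)) = g (grid_min n k (\<lambda>t. X t \<omega>))"
      using X_0
    proof eventually_elim
      fix \<omega> assume 0: "X 0 \<omega> = 0"
      show "g (walk_min k (?D \<omega>)) = g (grid_min n k (\<lambda>t. X t \<omega>))"
        unfolding walk_min_def grid_min_def
        by (intro arg_cong[where f = g] arg_cong[where f = Min] image_cong refl walk_increments[OF 0]) simp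
    qed
  qed measurable
  finally show ?thesis by simp
qed

context
  fixes N :: "'a measure"
  assumes N_space: "space N = space M" and N_meas: "\<And>t. t \<ge> 0 \<Longrightarrow> X t \<in> borel_measurable N"
begin

lemma grid_index_measurable [measurable]: "grid_index n \<in> borel \<rightarrow>\<^sub>M count_space UNIV"
  unfolding grid_index_def by measurable

lemma clock_measurable_aux:
  shows "(\<lambda>(t, \<omega>). X (grid_point n (grid_index n t)) \<omega>) \<in> borel_measurable (borel \<Otimes>\<^sub>M N)"
    and "(\<lambda>(t, \<omega>). grid_max n (grid_index n t) (\<lambda>t. X t \<omega>)) \<in> borel_measurable (borel \<Otimes>\<^sub>M N)"
    and "(\<lambda>(t, \<omega>). grid_min n (grid_index n t) (\<lambda>t. X t \<omega>)) \<in> borel_measurable (borel \<Otimes>\<^sub>M N)"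
proof -
  have i: "(\<lambda>z. grid_index n (fst z)) \<in> borel \<Otimes>\<^sub>M N \<rightarrow>\<^sub>M count_space UNIV" by measurable
  have Xm: "(\<lambda>z. X (grid_point n j) (snd z)) \<in> borel_measurable (borel \<Otimes>\<^sub>M N)" for j
    by (rule measurable_compose[OF measurable_snd N_meas]) simp
  show "(\<lambda>(t, \<omega>). X (grid_point n (grid_index n t)) \<omega>) \<in> borel_measurable (borel \<Otimes>\<^sub>M N)"
    unfolding case_prod_beta by (rule measurable_compose_countable[OF Xm i])
  have "(\<lambda>z. grid_max n k (\<lambda>t. X t (snd z))) \<in> borel_measurable (borel \<Otimes>\<^sub>M N)" for k
    unfolding grid_max_def by (rule borel_measurable_Max) (use Xm in auto)
  then show "(\<lambda>(t, \<omega>). grid_max n (grid_index n t) (\<lambda>t. X t \<omega>)) \<in> borel_measurable (borel \<Otimes>\<^sub>M N)"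
    unfolding case_prod_beta by (rule measurable_compose_countable[OF _ i])
  have "(\<lambda>z. grid_min n k (\<lambda>t. X t (snd z))) \<in> borel_measurable (borel \<Otimes>\<^sub>M N)" for k
    unfolding grid_min_def by (rule borel_measurable_Min) (use Xm in auto)
  then show "(\<lambda>(t, \<omega>). grid_min n (grid_index n t) (\<lambda>t. X t \<omega>)) \<in> borel_measurable (borel \<Otimes>\<^sub>M N)"
    unfolding case_prod_beta by (rule measurable_compose_countable[OF _ i])
qed

text \<open>
  The \<sigma>-algebra \<open>N\<close> is a parameter since joint measurability is needed twice: with respect to the full
  \<sigma>-algebra, and with respect to the one generated by the process, of which the clock is independent.
\<close>

lemma clock_measurable:
  shows "(\<lambda>(t, \<omega>). X (max 0 t) \<omega>) \<in> borel_measurable (borel \<Otimes>\<^sub>M N)"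
    and "(\<lambda>(t, \<omega>). running_max X (max 0 t) \<omega>) \<in> borel_measurable (borel \<Otimes>\<^sub>M N)"
    and "(\<lambda>(t, \<omega>). running_min X (max 0 t) \<omega>) \<in> borel_measurable (borel \<Otimes>\<^sub>M N)"
proof -
  let ?c = "\<lambda>(t::real, \<omega>::'a). (max 0 t, \<omega>)"
  have c: "?c \<in> borel \<Otimes>\<^sub>M N \<rightarrow>\<^sub>M borel \<Otimes>\<^sub>M N" by measurable
  have cad: "cadlag (\<lambda>t. X t (snd z))" if "z \<in> space (borel \<Otimes>\<^sub>M N)" for z :: "real \<times> 'a"
    using that X_cadlag N_space by (auto simp: space_pair_measure)
  show "(\<lambda>(t, \<omega>). X (max 0 t) \<omega>) \<in> borel_measurable (borel \<Otimes>\<^sub>M N)"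
  proof (rule borel_measurable_LIMSEQ_real[OF _ measurable_compose[OF c clock_measurable_aux(1)]])
    show "(\<lambda>i. case case z of (t, \<omega>) \<Rightarrow> (max 0 t, \<omega>) of (t, \<omega>) \<Rightarrow> X (grid_point i (grid_index i t)) \<omega>) \<longlonglongrightarrow> (case z of (t, \<omega>) \<Rightarrow> X (max 0 t) \<omega>)"
      if "z \<in> space (borel \<Otimes>\<^sub>M N)" for z
      using cadlag_grid_tendsto[OF cad[OF that], of "max 0 (fst z)"] by (simp add: case_prod_beta)
  qed
  show "(\<lambda>(t, \<omega>). running_max X (max 0 t) \<omega>) \<in> borel_measurable (borel \<Otimes>\<^sub>M N)"
  proof (rule borel_measurable_LIMSEQ_real[OF _ measurable_compose[OF c clock_measurable_aux(2)]])
    show "(\<lambda>i. case case z of (t, \<omega>) \<Rightarrow> (max 0 t, \<omega>) of (t, \<omega>) \<Rightarrow> grid_max i (grid_index i t) (\<lambda>t. X t \<omega>)) \<longlonglongrightarrow> (case z of (t, \<omega>) \<Rightarrow> running_max X (max 0 t) \<omega>)"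
      if "z \<in> space (borel \<Otimes>\<^sub>M N)" for z
      using cadlag_grid_max_tendsto[OF cad[OF that], of "max 0 (fst z)"] by (simp add: case_prod_beta running_max_def)
  qed
  show "(\<lambda>(t, \<omega>). running_min X (max 0 t) \<omega>) \<in> borel_measurable (borel \<Otimes>\<^sub>M N)"
  proof (rule borel_measurable_LIMSEQ_real[OF _ measurable_compose[OF c clock_measurable_aux(3)]])
    show "(\<lambda>i. case case z of (t, \<omega>) \<Rightarrow> (max 0 t, \<omega>) of (t, \<omega>) \<Rightarrow> grid_min i (grid_index i t) (\<lambda>t. X t \<omega>)) \<longlonglongrightarrow> (case z of (t, \<omega>) \<Rightarrow> running_min X (max 0 t) \<omega>)"
      if "z \<in> space (borel \<Otimes>\<^sub>M N)" for z
      using cadlag_grid_min_tendsto[OF cad[OF that], of "max 0 (fst z)"] by (simp add: case_prod_beta running_min_def)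
  qed
qed

end

lemma measurable_exp_clock_cong [measurable_cong]: "sets (density lborel (exponential_density q)) = sets borel"
  by simp

text \<open>
  The exponential clock is first realized as a coordinate of a product space.  Replacing \<open>t\<close> by
  \<open>max 0 t\<close> below discards the negative times, which have probability zero and at which the paths are
  arbitrary.
\<close>

abbreviation clocked :: "real \<Rightarrow> (real \<times> 'a) measure" where
  "clocked q \<equiv> density lborel (exponential_density q) \<Otimes>\<^sub>M M"

definition end_value :: "real \<times> 'a \<Rightarrow> real" where
  "end_value = (\<lambda>(t, \<omega>). X (max 0 t) \<omega>)"

definition end_max :: "real \<times> 'a \<Rightarrow> real" where
  "end_max = (\<lambda>(t, \<omega>). running_max X (max 0 t) \<omega>)"

definition end_min :: "real \<times> 'a \<Rightarrow> real" where
  "end_min = (\<lambda>(t, \<omega>). running_min X (max 0 t) \<omega>)"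

lemma sets_clocked: "sets (clocked q) = sets (borel \<Otimes>\<^sub>M M)"
  by (intro sets_pair_measure_cong) auto

lemma end_measurable [measurable]:
  "end_value \<in> borel_measurable (clocked q)"
  "end_max \<in> borel_measurable (clocked q)"
  "end_min \<in> borel_measurable (clocked q)"
  using clock_measurable[OF refl X_measurable]
  unfolding end_value_def end_max_def end_min_def
  by (simp_all add: measurable_cong_sets[OF sets_clocked refl])

lemma AE_exponential_nonneg: "AE t in density lborel (exponential_density q). 0 \<le> t"
  by (subst AE_density) (auto simp: exponential_density_def)

lemma AE_clocked_nonneg:
  assumes q: "q > 0"
  shows "AE z in clocked q. 0 \<le> fst z"
proof -
  interpret E: prob_space "density lborel (exponential_density q)" by (rule prob_space_exponential_density[OF q])
  interpret P: pair_prob_space "density lborel (exponential_density q)" M ..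
  show ?thesis
  proof (rule P.AE_pair_measure)
    show "{z \<in> space (clocked q). 0 \<le> fst z} \<in> sets (clocked q)" by measurable
    show "AE t in density lborel (exponential_density q). AE \<omega> in M. 0 \<le> fst (t, \<omega>)"
      using AE_exponential_nonneg by eventually_elim simp
  qed
qed

lemma prob_space_clocked:
  assumes q: "q > 0"
  shows "prob_space (clocked q)"
proof -
  interpret E: prob_space "density lborel (exponential_density q)" by (rule prob_space_exponential_density[OF q])
  interpret P: pair_prob_space "density lborel (exponential_density q)" M ..
  show ?thesis by (rule P.prob_space_axioms)
qed

text \<open>
  At the grid points the expectation over the clock is an expectation over a geometric time.  As the
  mesh vanishes it converges to the expectation at the exponential time, by dominated convergence.
\<close>

lemma geometric_clock_limit:
  fixes F :: "nat \<Rightarrow> nat \<Rightarrow> 'a \<Rightarrow> real" and G :: "real \<times> 'a \<Rightarrow> real"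
  assumes q: "q > 0" and F[measurable]: "\<And>n k. F n k \<in> borel_measurable M" and bd: "\<And>n k \<omega>. \<bar>F n k \<omega>\<bar> \<le> 1"
    and G[measurable]: "G \<in> borel_measurable (clocked q)"
    and lim: "\<And>t \<omega>. t \<ge> 0 \<Longrightarrow> \<omega> \<in> space M \<Longrightarrow> (\<lambda>n. F n (grid_index n t) \<omega>) \<longlonglongrightarrow> G (t, \<omega>)"
  shows "(\<lambda>n. geometric_expectation (exp (- q / real (Suc n))) (\<lambda>k. LINT \<omega>|M. F n k \<omega>)) \<longlonglongrightarrow> (LINT z|clocked q. G z)"
proof -
  let ?E = "density lborel (exponential_density q)"
  interpret E: prob_space ?E by (rule prob_space_exponential_density[OF q])
  interpret P: pair_prob_space ?E M ..
  define a where "a n k = (LINT \<omega>|M. F n k \<omega>)" for n k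
  have a: "\<bar>a n k\<bar> \<le> 1" for n k
  proof -
    have "\<bar>a n k\<bar> \<le> (LINT \<omega>|M. \<bar>F n k \<omega>\<bar>)" unfolding a_def by (rule integral_abs_bound)
    also have "\<dots> \<le> (LINT \<omega>|M. 1)" by (rule integral_mono') (use bd in auto)
    finally show ?thesis by (simp add: prob_space)
  qed
  have Fm[measurable]: "(\<lambda>z. F n (grid_index n (fst z)) (snd z)) \<in> borel_measurable (clocked q)" for n
  proof (rule measurable_compose_countable[where f = "\<lambda>k z. F n k (snd z)"])
    show "(\<lambda>z. grid_index n (fst z)) \<in> clocked q \<rightarrow>\<^sub>M count_space UNIV"
      unfolding grid_index_def by measurable
  qed measurable
  have L: "(\<lambda>n. LINT z|clocked q. F n (grid_index n (fst z)) (snd z)) \<longlonglongrightarrow> (LINT z|clocked q. G z)"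
  proof (rule integral_dominated_convergence[where w = "\<lambda>_. 1"])
    show "AE z in clocked q. (\<lambda>n. F n (grid_index n (fst z)) (snd z)) \<longlonglongrightarrow> G z"
      using AE_clocked_nonneg[OF q] AE_space
      by eventually_elim (use lim in \<open>auto simp: space_pair_measure\<close>)
  qed (simp_all add: bd)
  have eq: "(LINT z|clocked q. F n (grid_index n (fst z)) (snd z)) =
      geometric_expectation (exp (- q / real (Suc n))) (\<lambda>k. a n (Suc k))" for n
  proof -
    have "integrable (clocked q) (\<lambda>z. F n (grid_index n (fst z)) (snd z))"
      by (rule P.integrable_const_bound[of _ 1]) (simp_all add: bd)
    from P.integral_fst'[OF this]
    have "(LINT z|clocked q. F n (grid_index n (fst z)) (snd z)) = (LINT t|?E. a n (grid_index n t))"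
      unfolding a_def fst_conv snd_conv by (rule sym)
    also have "\<dots> = (LINT t|?E. (\<lambda>k. a n (Suc k)) (nat \<lfloor>t * real (Suc n)\<rfloor>))"
      by (simp only: grid_index_def)
    also have "\<dots> = geometric_expectation (exp (- q / real (Suc n))) (\<lambda>k. a n (Suc k))"
      by (rule exponential_floor_integral[OF q _ a]) simp
    finally show ?thesis .
  qed
  define r where "r n = exp (- q / real (Suc n))" for n
  have r: "0 < r n" "r n < 1" for n using q by (auto simp: r_def)
  have "r \<longlonglongrightarrow> exp 0"
  proof -
    have "(\<lambda>n. - q * inverse (real (Suc n))) \<longlonglongrightarrow> - q * 0"
      by (intro tendsto_intros LIMSEQ_inverse_real_of_nat)
    then have "(\<lambda>n. - q / real (Suc n)) \<longlonglongrightarrow> 0" by (simp add: divide_inverse)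
    then show ?thesis unfolding r_def by (rule tendsto_exp)
  qed
  then have r1: "r \<longlonglongrightarrow> 1" by simp
  have z: "(\<lambda>n. (1 - r n) * a n 0) \<longlonglongrightarrow> 0"
  proof (rule Lim_null_comparison)
    have "(\<lambda>n. 1 - r n) \<longlonglongrightarrow> 1 - 1" by (intro tendsto_intros r1)
    then show "(\<lambda>n. 1 - r n) \<longlonglongrightarrow> 0" by simp
    show "\<forall>\<^sub>F n in sequentially. norm ((1 - r n) * a n 0) \<le> 1 - r n"
    proof (intro always_eventually allI)
      fix n
      show "norm ((1 - r n) * a n 0) \<le> 1 - r n"
        using r[of n] a[of n 0] by (simp add: abs_mult mult_left_le)
    qed
  qed
  have "(\<lambda>n. (1 - r n) * a n 0 + r n * geometric_expectation (r n) (\<lambda>k. a n (Suc k))) \<longlonglongrightarrow> 0 + 1 * (LINT z|clocked q. G z)"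
    by (intro tendsto_add z tendsto_mult r1) (use L in \<open>simp only: eq r_def\<close>)
  moreover have "(1 - r n) * a n 0 + r n * geometric_expectation (r n) (\<lambda>k. a n (Suc k)) = geometric_expectation (r n) (a n)" for n
    by (rule geometric_expectation_shift[OF r a, symmetric])
  ultimately show ?thesis
    unfolding a_def[symmetric] r_def[symmetric] by (simp only: add_0_left mult_1_left)
qed

text \<open>
  Both sides of the discrete factorization, for the walk on the grid of mesh \<open>1 / (n + 1)\<close> and the
  matching geometric time, converge as \<open>n\<close> grows.  The functions are continuous because the
  discretized maximum and position converge pathwise.
\<close>

lemma wiener_hopf_test_functions:
  fixes f g :: "real \<Rightarrow> real"
  assumes q: "q > 0" and f: "continuous_on UNIV f" "\<And>x. \<bar>f x\<bar> \<le> 1" and g: "continuous_on UNIV g" "\<And>x. \<bar>g x\<bar> \<le> 1"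
  shows "(LINT z|clocked q. f (end_max z) * g (end_value z - end_max z)) =
    (LINT z|clocked q. f (end_max z)) * (LINT z|clocked q. g (end_min z))"
proof -
  define r where "r n = exp (- q / real (Suc n))" for n
  have r: "0 < r n" "r n < 1" for n using q by (auto simp: r_def)
  define W where "W f g n = geometric_expectation (r n) (random_walk.max_split (step_law n) f g)" for f g n
  have split_lim: "W f g \<longlonglongrightarrow> (LINT z|clocked q. f (end_max z) * g (end_value z - end_max z))"
    if f: "continuous_on UNIV f" "\<And>x. \<bar>f x\<bar> \<le> 1" and g: "continuous_on UNIV g" "\<And>x. \<bar>g x\<bar> \<le> 1" for f g
  proof -
    have [measurable]: "f \<in> borel_measurable borel" "g \<in> borel_measurable borel"
      using f(1) g(1) by (auto intro: borel_measurable_continuous_onI)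
    have cf: "isCont f x" "isCont g x" for x
      using f(1) g(1) by (auto simp: continuous_on_eq_continuous_at)
    let ?F = "\<lambda>n k \<omega>. f (grid_max n k (\<lambda>t. X t \<omega>)) * g (X (grid_point n k) \<omega> - grid_max n k (\<lambda>t. X t \<omega>))"
    have "(\<lambda>n. geometric_expectation (exp (- q / real (Suc n))) (\<lambda>k. LINT \<omega>|M. ?F n k \<omega>)) \<longlonglongrightarrow>
        (LINT z|clocked q. f (end_max z) * g (end_value z - end_max z))"
    proof (rule geometric_clock_limit[OF q])
      show "\<bar>?F n k \<omega>\<bar> \<le> 1" for n k \<omega>
        unfolding abs_mult by (intro mult_le_one f g) simp
      fix t \<omega> assume t: "t \<ge> (0::real)" and \<omega>: "\<omega> \<in> space M"
      have "(\<lambda>n. grid_max n (grid_index n t) (\<lambda>t. X t \<omega>)) \<longlonglongrightarrow> end_max (t, \<omega>)"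
        using cadlag_grid_max_tendsto[OF X_cadlag[OF \<omega>] t] t by (simp add: end_max_def running_max_def)
      moreover have "(\<lambda>n. X (grid_point n (grid_index n t)) \<omega>) \<longlonglongrightarrow> end_value (t, \<omega>)"
        using cadlag_grid_tendsto[OF X_cadlag[OF \<omega>] t] t by (simp add: end_value_def)
      ultimately show "(\<lambda>n. ?F n (grid_index n t) \<omega>) \<longlonglongrightarrow> f (end_max (t, \<omega>)) * g (end_value (t, \<omega>) - end_max (t, \<omega>))"
        by (intro tendsto_mult isCont_tendsto_compose[OF cf(1)] isCont_tendsto_compose[OF cf(2)] tendsto_diff)
    qed measurable
    moreover have "(LINT \<omega>|M. ?F n k \<omega>) = random_walk.max_split (step_law n) f g k" for n k
      by (rule max_split_process) measurable
    ultimately show ?thesis unfolding W_def r_def by simp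
  qed
  have min_lim: "W (\<lambda>_. 1) g \<longlonglongrightarrow> (LINT z|clocked q. g (end_min z))"
  proof -
    have [measurable]: "g \<in> borel_measurable borel"
      using g(1) by (auto intro: borel_measurable_continuous_onI)
    have cg: "isCont g x" for x
      using g(1) by (auto simp: continuous_on_eq_continuous_at)
    let ?F = "\<lambda>n k \<omega>. g (grid_min n k (\<lambda>t. X t \<omega>))"
    have "(\<lambda>n. geometric_expectation (exp (- q / real (Suc n))) (\<lambda>k. LINT \<omega>|M. ?F n k \<omega>)) \<longlonglongrightarrow>
        (LINT z|clocked q. g (end_min z))"
    proof (rule geometric_clock_limit[OF q])
      show "\<bar>?F n k \<omega>\<bar> \<le> 1" for n k \<omega> by (rule g)
      fix t \<omega> assume t: "t \<ge> (0::real)" and \<omega>: "\<omega> \<in> space M"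
      have "(\<lambda>n. grid_min n (grid_index n t) (\<lambda>t. X t \<omega>)) \<longlonglongrightarrow> end_min (t, \<omega>)"
        using cadlag_grid_min_tendsto[OF X_cadlag[OF \<omega>] t] t by (simp add: end_min_def running_min_def)
      then show "(\<lambda>n. ?F n (grid_index n t) \<omega>) \<longlonglongrightarrow> g (end_min (t, \<omega>))"
        by (rule isCont_tendsto_compose[OF cg])
    qed measurable
    moreover have "(LINT \<omega>|M. ?F n k \<omega>) = random_walk.max_split (step_law n) (\<lambda>_. 1) g k" for n k
      by (rule min_process) measurable
    ultimately show ?thesis unfolding W_def r_def by simp
  qed
  have "W f g n = W f (\<lambda>_. 1) n * W (\<lambda>_. 1) g n" for n
  proof -
    interpret N: random_walk "step_law n" by (rule random_walk_step_law)
    show ?thesis unfolding W_def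
      by (rule N.discrete_wiener_hopf) (use f g r in \<open>auto intro: borel_measurable_continuous_onI\<close>)
  qed
  then have "W f g = (\<lambda>n. W f (\<lambda>_. 1) n * W (\<lambda>_. 1) g n)" by (rule ext)
  moreover have "(\<lambda>n. W f (\<lambda>_. 1) n * W (\<lambda>_. 1) g n) \<longlonglongrightarrow>
      (LINT z|clocked q. f (end_max z) * 1) * (LINT z|clocked q. g (end_min z))"
    using split_lim[OF f, of "\<lambda>_. 1"] by (intro tendsto_mult min_lim) auto
  ultimately show ?thesis
    using split_lim[OF f g] by (simp add: LIMSEQ_unique)
qed

text \<open>
  The limit of vanishing mesh only reaches continuous test functions.  Ramps of slope \<open>n\<close> carry the
  factorization over to the indicators of open half-lines, which are their pointwise limits.
\<close>

lemma wiener_hopf_tails: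
  assumes q: "q > 0"
  shows "measure (clocked q) {z \<in> space (clocked q). b < end_max z \<and> d < end_value z - end_max z} =
    measure (clocked q) {z \<in> space (clocked q). b < end_max z} * measure (clocked q) {z \<in> space (clocked q). d < end_min z}"
proof -
  let ?S = "space (clocked q)"
  interpret P: prob_space "clocked q" by (rule prob_space_clocked[OF q])
  define ramp where "ramp a n x = min 1 (max 0 (real n * (x - a)))" for a n x
  have ramp_cont: "continuous_on UNIV (ramp a n)" for a n
    unfolding ramp_def
    by (intro continuous_on_min continuous_on_max continuous_on_const continuous_on_mult_left continuous_on_diff continuous_on_id)
  have ramp_meas[measurable]: "ramp a n \<in> borel_measurable borel" for a n
    by (rule borel_measurable_continuous_onI[OF ramp_cont])
  have ramp_bd: "\<bar>ramp a n x\<bar> \<le> 1" for a n x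
    by (simp add: ramp_def abs_if)
  have ramp_lim: "(\<lambda>n. ramp a n x) \<longlonglongrightarrow> of_bool (a < x)" for a x
  proof (cases "a < x")
    case True
    obtain m :: nat where m: "1 / (x - a) < real m" using reals_Archimedean2 by blast
    have "ramp a n x = 1" if "n \<ge> m" for n
    proof -
      have "1 < real m * (x - a)" using m True by (simp add: field_simps)
      also have "\<dots> \<le> real n * (x - a)" using that True by (intro mult_right_mono) auto
      finally show ?thesis by (simp add: ramp_def)
    qed
    then have "\<forall>\<^sub>F n in sequentially. ramp a n x = 1" by (auto simp: eventually_sequentially)
    then show ?thesis using True by (simp add: tendsto_eventually)
  next
    case False
    then have "real n * (x - a) \<le> 0" for n by (intro mult_nonneg_nonpos) auto
    then have "ramp a n x = 0" for n by (simp add: ramp_def max_absorb1)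
    then show ?thesis using False by simp
  qed
  have L: "(\<lambda>n. LINT z|clocked q. ramp b n (end_max z) * ramp d n (end_value z - end_max z)) \<longlonglongrightarrow>
      (LINT z|clocked q. of_bool (b < end_max z) * of_bool (d < end_value z - end_max z))"
  proof (rule integral_dominated_convergence[where w = "\<lambda>_. 1"])
    show "AE z in clocked q. (\<lambda>n. ramp b n (end_max z) * ramp d n (end_value z - end_max z)) \<longlonglongrightarrow>
        of_bool (b < end_max z) * of_bool (d < end_value z - end_max z)"
      by (intro AE_I2 tendsto_mult ramp_lim)
  qed (use ramp_bd in \<open>auto simp: abs_mult intro!: mult_le_one\<close>)
  have L1: "(\<lambda>n. LINT z|clocked q. ramp b n (end_max z)) \<longlonglongrightarrow> (LINT z|clocked q. of_bool (b < end_max z))"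
  proof (rule integral_dominated_convergence[where w = "\<lambda>_. 1"])
    show "AE z in clocked q. (\<lambda>n. ramp b n (end_max z)) \<longlonglongrightarrow> of_bool (b < end_max z)"
      by (intro AE_I2 ramp_lim)
  qed (simp_all add: ramp_bd)
  have L2: "(\<lambda>n. LINT z|clocked q. ramp d n (end_min z)) \<longlonglongrightarrow> (LINT z|clocked q. of_bool (d < end_min z))"
  proof (rule integral_dominated_convergence[where w = "\<lambda>_. 1"])
    show "AE z in clocked q. (\<lambda>n. ramp d n (end_min z)) \<longlonglongrightarrow> of_bool (d < end_min z)"
      by (intro AE_I2 ramp_lim)
  qed (simp_all add: ramp_bd)
  have prod: "(LINT z|clocked q. of_bool (b < end_max z) * of_bool (d < end_value z - end_max z)) =
      (LINT z|clocked q. of_bool (b < end_max z)) * (LINT z|clocked q. (of_bool (d < end_min z) :: real))"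
    using tendsto_mult[OF L1 L2] L
    unfolding wiener_hopf_test_functions[OF q ramp_cont ramp_bd ramp_cont ramp_bd]
    by (rule LIMSEQ_unique[rotated])
  have ind: "(LINT z|clocked q. of_bool (Q z)) = measure (clocked q) {z \<in> ?S. Q z}"
    if "{z \<in> ?S. Q z} \<in> sets (clocked q)" for Q
  proof -
    have "(LINT z|clocked q. of_bool (Q z)) = (LINT z|clocked q. indicat_real {z \<in> ?S. Q z} z)"
      by (intro Bochner_Integration.integral_cong refl) (auto simp: indicator_def)
    then show ?thesis using that by simp
  qed
  have S: "{z \<in> ?S. b < end_max z \<and> d < end_value z - end_max z} \<in> sets (clocked q)"
    "{z \<in> ?S. b < end_max z} \<in> sets (clocked q)"
    "{z \<in> ?S. d < end_min z} \<in> sets (clocked q)"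
    by measurable
  show ?thesis
    using prod unfolding of_bool_conj[symmetric] ind[OF S(1)] ind[OF S(2)] ind[OF S(3)] .
qed

text \<open>
  Half-lines determine finite measures on the line, so it is enough to compare both sides on products
  of half-lines and then to extend to arbitrary sets in one factor after the other.
\<close>

proposition wiener_hopf_factorization:
  assumes q: "q > 0"
  shows "distr (clocked q) (borel \<Otimes>\<^sub>M borel) (\<lambda>z. (end_max z, end_value z - end_max z)) =
    distr (clocked q) borel end_max \<Otimes>\<^sub>M distr (clocked q) borel end_min"
proof (rule pair_measure_eqI[symmetric])
  interpret P: prob_space "clocked q" by (rule prob_space_clocked[OF q])
  let ?M = "distr (clocked q) borel end_max" and ?I = "distr (clocked q) borel end_min"
  let ?J = "distr (clocked q) (borel \<Otimes>\<^sub>M borel) (\<lambda>z. (end_max z, end_value z - end_max z))"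
  interpret PM: prob_space ?M by (rule P.prob_space_distr) measurable
  interpret PI: prob_space ?I by (rule P.prob_space_distr) measurable
  interpret PJ: prob_space ?J by (rule P.prob_space_distr) measurable
  show "sigma_finite_measure ?M" "sigma_finite_measure ?I" by unfold_locales
  show "sets (?M \<Otimes>\<^sub>M ?I) = sets ?J" by (simp cong: sets_pair_measure_cong)
  have rect: "emeasure ?J (A \<times> B) = emeasure (clocked q) {z \<in> space (clocked q). end_max z \<in> A \<and> end_value z - end_max z \<in> B}"
    if [measurable]: "A \<in> sets borel" "B \<in> sets borel" for A B
    by (subst emeasure_distr) (auto intro!: arg_cong[where f = "emeasure (clocked q)"])
  have tails: "emeasure ?J ({b<..} \<times> {d<..}) = emeasure ?M {b<..} * emeasure ?I {d<..}" for b d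
  proof -
    have "emeasure ?M {b<..} = ennreal (measure (clocked q) {z \<in> space (clocked q). b < end_max z})"
      by (subst emeasure_distr) (auto simp: P.emeasure_eq_measure vimage_def Int_def conj_commute)
    moreover have "emeasure ?I {d<..} = ennreal (measure (clocked q) {z \<in> space (clocked q). d < end_min z})"
      by (subst emeasure_distr) (auto simp: P.emeasure_eq_measure vimage_def Int_def conj_commute)
    ultimately show ?thesis
      by (simp add: rect P.emeasure_eq_measure wiener_hopf_tails[OF q] ennreal_mult)
  qed
  \<comment> \<open>First extend the factor of the maximum from half-lines to Borel sets.\<close>
  have strip: "emeasure ?J (A \<times> {d<..}) = emeasure ?M A * emeasure ?I {d<..}" if A: "A \<in> sets borel" for A d
  proof -
    let ?\<mu> = "distr (density ?J (indicator (UNIV \<times> {d<..}))) borel fst"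
    let ?\<nu> = "scale_measure (emeasure ?I {d<..}) ?M"
    have \<mu>: "emeasure ?\<mu> A = emeasure ?J (A \<times> {d<..})" if [measurable]: "A \<in> sets borel" for A
    proof -
      have "emeasure ?\<mu> A = emeasure (density ?J (indicator (UNIV \<times> {d<..}))) (A \<times> UNIV)"
        by (subst emeasure_distr) (auto intro!: arg_cong2[where f = emeasure] simp: space_pair_measure)
      also have "\<dots> = emeasure ?J ((UNIV \<times> {d<..}) \<inter> (A \<times> UNIV))"
        by (rule emeasure_restricted) (auto)
      also have "(UNIV \<times> {d<..}) \<inter> (A \<times> UNIV) = A \<times> {d<..}" by auto
      finally show ?thesis .
    qed
    have \<nu>: "emeasure ?\<nu> A = emeasure ?M A * emeasure ?I {d<..}" for A
      by (simp add: mult.commute)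
    have "?\<mu> = ?\<nu>"
    proof (rule borel_measure_eqI_greaterThan)
      show "finite_measure ?\<mu>"
      proof
        show "emeasure ?\<mu> (space ?\<mu>) \<noteq> \<infinity>" using \<mu>[of UNIV] by simp
      qed
      show "emeasure ?\<mu> {b<..} = emeasure ?\<nu> {b<..}" for b
        by (subst \<mu>, simp, subst \<nu>, rule tails)
    qed auto
    then show ?thesis using \<mu>[OF A] \<nu>[of A] by simp
  qed
  fix A B assume "A \<in> sets ?M" "B \<in> sets ?I"
  then have A: "A \<in> sets borel" and B: "B \<in> sets borel" by auto
  let ?\<mu> = "distr (density ?J (indicator (A \<times> UNIV))) borel snd"
  let ?\<nu> = "scale_measure (emeasure ?M A) ?I"
  have \<mu>: "emeasure ?\<mu> B = emeasure ?J (A \<times> B)" if [measurable]: "B \<in> sets borel" for B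
  proof -
    have [measurable]: "A \<in> sets borel" by (rule A)
    have "emeasure ?\<mu> B = emeasure (density ?J (indicator (A \<times> UNIV))) (UNIV \<times> B)"
      by (subst emeasure_distr) (auto intro!: arg_cong2[where f = emeasure] simp: space_pair_measure)
    also have "\<dots> = emeasure ?J ((A \<times> UNIV) \<inter> (UNIV \<times> B))"
      by (rule emeasure_restricted) (auto)
    also have "(A \<times> UNIV) \<inter> (UNIV \<times> B) = A \<times> B" by auto
    finally show ?thesis .
  qed
  have \<nu>: "emeasure ?\<nu> B = emeasure ?M A * emeasure ?I B" for B by simp
  have "?\<mu> = ?\<nu>"
  proof (rule borel_measure_eqI_greaterThan)
    show "finite_measure ?\<mu>"
    proof
      show "emeasure ?\<mu> (space ?\<mu>) \<noteq> \<infinity>" using \<mu>[of UNIV] by simp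
    qed
    show "emeasure ?\<mu> {b<..} = emeasure ?\<nu> {b<..}" for b
      by (subst \<mu>, simp, subst \<nu>, rule strip[OF A])
  qed auto
  then show "emeasure ?M A * emeasure ?I B = emeasure ?J (A \<times> B)"
    using \<mu>[OF B] \<nu>[of B] by simp
qed


definition history :: "'a measure" where
  "history = sigma (space M) {X t -` A \<inter> space M | t A. 0 \<le> t \<and> A \<in> sets borel}"

lemma space_history: "space history = space M"
  unfolding history_def by (rule space_measure_of) auto

lemma sets_history: "sets history = sigma_sets (space M) {X t -` A \<inter> space M | t A. 0 \<le> t \<and> A \<in> sets borel}"
  unfolding history_def by (rule sets_measure_of) auto

lemma X_measurable_history: "t \<ge> 0 \<Longrightarrow> X t \<in> borel_measurable history"
proof (rule measurableI)
  fix A :: "real set" assume "t \<ge> 0" "A \<in> sets borel"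
  then show "X t -` A \<inter> space history \<in> sets history"
    unfolding sets_history space_history by (intro sigma_sets.Basic) blast
qed simp

lemma id_measurable_history: "(\<lambda>\<omega>. \<omega>) \<in> M \<rightarrow>\<^sub>M history"
proof -
  have "{X t -` A \<inter> space M | t A. 0 \<le> t \<and> A \<in> sets borel} \<subseteq> sets M"
    using X_measurable by (auto intro: measurable_sets)
  then have "sets history \<subseteq> sets M"
    unfolding sets_history by (rule sets.sigma_sets_subset)
  then show ?thesis
    by (intro measurableI) (auto simp: space_history)
qed

context
  fixes q :: real and T :: "'a \<Rightarrow> real"
  assumes q: "q > 0" and T_exp: "distributed M lborel T (exponential_density q)"
    and T_indep: "indep_of_process M X T"
begin

lemma T_measurable [measurable]: "T \<in> borel_measurable M"
  using T_exp by (auto simp: distributed_def)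

lemma T_nonneg: "AE \<omega> in M. 0 \<le> T \<omega>"
proof -
  have eq: "distr M lborel T = density lborel (exponential_density q)"
    using T_exp by (simp add: distributed_def)
  have "AE t in distr M lborel T. 0 \<le> t" unfolding eq by (rule AE_exponential_nonneg)
  then show ?thesis by (subst (asm) AE_distr_iff) auto
qed

text \<open>
  The clock \<open>T\<close> and the identity map take values in different spaces, so their independence is
  expressed by the product form of their joint law.
\<close>

lemma clock_history_law:
  "distr M (borel \<Otimes>\<^sub>M history) (\<lambda>\<omega>. (T \<omega>, \<omega>)) = distr M borel T \<Otimes>\<^sub>M distr M history (\<lambda>\<omega>. \<omega>)"
proof (rule pair_measure_eqI[symmetric])
  let ?D = "distr M (borel \<Otimes>\<^sub>M history) (\<lambda>\<omega>. (T \<omega>, \<omega>))"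
  interpret H: prob_space "distr M history (\<lambda>\<omega>. \<omega>)"
    by (rule prob_space_distr[OF id_measurable_history])
  interpret D: prob_space "distr M borel T"
    by (rule prob_space_distr) measurable
  show "sigma_finite_measure (distr M borel T)" "sigma_finite_measure (distr M history (\<lambda>\<omega>. \<omega>))"
    by unfold_locales
  show "sets (distr M borel T \<Otimes>\<^sub>M distr M history (\<lambda>\<omega>. \<omega>)) = sets ?D"
    by (simp cong: sets_pair_measure_cong)
  have pm: "(\<lambda>\<omega>. (T \<omega>, \<omega>)) \<in> M \<rightarrow>\<^sub>M borel \<Otimes>\<^sub>M history"
    by (intro measurable_Pair T_measurable id_measurable_history)
  fix A B assume "A \<in> sets (distr M borel T)" "B \<in> sets (distr M history (\<lambda>\<omega>. \<omega>))"
  then have A: "A \<in> sets borel" and B: "B \<in> sets history" by auto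
  have sub: "B \<subseteq> space M" using sets.sets_into_space[OF B] by (simp add: space_history)
  have ind: "indep_set (sets history) {T -` A \<inter> space M | A. A \<in> sets borel}"
    using T_indep unfolding indep_of_process_def sets_history .
  have "prob (B \<inter> (T -` A \<inter> space M)) = prob B * prob (T -` A \<inter> space M)"
    using ind A B unfolding indep_sets2_eq by blast
  moreover have "B \<inter> (T -` A \<inter> space M) = (\<lambda>\<omega>. (T \<omega>, \<omega>)) -` (A \<times> B) \<inter> space M"
    using sub by auto
  moreover have "(\<lambda>\<omega>. \<omega>) -` B \<inter> space M = B" using sub by auto
  moreover have "A \<times> B \<in> sets (borel \<Otimes>\<^sub>M history)" using A B by (rule pair_measureI)
  ultimately show "emeasure (distr M borel T) A * emeasure (distr M history (\<lambda>\<omega>. \<omega>)) B = emeasure ?D (A \<times> B)"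
    using A B by (simp add: emeasure_distr pm id_measurable_history emeasure_eq_measure ennreal_mult[symmetric] mult.commute)
qed

text \<open>
  Replaces the given clock by the one of the product space.  The function must be measurable with
  respect to \<open>history\<close>, because \<open>T\<close> is independent of the process only.
\<close>

lemma clock_joint_law:
  assumes G: "G \<in> borel \<Otimes>\<^sub>M history \<rightarrow>\<^sub>M N"
  shows "distr M N (\<lambda>\<omega>. G (T \<omega>, \<omega>)) = distr (clocked q) N G"
proof -
  let ?E = "density lborel (exponential_density q)"
  have E: "distr M borel T = ?E"
  proof -
    have "distr M borel T = distr M lborel T" by (rule distr_cong) auto
    then show ?thesis using T_exp by (simp add: distributed_def)
  qed
  have idE: "distr ?E borel (\<lambda>t. t) = ?E"
    by (rule distr_id2) simp
  have idm: "(\<lambda>t. t) \<in> ?E \<rightarrow>\<^sub>M borel" by simp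
  interpret H: prob_space "distr M history (\<lambda>\<omega>. \<omega>)"
    by (rule prob_space_distr[OF id_measurable_history])
  have pm: "(\<lambda>\<omega>. (T \<omega>, \<omega>)) \<in> M \<rightarrow>\<^sub>M borel \<Otimes>\<^sub>M history"
    by (intro measurable_Pair T_measurable id_measurable_history)
  have cm: "(\<lambda>(x, y). (x, y)) \<in> clocked q \<rightarrow>\<^sub>M borel \<Otimes>\<^sub>M history"
    unfolding case_prod_beta
    by (intro measurable_Pair measurable_compose[OF measurable_fst idm] measurable_compose[OF measurable_snd id_measurable_history])
  have "distr M (borel \<Otimes>\<^sub>M history) (\<lambda>\<omega>. (T \<omega>, \<omega>)) = distr M borel T \<Otimes>\<^sub>M distr M history (\<lambda>\<omega>. \<omega>)"
    by (rule clock_history_law)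
  also have "\<dots> = distr ?E borel (\<lambda>t. t) \<Otimes>\<^sub>M distr M history (\<lambda>\<omega>. \<omega>)"
    unfolding E idE ..
  also have "\<dots> = distr (clocked q) (borel \<Otimes>\<^sub>M history) (\<lambda>(x, y). (x, y))"
    by (rule pair_measure_distr[OF idm id_measurable_history H.sigma_finite_measure_axioms])
  finally have "distr (distr M (borel \<Otimes>\<^sub>M history) (\<lambda>\<omega>. (T \<omega>, \<omega>))) N G =
      distr (distr (clocked q) (borel \<Otimes>\<^sub>M history) (\<lambda>(x, y). (x, y))) N G"
    by (rule arg_cong)
  moreover have "G \<circ> (\<lambda>(x, y). (x, y)) = G" by auto
  moreover have "G \<circ> (\<lambda>\<omega>. (T \<omega>, \<omega>)) = (\<lambda>\<omega>. G (T \<omega>, \<omega>))" by auto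
  ultimately show ?thesis
    by (simp only: distr_distr[OF G pm] distr_distr[OF G cm])
qed

lemma expectation_at_clock:
  fixes e :: "real \<Rightarrow> complex" and Y :: "real \<Rightarrow> 'a \<Rightarrow> real"
  assumes e[measurable]: "e \<in> borel_measurable borel"
    and Y: "(\<lambda>(t, \<omega>). Y (max 0 t) \<omega>) \<in> borel_measurable (borel \<Otimes>\<^sub>M history)"
    and empty: "\<And>t \<omega>. t < 0 \<Longrightarrow> Y t \<omega> = (c :: real)"
  shows "(LINT \<omega>|M. e (Y (T \<omega>) \<omega>)) = (LINT y|distr (clocked q) borel (\<lambda>(t, \<omega>). Y (max 0 t) \<omega>). e y)"
proof -
  let ?G = "\<lambda>(t, \<omega>). Y (max 0 t) \<omega>"
  have pm: "(\<lambda>\<omega>. (T \<omega>, \<omega>)) \<in> M \<rightarrow>\<^sub>M borel \<Otimes>\<^sub>M history"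
    by (intro measurable_Pair T_measurable id_measurable_history)
  have [measurable]: "(\<lambda>\<omega>. Y (max 0 (T \<omega>)) \<omega>) \<in> borel_measurable M"
    using measurable_compose[OF pm Y] by simp
  have "(\<lambda>\<omega>. Y (T \<omega>) \<omega>) = (\<lambda>\<omega>. if T \<omega> < 0 then c else Y (max 0 (T \<omega>)) \<omega>)"
    using empty by (auto simp: fun_eq_iff max_def)
  then have [measurable]: "(\<lambda>\<omega>. Y (T \<omega>) \<omega>) \<in> borel_measurable M" by simp
  have "(LINT \<omega>|M. e (Y (T \<omega>) \<omega>)) = (LINT \<omega>|M. e (?G (T \<omega>, \<omega>)))"
  proof (rule integral_cong_AE)
    show "AE \<omega> in M. e (Y (T \<omega>) \<omega>) = e (?G (T \<omega>, \<omega>))"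
      using T_nonneg by eventually_elim (simp add: max_def)
    show "(\<lambda>\<omega>. e (?G (T \<omega>, \<omega>))) \<in> borel_measurable M"
      unfolding prod.case by measurable
  qed measurable
  also have "\<dots> = (LINT y|distr M borel (\<lambda>\<omega>. ?G (T \<omega>, \<omega>)). e y)"
    by (rule integral_distr[symmetric]) auto
  also have "\<dots> = (LINT y|distr (clocked q) borel ?G. e y)"
    unfolding clock_joint_law[OF Y] ..
  finally show ?thesis .
qed

lemma wh_plus_eq: "wh_plus M X T \<xi> = (LINT m|distr (clocked q) borel end_max. exp (\<i> * \<xi> * of_real m))"
  unfolding wh_plus_def end_max_def
  by (rule expectation_at_clock[where c = "Sup {}"])
     (use clock_measurable(2)[OF space_history X_measurable_history] in \<open>auto simp: running_max_def\<close>)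

lemma wh_minus_eq: "wh_minus M X T \<xi> = (LINT m|distr (clocked q) borel end_min. exp (\<i> * \<xi> * of_real m))"
  unfolding wh_minus_def end_min_def
  by (rule expectation_at_clock[where c = "Inf {}"])
     (use clock_measurable(3)[OF space_history X_measurable_history] in \<open>auto simp: running_min_def\<close>)

end

text \<open>
  The factor \<open>q * exp (- q * t)\<close> is the density of the clock, so this is Fubini's theorem.
\<close>

lemma joint_V_laplace_eq:
  assumes q: "q > 0" and x2: "x2 \<le> a2"
  shows "q * joint_V_laplace M X a1 a2 q x1 x2 =
    measure (clocked q) {z \<in> space (clocked q). end_value z \<le> a1 - x1 \<and> end_max z \<le> a2 - x1}"
proof -
  let ?E = "density lborel (exponential_density q)"
  interpret E: prob_space ?E by (rule prob_space_exponential_density[OF q])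
  interpret P: pair_prob_space ?E M ..
  let ?A = "{z \<in> space (clocked q). end_value z \<le> a1 - x1 \<and> end_max z \<le> a2 - x1}"
  define v where "v t = measure M {\<omega> \<in> space M. end_value (t, \<omega>) \<le> a1 - x1 \<and> end_max (t, \<omega>) \<le> a2 - x1}" for t
  have ind: "integrable (clocked q) (indicat_real ?A)"
    by (rule P.integrable_const_bound[of _ 1]) auto
  have sec: "(LINT \<omega>|M. indicat_real ?A (t, \<omega>)) = v t" for t
  proof -
    have "(LINT \<omega>|M. indicat_real ?A (t, \<omega>)) =
        (LINT \<omega>|M. indicat_real {\<omega> \<in> space M. end_value (t, \<omega>) \<le> a1 - x1 \<and> end_max (t, \<omega>) \<le> a2 - x1} \<omega>)"
      by (intro Bochner_Integration.integral_cong refl) (auto simp: indicator_def space_pair_measure)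
    also have "\<dots> = measure M ({\<omega> \<in> space M. end_value (t, \<omega>) \<le> a1 - x1 \<and> end_max (t, \<omega>) \<le> a2 - x1} \<inter> space M)"
      by simp
    also have "\<dots> = v t"
      unfolding v_def by (rule arg_cong[where f = "measure M"]) auto
    finally show ?thesis .
  qed
  have v_meas[measurable]: "v \<in> borel_measurable borel"
    using P.integrable_fst'[OF ind] unfolding sec by (auto dest: borel_measurable_integrable)
  have "?A \<inter> space (clocked q) = ?A" by auto
  then have "measure (clocked q) ?A = (LINT z|clocked q. indicat_real ?A z)" by simp
  also have "\<dots> = (LINT t|?E. LINT \<omega>|M. indicat_real ?A (t, \<omega>))"
    by (rule P.integral_fst'[OF ind, symmetric])
  also have "\<dots> = (LINT t|lborel. exponential_density q t *\<^sub>R v t)"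
    unfolding sec
  proof (rule integral_density)
    show "AE t in lborel. 0 \<le> exponential_density q t"
      using exponential_density_nonneg[OF q] by simp
  qed measurable
  also have "\<dots> = (LINT t|lborel. q * (indicator {0..} t *\<^sub>R (exp (- q * t) * joint_V M X a1 a2 t x1 x2)))"
  proof (intro Bochner_Integration.integral_cong refl)
    fix t :: real
    show "exponential_density q t *\<^sub>R v t = q * (indicator {0..} t *\<^sub>R (exp (- q * t) * joint_V M X a1 a2 t x1 x2))"
    proof (cases "t < 0")
      case False
      have "joint_V M X a1 a2 t x1 x2 = v t"
      proof -
        have "max 0 t = t" using False by simp
        then have "x1 + X t \<omega> \<le> a1 \<and> max x2 (x1 + running_max X t \<omega>) \<le> a2 \<longleftrightarrow>
            end_value (t, \<omega>) \<le> a1 - x1 \<and> end_max (t, \<omega>) \<le> a2 - x1" for \<omega>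
          unfolding end_value_def end_max_def prod.case using x2 by (auto simp: algebra_simps)
        then show ?thesis unfolding joint_V_def v_def by (simp only:)
      qed
      then show ?thesis using False by (simp add: exponential_density_def mult.commute)
    qed (simp add: exponential_density_def)
  qed
  finally show ?thesis by (simp add: joint_V_laplace_def set_lebesgue_integral_def)
qed

text \<open>
  The norm of an expectation is at most the expectation of the norm, which depends only on \<open>Im \<xi>\<close>.
  Thus positivity of \<open>q + \<psi>\<close> on the imaginary axis gives positivity of \<open>Re (q + \<psi>)\<close> on the whole line.
\<close>

lemma char_exponent_Re_ge:
  assumes mom: "integrable M (\<lambda>\<omega>. exp (- \<gamma> * X 1 \<omega>))" and \<xi>: "Im \<xi> = \<gamma>"
  shows "Re (char_exponent M X (\<i> * of_real \<gamma>)) \<le> Re (char_exponent M X \<xi>)"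
proof -
  have "norm (LINT \<omega>|M. exp (\<i> * \<xi> * of_real (X 1 \<omega>))) \<le> (LINT \<omega>|M. norm (exp (\<i> * \<xi> * of_real (X 1 \<omega>))))"
    by (rule integral_norm_bound)
  also have "\<dots> = norm (of_real (LINT \<omega>|M. exp (- \<gamma> * X 1 \<omega>)) :: complex)"
    using \<xi> by (simp add: integral_nonneg_AE)
  also have "complex_of_real (LINT \<omega>|M. exp (- \<gamma> * X 1 \<omega>)) = (LINT \<omega>|M. exp (\<i> * (\<i> * of_real \<gamma>) * of_real (X 1 \<omega>)))"
    by (subst integral_complex_of_real[symmetric]) (simp add: exp_of_real[symmetric] mult.assoc[symmetric])
  finally show ?thesis
    unfolding char_exponent_moment[OF mom \<xi> zero_le_one] using char_exponent_moment[OF mom, of "\<i> * of_real \<gamma>" 1] by simp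
qed

lemma end_value_moment:
  assumes q: "q > 0" and mom: "integrable M (\<lambda>\<omega>. exp (- \<gamma> * X 1 \<omega>))"
    and pos: "q + Re (char_exponent M X (\<i> * of_real \<gamma>)) > 0"
  shows "integrable (clocked q) (\<lambda>z. exp (- \<gamma> * end_value z))"
    and "Im \<xi> = \<gamma> \<Longrightarrow> (LINT z|clocked q. exp (\<i> * \<xi> * of_real (end_value z))) = of_real q / (of_real q + char_exponent M X \<xi>)"
proof -
  let ?\<rho> = "Re (char_exponent M X (\<i> * of_real \<gamma>))"
  let ?e = "\<lambda>\<xi> t \<omega>. exp (\<i> * \<xi> * of_real (end_value (t, \<omega>)))"
  let ?E = "density lborel (exponential_density q)"
  interpret E: prob_space ?E by (rule prob_space_exponential_density[OF q])
  interpret P: pair_prob_space ?E M ..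
  have mgf: "(LINT \<omega>|M. ?e \<xi> t \<omega>) = exp (- of_real t * char_exponent M X \<xi>)"
    if "t \<ge> 0" "Im \<xi> = \<gamma>" for t \<xi>
    using char_exponent_moment[OF mom that(2,1)] that(1) by (simp add: end_value_def max_def)
  have rmgf: "(LINT \<omega>|M. exp (- \<gamma> * end_value (t, \<omega>))) = exp (- t * Re (char_exponent M X (\<i> * of_real \<gamma>)))" if t: "t \<ge> 0" for t
  proof -
    have "complex_of_real (LINT \<omega>|M. exp (- \<gamma> * end_value (t, \<omega>))) = (LINT \<omega>|M. exp (\<i> * (\<i> * of_real \<gamma>) * of_real (end_value (t, \<omega>))))"
      by (subst integral_complex_of_real[symmetric]) (simp add: exp_of_real[symmetric] mult.assoc[symmetric])
    also have "\<dots> = exp (- of_real t * char_exponent M X (\<i> * of_real \<gamma>))" using t by (intro mgf) auto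
    finally have "norm (complex_of_real (LINT \<omega>|M. exp (- \<gamma> * end_value (t, \<omega>)))) = norm (exp (- of_real t * char_exponent M X (\<i> * of_real \<gamma>)))"
      by (rule arg_cong)
    then show ?thesis by (simp add: integral_nonneg_AE)
  qed
  have E_int: "(LINT t|?E. exp (- of_real t * z)) = of_real q / (of_real q + z)"
    and E_integrable: "integrable ?E (\<lambda>t. exp (- of_real t * z))"
    if z: "q + Re z > 0" for z :: complex
  proof -
    have decay_kernel_eq: "AE t in lborel. of_real q * decay_kernel (of_real q + z) t = exponential_density q t *\<^sub>R exp (- of_real t * z)"
      using AE_lborel_singleton[of "0::real"]
    proof eventually_elim
      fix t :: real assume "t \<noteq> 0"
      have "exp (- (of_real q + z) * of_real t) = of_real (exp (- t * q)) * exp (- of_real t * z)"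
        by (simp add: exp_of_real[symmetric] algebra_simps flip: exp_add)
      then show "of_real q * decay_kernel (of_real q + z) t = exponential_density q t *\<^sub>R exp (- of_real t * z)"
        using \<open>t \<noteq> 0\<close> by (simp add: decay_kernel_def exponential_density_def scaleR_conv_of_real)
    qed
    have k: "integrable lborel (\<lambda>t. of_real q * decay_kernel (of_real q + z) t)"
      using decay_kernel_integrable[of "of_real q + z"] z by simp
    have "integrable lborel (\<lambda>t. exponential_density q t *\<^sub>R exp (- of_real t * z))"
      using k by (rule integrable_cong_AE_imp) (use decay_kernel_eq in \<open>auto elim!: eventually_mono\<close>)
    then show "integrable ?E (\<lambda>t. exp (- of_real t * z))"
      using q by (subst integrable_density) (auto simp: exponential_density_nonneg)
    have "(LINT t|?E. exp (- of_real t * z)) = (LINT t|lborel. exponential_density q t *\<^sub>R exp (- of_real t * z))"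
      using q by (subst integral_density) (auto simp: exponential_density_nonneg)
    also have "\<dots> = (LINT t|lborel. of_real q * decay_kernel (of_real q + z) t)"
      by (rule integral_cong_AE) (use decay_kernel_eq in \<open>auto elim!: eventually_mono\<close>)
    also have "\<dots> = of_real q * (1 / (of_real q + z))"
      using decay_kernel_integral[of "of_real q + z"] z by simp
    finally show "(LINT t|?E. exp (- of_real t * z)) = of_real q / (of_real q + z)" by simp
  qed
  show int: "integrable (clocked q) (\<lambda>z. exp (- \<gamma> * end_value z))"
  proof (rule P.Fubini_integrable)
    have "integrable ?E (\<lambda>t. exp (- of_real t * complex_of_real ?\<rho>))"
      using pos by (intro E_integrable) simp
    then have i: "integrable ?E (\<lambda>t. norm (exp (- of_real t * complex_of_real ?\<rho>)))"
      by (rule integrable_norm)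
    show "integrable ?E (\<lambda>t. LINT \<omega>|M. norm (exp (- \<gamma> * end_value (t, \<omega>))))"
    proof (rule integrable_cong_AE_imp[OF i])
      show "AE t in ?E. norm (exp (- of_real t * complex_of_real ?\<rho>)) =
          (LINT \<omega>|M. norm (exp (- \<gamma> * end_value (t, \<omega>))))"
        using AE_exponential_nonneg
      proof eventually_elim
        fix t :: real assume "0 \<le> t"
        from rmgf[OF this]
        show "norm (exp (- of_real t * complex_of_real ?\<rho>)) =
          (LINT \<omega>|M. norm (exp (- \<gamma> * end_value (t, \<omega>))))" by simp
      qed
    qed measurable
    show "AE t in ?E. integrable M (\<lambda>\<omega>. exp (- \<gamma> * end_value (t, \<omega>)))"
      using exp_moment_integrable[OF mom] by (intro AE_I2) (simp add: end_value_def)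
  qed measurable
  assume \<xi>: "Im \<xi> = \<gamma>"
  have ge: "q + Re (char_exponent M X \<xi>) > 0"
    using pos char_exponent_Re_ge[OF mom \<xi>] by simp
  have "integrable (clocked q) (\<lambda>z. exp (\<i> * \<xi> * of_real (end_value z)))"
    by (rule Bochner_Integration.integrable_bound[OF int]) (use \<xi> in auto)
  from P.integral_fst'[OF this]
  have "(LINT z|clocked q. exp (\<i> * \<xi> * of_real (end_value z))) = (LINT t|?E. LINT \<omega>|M. ?e \<xi> t \<omega>)"
    by simp
  also have "\<dots> = (LINT t|?E. exp (- of_real t * char_exponent M X \<xi>))"
  proof (rule integral_cong_AE)
    show "AE t in ?E. (LINT \<omega>|M. ?e \<xi> t \<omega>) = exp (- of_real t * char_exponent M X \<xi>)"
      using AE_exponential_nonneg by eventually_elim (rule mgf[OF _ \<xi>])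
  qed measurable
  also have "\<dots> = of_real q / (of_real q + char_exponent M X \<xi>)" by (rule E_int[OF ge])
  finally show "(LINT z|clocked q. exp (\<i> * \<xi> * of_real (end_value z))) = of_real q / (of_real q + char_exponent M X \<xi>)" .
qed

end

section \<open>The Laplace transform of the joint distribution function\<close>

theorem theorem3p5:
  fixes M :: "'a measure" and X :: "real \<Rightarrow> 'a \<Rightarrow> real" and T :: "'a \<Rightarrow> real"
    and q a1 a2 x1 x2 mu_minus mu_plus a_plus a_minus C_plus C_minus nu_plus nu_minus :: real
    and phi_pp phi_mm :: "complex \<Rightarrow> complex" and w_minus w1 :: real
  assumes levy: "levy_process M X"
    and q: "q > 0"
    and T_exp: "distributed M lborel T (exponential_density q)"
    and T_indep: "indep_of_process M X T"
    and a12: "a1 \<le> a2" and x12: "x1 \<le> x2" and x2a2: "x2 \<le> a2"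
    and mu: "mu_minus < 0" "0 < mu_plus"
    and moments: "\<And>\<gamma>. \<gamma> \<in> {mu_minus..mu_plus} \<Longrightarrow> integrable M (\<lambda>\<omega>. exp (- \<gamma> * X 1 \<omega>))"
    and psi_pos: "\<And>\<gamma>. \<gamma> \<in> {mu_minus..mu_plus} \<Longrightarrow> q + Re (char_exponent M X (\<i> * of_real \<gamma>)) > 0"
    and a_nonneg: "a_plus \<ge> 0" "a_minus \<ge> 0"
    and const_pos: "nu_plus > 0" "nu_minus > 0" "C_plus > 0" "C_minus > 0"
    and rep_plus: "\<And>\<xi>. Im \<xi> \<ge> mu_minus \<Longrightarrow> wh_plus M X T \<xi> = of_real a_plus + phi_pp \<xi>"
    and rep_minus: "\<And>\<xi>. Im \<xi> \<le> mu_plus \<Longrightarrow> wh_minus M X T \<xi> = of_real a_minus + phi_mm \<xi>"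
    and bound_plus: "\<And>\<xi>. Im \<xi> \<ge> mu_minus \<Longrightarrow>
          norm (phi_pp \<xi>) \<le> C_plus * (1 + norm \<xi>) powr (- nu_plus)"
    and bound_minus: "\<And>\<xi>. Im \<xi> \<le> mu_plus \<Longrightarrow>
          norm (phi_mm \<xi>) \<le> C_minus * (1 + norm \<xi>) powr (- nu_minus)"
    \<comment> \<open>otherwise the first integrand is asymptotic to a nonzero multiple of \<open>1 / \<xi>\<close> and the
      integral diverges\<close>
    and nondegenerate: "\<not> (x1 = a1 \<and> a_plus > 0 \<and> a_minus > 0)"
    and w_minus: "mu_minus < w_minus" "w_minus < 0"
    and w1: "0 < w1" "w1 < mu_plus"
  shows "line_integrable w1
           (\<lambda>\<xi>. exp (\<i> * of_real (x1 - a1) * \<xi>) / (- \<i> * \<xi> * (of_real q + char_exponent M X \<xi>))) \<and>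
         (\<forall>\<eta>. Im \<eta> = w_minus \<longrightarrow> line_integrable w1
           (\<lambda>\<xi>. exp (\<i> * \<xi> * of_real (a2 - a1)) * phi_mm \<xi> / (\<xi> * (\<xi> - \<eta>)))) \<and>
         line_integrable w_minus
           (\<lambda>\<eta>. exp (\<i> * of_real (x1 - a2) * \<eta>) * phi_pp \<eta> *
             line_integral w1
               (\<lambda>\<xi>. exp (\<i> * \<xi> * of_real (a2 - a1)) * phi_mm \<xi> / (\<xi> * (\<xi> - \<eta>)))) \<and>
         complex_of_real (joint_V_laplace M X a1 a2 q x1 x2) =
           1 / (2 * of_real pi) *
             line_integral w1
               (\<lambda>\<xi>. exp (\<i> * of_real (x1 - a1) * \<xi>) / (- \<i> * \<xi> * (of_real q + char_exponent M X \<xi>))) +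
           1 / ((2 * of_real pi)\<^sup>2 * of_real q) *
             line_integral w_minus
               (\<lambda>\<eta>. exp (\<i> * of_real (x1 - a2) * \<eta>) * phi_pp \<eta> *
                 line_integral w1
                   (\<lambda>\<xi>. exp (\<i> * \<xi> * of_real (a2 - a1)) * phi_mm \<xi> / (\<xi> * (\<xi> - \<eta>))))"
proof -
  interpret prob_space M using levy by (simp add: levy_process_def)
  interpret L: levy M X by unfold_locales (rule levy)
  interpret E: prob_space "L.clocked q" by (rule L.prob_space_clocked[OF q])
  let ?\<psi> = "char_exponent M X"
  define \<mu> where "\<mu> = distr (L.clocked q) borel L.end_max"
  define \<nu> where "\<nu> = distr (L.clocked q) borel L.end_min"
  have \<mu>: "prob_space \<mu>" "sets \<mu> = sets borel"
    unfolding \<mu>_def by (rule E.prob_space_distr, simp_all)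
  have \<nu>: "prob_space \<nu>" "sets \<nu> = sets borel"
    unfolding \<nu>_def by (rule E.prob_space_distr, simp_all)
  interpret \<mu>: prob_space \<mu> by fact
  interpret \<nu>: prob_space \<nu> by fact
  interpret MN: pair_prob_space \<mu> \<nu> ..
  have [measurable_cong]: "sets \<mu> = sets borel" "sets \<nu> = sets borel" by (fact \<mu>(2), fact \<nu>(2))
  \<comment> \<open>The reduction of the introduction; \<open>\<mu>\<close> and \<open>\<nu>\<close> are the laws of \<open>M\<close> and \<open>N\<close>.\<close>
  define h where "h = a1 - x1"
  define b where "b = a2 - x1"
  have b: "0 \<le> b" and hb: "h \<le> b" using a12 x12 x2a2 by (simp_all add: b_def h_def)
  have split: "distr (L.clocked q) (borel \<Otimes>\<^sub>M borel) (\<lambda>z. (L.end_max z, L.end_value z - L.end_max z)) = \<mu> \<Otimes>\<^sub>M \<nu>"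
    unfolding \<mu>_def \<nu>_def by (rule L.wiener_hopf_factorization[OF q])
  let ?Z = "\<lambda>z. (L.end_max z, L.end_value z - L.end_max z)"
  have Zm: "?Z \<in> L.clocked q \<rightarrow>\<^sub>M borel \<Otimes>\<^sub>M borel" by measurable
  have plus: "(LINT m|\<mu>. exp (\<i> * \<xi> * of_real m)) = of_real a_plus + phi_pp \<xi>" if "Im \<xi> \<ge> mu_minus" for \<xi>
    using rep_plus[OF that] unfolding L.wh_plus_eq[OF q T_exp T_indep] \<mu>_def .
  have minus: "(LINT n|\<nu>. exp (\<i> * \<xi> * of_real n)) = of_real a_minus + phi_mm \<xi>" if "Im \<xi> \<le> mu_plus" for \<xi>
    using rep_minus[OF that] unfolding L.wh_minus_eq[OF q T_exp T_indep] \<nu>_def .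
  have pair_int: "integrable (\<mu> \<Otimes>\<^sub>M \<nu>) (\<lambda>z. exp (- \<gamma> * (fst z + snd z)))" if "\<gamma> \<in> {mu_minus..mu_plus}" for \<gamma>
    unfolding split[symmetric]
    by (subst integrable_distr_eq[OF Zm]) (use L.end_value_moment(1)[OF q moments[OF that] psi_pos[OF that]] in simp_all)
  have w1_in: "w1 \<in> {mu_minus..mu_plus}" and wm_in: "w_minus \<in> {mu_minus..mu_plus}"
    using mu w1 w_minus by auto
  have int_\<mu>: "integrable \<mu> (\<lambda>m. exp (- w_minus * m))"
    by (rule pair_exp_integrable_factors(1)[OF \<mu> \<nu> pair_int[OF wm_in]])
  have int_\<nu>: "integrable \<nu> (\<lambda>n. exp (- w1 * n))"
    by (rule pair_exp_integrable_factors(2)[OF \<mu> \<nu> pair_int[OF w1_in]])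
  have int_\<mu>1: "integrable \<mu> (\<lambda>m. exp (- w1 * m))"
    by (rule pair_exp_integrable_factors(1)[OF \<mu> \<nu> pair_int[OF w1_in]])
  define f where "f u = phi_pp (Complex u w_minus)" for u
  define f1 where "f1 u = phi_pp (Complex u w1)" for u
  define g where "g u = phi_mm (Complex u w1)" for u
  have f_tr: "(LINT m|\<mu>. exp (\<i> * Complex u w_minus * of_real m)) = of_real a_plus + f u" for u
    unfolding f_def using w_minus by (intro plus) simp
  have f1_tr: "(LINT m|\<mu>. exp (\<i> * Complex u w1 * of_real m)) = of_real a_plus + f1 u" for u
    unfolding f1_def using w1 mu by (intro plus) simp
  have g_tr: "(LINT n|\<nu>. exp (\<i> * Complex u w1 * of_real n)) = of_real a_minus + g u" for u
    unfolding g_def using w1 by (intro minus) simp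
  have f_eq: "f = (\<lambda>u. (LINT m|\<mu>. exp (\<i> * Complex u w_minus * of_real m)) - of_real a_plus)"
    and f1_eq: "f1 = (\<lambda>u. (LINT m|\<mu>. exp (\<i> * Complex u w1 * of_real m)) - of_real a_plus)"
    and g_eq: "g = (\<lambda>u. (LINT n|\<nu>. exp (\<i> * Complex u w1 * of_real n)) - of_real a_minus)"
    by (simp_all only: f_tr f1_tr g_tr add_diff_cancel_left')
  have [measurable]: "f \<in> borel_measurable borel" "f1 \<in> borel_measurable borel" "g \<in> borel_measurable borel"
    unfolding f_eq f1_eq g_eq by measurable
  define r where "r = min nu_plus nu_minus"
  have r: "r > 0" "r \<le> nu_plus" "r \<le> nu_minus" using const_pos by (auto simp: r_def)
  have f_bd: "norm (f u) \<le> C_plus * (1 + \<bar>u\<bar>) powr (- nu_plus)" for u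
    unfolding f_def using w_minus const_pos by (intro line_decay[where \<phi> = phi_pp, OF bound_plus]) auto
  have g_bd: "norm (g u) \<le> C_minus * (1 + \<bar>u\<bar>) powr (- nu_minus)" for u
    unfolding g_def using w1 const_pos by (intro line_decay[where \<phi> = phi_mm, OF bound_minus]) auto
  have f1_bd': "norm (f1 u) \<le> C_plus * (1 + \<bar>u\<bar>) powr (- r)" for u
    unfolding f1_def using w1 mu const_pos r by (intro line_decay[where \<phi> = phi_pp, OF bound_plus]) auto
  have g_bd': "norm (g u) \<le> C_minus * (1 + \<bar>u\<bar>) powr (- r)" for u
    unfolding g_def using w1 const_pos r by (intro line_decay[where \<phi> = phi_mm, OF bound_minus]) auto
  note cross = max_crossing_probability[OF \<mu> \<nu> w_minus(2) w1(1) int_\<mu> int_\<nu> _ _ const_pos(1,2) f_bd g_bd f_tr g_tr b hb]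

  \<comment> \<open>The transform of the position is \<open>c + k\<close> on the line \<open>Im \<xi> = w1\<close>, with \<open>c\<close> its mass at \<open>0\<close>.\<close>
  define c where "c = complex_of_real (a_plus * a_minus)"
  define k where "k u = of_real a_plus * g u + of_real a_minus * f1 u + f1 u * g u" for u
  have [measurable]: "k \<in> borel_measurable borel" unfolding k_def[abs_def] by measurable
  have k_bd: "norm (k u) \<le> (a_plus * C_minus + a_minus * C_plus + C_plus * C_minus) * (1 + \<bar>u\<bar>) powr (- r)" for u
  proof -
    let ?p = "(1 + \<bar>u\<bar>) powr (- r)"
    have nz: "1 + \<bar>u\<bar> \<noteq> 0" by linarith
    have p: "0 \<le> ?p" "?p \<le> 1"
      using r powr_mono[of "- r" 0 "1 + \<bar>u\<bar>"] nz by (auto simp: powr_zero_eq_one)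
    have "norm (k u) \<le> norm (of_real a_plus * g u) + norm (of_real a_minus * f1 u) + norm (f1 u * g u)"
      unfolding k_def by (intro norm_triangle_le add_mono order_refl)
    also have "\<dots> = a_plus * norm (g u) + a_minus * norm (f1 u) + norm (f1 u) * norm (g u)"
      using a_nonneg by (simp add: norm_mult)
    also have "\<dots> \<le> a_plus * (C_minus * ?p) + a_minus * (C_plus * ?p) + (C_plus * ?p) * (C_minus * 1)"
    proof (intro add_mono mult_left_mono mult_mono f1_bd' g_bd')
      show "norm (g u) \<le> C_minus * 1"
        using g_bd'[of u] mult_left_mono[OF p(2), of C_minus] const_pos by linarith
    qed (use a_nonneg const_pos p in auto)
    finally show ?thesis by (simp add: algebra_simps)
  qed
  have X_tr: "(LINT z|L.clocked q. exp (\<i> * Complex u w1 * of_real (L.end_value z))) = c + k u" for u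
  proof -
    let ?e = "\<lambda>m. exp (\<i> * Complex u w1 * of_real m)"
    have "(LINT z|L.clocked q. ?e (L.end_value z)) = (LINT z|L.clocked q. ?e (fst (?Z z)) * ?e (snd (?Z z)))"
      by (simp add: algebra_simps flip: exp_add)
    also have "\<dots> = (LINT z|(\<mu> \<Otimes>\<^sub>M \<nu>). ?e (fst z) * ?e (snd z))"
      unfolding split[symmetric] by (rule integral_distr[OF Zm, symmetric]) measurable
    also have "\<dots> = (LINT m|\<mu>. LINT n|\<nu>. ?e m * ?e n)"
    proof -
      have "integrable (\<mu> \<Otimes>\<^sub>M \<nu>) (case_prod (\<lambda>m n. ?e m * ?e n))"
      proof (rule MN.integrable_pair_dominated[OF _ int_\<mu>1 int_\<nu>])
        show "norm (?e m * ?e n) \<le> exp (- w1 * m) * exp (- w1 * n)" for m n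
          by (simp add: norm_mult)
      qed measurable
      from MN.integral_fst[OF this] show ?thesis by (simp add: case_prod_unfold)
    qed
    also have "\<dots> = (of_real a_plus + f1 u) * (of_real a_minus + g u)"
      unfolding f1_tr[symmetric] g_tr[symmetric] by simp
    finally show ?thesis by (simp add: c_def k_def algebra_simps)
  qed
  have \<psi>: "of_real q + ?\<psi> (Complex u w1) = of_real q / (c + k u)" "c + k u \<noteq> 0" for u
  proof -
    have "c + k u = of_real q / (of_real q + ?\<psi> (Complex u w1))"
      unfolding X_tr[symmetric] by (rule L.end_value_moment(2)[OF q moments[OF w1_in] psi_pos[OF w1_in]]) simp
    moreover have "of_real q + ?\<psi> (Complex u w1) \<noteq> 0"
    proof -
      have "Re (?\<psi> (\<i> * of_real w1)) \<le> Re (?\<psi> (Complex u w1))"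
        by (rule L.char_exponent_Re_ge[OF moments[OF w1_in]]) simp
      then have pos: "Re (of_real q + ?\<psi> (Complex u w1)) > 0" using psi_pos[OF w1_in] by simp
      show ?thesis
      proof
        assume eq: "of_real q + ?\<psi> (Complex u w1) = 0"
        show False using pos unfolding eq by simp
      qed
    qed
    ultimately show "of_real q + ?\<psi> (Complex u w1) = of_real q / (c + k u)" "c + k u \<noteq> 0"
      using q by simp_all
  qed
  \<comment> \<open>If \<open>h = 0\<close>, the mass at \<open>0\<close> must vanish, as the improper integral exists only for \<open>h \<noteq> 0\<close>.\<close>
  have nondeg: "h = 0 \<Longrightarrow> c = 0"
    using nondegenerate a_nonneg by (auto simp: h_def c_def)
  note cdf = cdf_inversion[OF E.prob_space_axioms L.end_measurable(1) w1(1)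
      L.end_value_moment(1)[OF q moments[OF w1_in] psi_pos[OF w1_in]] _ r(1) k_bd X_tr nondeg]
  define I1 where "I1 = (\<lambda>\<xi>. exp (\<i> * of_real (x1 - a1) * \<xi>) / (- \<i> * \<xi> * (of_real q + ?\<psi> \<xi>)))"
  define p1 where "p1 = measure (L.clocked q) {z \<in> space (L.clocked q). L.end_value z \<le> h}"
  have first: "((\<lambda>u. I1 (Complex u w1)) has_integral (2 * of_real pi / of_real q * of_real p1)) UNIV"
  proof -
    let ?B = "\<lambda>u. exp (- \<i> * of_real h * Complex u w1) * k u / (- \<i> * Complex u w1)"
    let ?A = "\<lambda>u. exp (- \<i> * of_real h * Complex u w1) / (- \<i> * Complex u w1)"
    have split_I1: "I1 (Complex u w1) = 1 / of_real q * (c * ?A u + ?B u)" for u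
    proof -
      have "\<i> * of_real (x1 - a1) * Complex u w1 = - \<i> * of_real h * Complex u w1"
        by (simp add: h_def algebra_simps)
      then have "I1 (Complex u w1) = exp (- \<i> * of_real h * Complex u w1) / (- \<i> * Complex u w1 * (of_real q / (c + k u)))"
        unfolding I1_def \<psi>(1) by (simp only:)
      also have "\<dots> = 1 / of_real q * ((c + k u) * ?A u)"
        by (simp add: mult_ac)
      also have "(c + k u) * ?A u = c * ?A u + ?B u"
        by (simp add: distrib_right distrib_left add_divide_distrib mult.commute)
      finally show ?thesis .
    qed
    have B: "(?B has_integral (LINT u|lborel. ?B u)) UNIV"
      by (rule has_integral_integral_lborel[OF cdf(1)]) measurable
    have A: "((\<lambda>u. c * ?A u) has_integral (2 * of_real pi * (if h > 0 then c else 0))) UNIV"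
    proof (cases "h = 0")
      case True
      then show ?thesis using nondeg by simp
    next
      case False
      have eq: "?A u = of_real (exp (w1 * h)) * (exp (- \<i> * of_real u * of_real h) / (of_real w1 - \<i> * of_real u))" for u
      proof -
        have "- \<i> * Complex u w1 = of_real w1 - \<i> * of_real u" by (simp add: complex_eq_iff)
        moreover have "exp (- \<i> * of_real h * Complex u w1) = of_real (exp (w1 * h)) * exp (- \<i> * of_real u * of_real h)"
          using exp_i_Complex[of u w1 "- h"] by (simp add: mult_ac)
        ultimately show ?thesis by simp
      qed
      have "((\<lambda>u. c * ?A u) has_integral (c * (of_real (exp (w1 * h)) * (2 * of_real pi * decay_kernel (of_real w1) h)))) UNIV"
        unfolding eq by (intro has_integral_mult_right decay_kernel_has_integral w1(1) False)
      moreover have "complex_of_real (exp (w1 * h)) * decay_kernel (of_real w1) h = (if h > 0 then 1 else 0)"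
        by (simp add: decay_kernel_def exp_minus flip: exp_of_real)
      then have "c * (of_real (exp (w1 * h)) * (2 * of_real pi * decay_kernel (of_real w1) h)) = 2 * of_real pi * (if h > 0 then c else 0)"
        by (simp add: algebra_simps split: if_splits)
      ultimately show ?thesis by simp
    qed
    have "((\<lambda>u. 1 / of_real q * (c * ?A u + ?B u)) has_integral
        (1 / of_real q * (2 * of_real pi * (if h > 0 then c else 0) + (LINT u|lborel. ?B u)))) UNIV"
      by (intro has_integral_mult_right has_integral_add A B)
    moreover have "of_real p1 = (if h > 0 then c else 0) + 1 / (2 * of_real pi) * (LINT u|lborel. ?B u)"
      unfolding p1_def by (rule cdf(2)) measurable
    then have "1 / of_real q * (2 * of_real pi * (if h > 0 then c else 0) + (LINT u|lborel. ?B u)) = 2 * of_real pi / of_real q * of_real p1"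
      by (simp add: field_simps)
    ultimately show ?thesis unfolding split_I1 by (simp only:)
  qed

  define I2 where "I2 \<eta> = (\<lambda>\<xi>. exp (\<i> * \<xi> * of_real (a2 - a1)) * phi_mm \<xi> / (\<xi> * (\<xi> - \<eta>)))" for \<eta>
  define p2 where "p2 = measure (\<mu> \<Otimes>\<^sub>M \<nu>) {z \<in> space (\<mu> \<Otimes>\<^sub>M \<nu>). b < fst z \<and> fst z + snd z \<le> h}"
  have ab: "a2 - a1 = b - h" by (simp add: b_def h_def)
  have I2_line: "I2 \<eta> (Complex s w1) = exp (\<i> * Complex s w1 * of_real (b - h)) * g s / (Complex s w1 * (Complex s w1 - \<eta>))" for \<eta> s
    by (simp add: I2_def ab g_def)
  have I2_int: "integrable lborel (\<lambda>s. I2 (Complex u w_minus) (Complex s w1))" for u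
    unfolding I2_line by (rule cross(1)) measurable
  have inner: "line_integral w1 (I2 (Complex u w_minus)) = (LINT s|lborel. I2 (Complex u w_minus) (Complex s w1))" for u
    unfolding line_integral_def by (rule integral_lborel[OF I2_int])
  define I3 where "I3 = (\<lambda>\<eta>. exp (\<i> * of_real (x1 - a2) * \<eta>) * phi_pp \<eta> * line_integral w1 (I2 \<eta>))"
  have I3_line: "I3 (Complex u w_minus) = exp (- \<i> * of_real b * Complex u w_minus) * f u *
      (LINT s|lborel. exp (\<i> * Complex s w1 * of_real (b - h)) * g s / (Complex s w1 * (Complex s w1 - Complex u w_minus)))" for u
  proof -
    have "\<i> * of_real (x1 - a2) * Complex u w_minus = - \<i> * of_real b * Complex u w_minus"
      by (simp add: b_def algebra_simps)
    then show ?thesis unfolding I3_def inner I2_line f_def by (simp only:)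
  qed
  have I3_int: "integrable lborel (\<lambda>u. I3 (Complex u w_minus))"
    unfolding I3_line by (rule cross(2)) measurable
  have p2: "of_real p2 = - (1 / (2 * of_real pi)\<^sup>2) * (LINT u|lborel. I3 (Complex u w_minus))"
    unfolding I3_line p2_def by (rule cross(3)) measurable
  have V: "q * joint_V_laplace M X a1 a2 q x1 x2 = p1 - p2"
  proof -
    let ?S = "space (L.clocked q)"
    have "q * joint_V_laplace M X a1 a2 q x1 x2 = measure (L.clocked q) {z \<in> ?S. L.end_value z \<le> h \<and> L.end_max z \<le> b}"
      unfolding h_def b_def by (rule L.joint_V_laplace_eq[OF q x2a2])
    also have "{z \<in> ?S. L.end_value z \<le> h \<and> L.end_max z \<le> b} = {z \<in> ?S. L.end_value z \<le> h} - {z \<in> ?S. b < L.end_max z \<and> L.end_value z \<le> h}"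
      by auto
    also have "measure (L.clocked q) \<dots> = p1 - measure (L.clocked q) {z \<in> ?S. b < L.end_max z \<and> L.end_value z \<le> h}"
      unfolding p1_def
    proof (rule E.finite_measure_Diff)
      show "{z \<in> ?S. L.end_value z \<le> h} \<in> sets (L.clocked q)"
        "{z \<in> ?S. b < L.end_max z \<and> L.end_value z \<le> h} \<in> sets (L.clocked q)" by measurable
    qed auto
    also have "measure (L.clocked q) {z \<in> ?S. b < L.end_max z \<and> L.end_value z \<le> h} = p2"
    proof -
      have "{z \<in> space (borel \<Otimes>\<^sub>M borel :: (real \<times> real) measure). b < fst z \<and> fst z + snd z \<le> h} \<in> sets (borel \<Otimes>\<^sub>M borel)"
        by measurable
      then show ?thesis
        unfolding p2_def split[symmetric]
        by (subst measure_distr[OF Zm]) (auto intro!: arg_cong[where f = "measure (L.clocked q)"] simp: space_pair_measure)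
    qed
    finally show ?thesis .
  qed
  have "complex_of_real (joint_V_laplace M X a1 a2 q x1 x2) =
      1 / (2 * of_real pi) * line_integral w1 I1 + 1 / ((2 * of_real pi)\<^sup>2 * of_real q) * line_integral w_minus I3"
  proof -
    have l1: "line_integral w1 I1 = 2 * of_real pi / of_real q * of_real p1"
      unfolding line_integral_def by (rule integral_unique[OF first])
    have l3: "line_integral w_minus I3 = (LINT u|lborel. I3 (Complex u w_minus))"
      unfolding line_integral_def by (rule integral_lborel[OF I3_int])
    have "1 / ((2 * of_real pi)\<^sup>2 * of_real q) * line_integral w_minus I3 = - of_real p2 / of_real q"
      unfolding p2 l3 by simp
    moreover have "1 / (2 * of_real pi) * line_integral w1 I1 = of_real p1 / of_real q"
      unfolding l1 by simp
    moreover have "joint_V_laplace M X a1 a2 q x1 x2 = (p1 - p2) / q"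
      using V q by (simp add: field_simps)
    ultimately show ?thesis by (simp add: diff_divide_distrib)
  qed
  moreover have "line_integrable w1 I1"
    unfolding line_integrable_def using first by (rule has_integral_integrable)
  moreover have "line_integrable w1 (I2 \<eta>)" if "Im \<eta> = w_minus" for \<eta>
  proof -
    have "\<eta> = Complex (Re \<eta>) w_minus" using that by (simp add: complex_eq_iff)
    then show ?thesis
      unfolding line_integrable_def using integrable_on_lborel[OF I2_int[of "Re \<eta>"]] by simp
  qed
  moreover have "line_integrable w_minus I3"
    unfolding line_integrable_def by (rule integrable_on_lborel[OF I3_int])
  ultimately show ?thesis
    unfolding I1_def I2_def I3_def by blast
qed

end
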